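(* Let $G$ be a localic group with multiplication $m : G \times G \to G$, let $U, V \subseteq G$ be open sublocales, and let $S \subseteq U$ and $T \subseteq V$ be dense sublocales. Let $U \cdot V := m(U \times V)$ be the image of the open rectangle $U \times V$ under the open map $m$ (an open sublocale of $G$). Then the restriction of $m$ to $S \times T$, viewed as a map $m : S \times T \to U \cdot V$, is a pullback-stable epimorphism of locales.
   Context: Locales $X$ are given by their frames $\mathcal{O}(X)$ of open sets; continuous maps $f : X \to Y$ correspond to frame homomorphisms $f^* : \mathcal{O}(Y) \to \mathcal{O}(X)$; sublocales correspond to quotient frames, and open sets $U \in \mathcal{O}(X)$ are identified with open sublocales. Products of locales are given by coproducts of frames; $U \times V$ denotes the open rectangle. A localic group is a group object in the category of locales (multiplication $m$, inverse $i$, identity $e : 1 \to G$). A continuous map $f : X \to Y$ is open if $f^*$ has a left adjoint $U \mapsto f(U)$ which is pullback-stable: for any pullback of $f$ along $g : Z \to Y$ with projections $f' : Z \times_Y X \to Z$ and $g' : Z \times_Y X \to X$, one has $f'(g'^*(U)) = g^*(f(U))$. The multiplication $m$ of a localic group is an open map. A sublocale $A \subseteq X$ is dense if every nonempty open set of $X$ has nonempty pullback (restriction) to $A$. A continuous map is a pullback-stable epimorphism if every pullback of it along any continuous map is an epimorphism in the category of locales. *)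

theory Defs
  imports "HOL-Algebra.Complete_Lattice"
begin

text \<open>
  A locale \<open>X\<close> is represented by its frame of opens \<open>\<O>(X)\<close>, an ordered structure with explicit
  carrier, and a continuous map \<open>f : X \<rightarrow> Y\<close> by its inverse image \<open>f\<^sup>* : \<O>(Y) \<rightarrow> \<O>(X)\<close>.
  Hence composition of continuous maps is reversed composition of functions, and two parallel maps
  \<open>X \<rightarrow> Y\<close> are equal iff they agree on the carrier of \<open>Y\<close>.
\<close>

locale frame = complete_lattice +
  assumes meet_sup_distrib:
    "\<lbrakk>a \<in> carrier L; B \<subseteq> carrier L\<rbrakk> \<Longrightarrow> a \<sqinter> (\<Squnion>B) = \<Squnion>((\<lambda>b. a \<sqinter> b) ` B)"

definition frame_hom :: "'a gorder \<Rightarrow> 'b gorder \<Rightarrow> ('a \<Rightarrow> 'b) \<Rightarrow> bool" where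
  "frame_hom A B h \<longleftrightarrow> h \<in> carrier A \<rightarrow> carrier B \<and>
     h \<top>\<^bsub>A\<^esub> = \<top>\<^bsub>B\<^esub> \<and>
     (\<forall>x\<in>carrier A. \<forall>y\<in>carrier A. h (x \<sqinter>\<^bsub>A\<^esub> y) = h x \<sqinter>\<^bsub>B\<^esub> h y) \<and>
     (\<forall>K. K \<subseteq> carrier A \<longrightarrow> h (\<Squnion>\<^bsub>A\<^esub>K) = \<Squnion>\<^bsub>B\<^esub>(h ` K))"

definition cont_map :: "'a gorder \<Rightarrow> 'b gorder \<Rightarrow> ('b \<Rightarrow> 'a) \<Rightarrow> bool" where
  "cont_map X Y f \<longleftrightarrow> frame X \<and> frame Y \<and> frame_hom Y X f"

definition map_eq :: "'b gorder \<Rightarrow> ('b \<Rightarrow> 'a) \<Rightarrow> ('b \<Rightarrow> 'a) \<Rightarrow> bool" where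
  "map_eq Y f g \<longleftrightarrow> (\<forall>W\<in>carrier Y. f W = g W)"

abbreviation (input) map_comp :: "('c \<Rightarrow> 'b) \<Rightarrow> ('b \<Rightarrow> 'a) \<Rightarrow> 'c \<Rightarrow> 'a"  (infixl \<open>\<odot>\<close> 75) where
  "f \<odot> g \<equiv> g \<circ> f"

definition point :: "bool gorder" where
  "point = \<lparr>carrier = UNIV, eq = (=), le = (\<longrightarrow>)\<rparr>"

definition to_point :: "'a gorder \<Rightarrow> bool \<Rightarrow> 'a" where
  "to_point X p = (if p then \<top>\<^bsub>X\<^esub> else \<bottom>\<^bsub>X\<^esub>)"


subsection \<open>Products and pullbacks\<close>

text \<open>
  The frame coproduct of \<open>\<O>(X)\<close> and \<open>\<O>(Y)\<close> in its usual construction: a set \<open>D\<close> of pairs \<open>(x, y)\<close>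
  stands for the join of the rectangles \<open>x \<times> y\<close>, and the carrier consists of those \<open>D\<close> that are
  saturated under the relations satisfied by rectangles.  For the pushout of
  \<open>f\<^sup>* : \<O>(B) \<rightarrow> \<O>(X)\<close> and \<open>g\<^sup>* : \<O>(B) \<rightarrow> \<O>(Y)\<close> one adds the relation identifying
  \<open>f\<^sup>* b \<times> \<top>\<close> with \<open>\<top> \<times> g\<^sup>* b\<close>.
\<close>

definition c_ideal :: "'a gorder \<Rightarrow> 'b gorder \<Rightarrow> ('a \<times> 'b) set \<Rightarrow> bool" where
  "c_ideal X Y D \<longleftrightarrow> D \<subseteq> carrier X \<times> carrier Y \<and>
     (\<forall>x y x' y'. (x, y) \<in> D \<and> x' \<in> carrier X \<and> y' \<in> carrier Y \<and> x' \<sqsubseteq>\<^bsub>X\<^esub> x \<and> y' \<sqsubseteq>\<^bsub>Y\<^esub> y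
        \<longrightarrow> (x', y') \<in> D) \<and>
     (\<forall>K y. K \<subseteq> carrier X \<and> y \<in> carrier Y \<and> (\<forall>x\<in>K. (x, y) \<in> D) \<longrightarrow> (\<Squnion>\<^bsub>X\<^esub>K, y) \<in> D) \<and>
     (\<forall>x K. x \<in> carrier X \<and> K \<subseteq> carrier Y \<and> (\<forall>y\<in>K. (x, y) \<in> D) \<longrightarrow> (x, \<Squnion>\<^bsub>Y\<^esub>K) \<in> D)"

definition prod_loc :: "'a gorder \<Rightarrow> 'b gorder \<Rightarrow> ('a \<times> 'b) set gorder"  (infixl \<open>\<times>\<^sub>L\<close> 70) where
  "X \<times>\<^sub>L Y = \<lparr>carrier = {D. c_ideal X Y D}, eq = (=), le = (\<subseteq>)\<rparr>"

definition pullback ::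
    "'a gorder \<Rightarrow> 'b gorder \<Rightarrow> 'c gorder \<Rightarrow> ('c \<Rightarrow> 'a) \<Rightarrow> ('c \<Rightarrow> 'b) \<Rightarrow> ('a \<times> 'b) set gorder" where
  "pullback X Y B f g =
     \<lparr>carrier = {D. c_ideal X Y D \<and>
        (\<forall>x\<in>carrier X. \<forall>y\<in>carrier Y. \<forall>b\<in>carrier B.
           (x \<sqinter>\<^bsub>X\<^esub> f b, y) \<in> D \<longleftrightarrow> (x, y \<sqinter>\<^bsub>Y\<^esub> g b) \<in> D)},
      eq = (=), le = (\<subseteq>)\<rparr>"

text \<open>In both structures the open rectangle \<open>x \<times> y\<close> is the least element containing \<open>(x, y)\<close>.\<close>

definition rect :: "('a \<times> 'b) set gorder \<Rightarrow> 'a \<Rightarrow> 'b \<Rightarrow> ('a \<times> 'b) set" where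
  "rect P x y = \<Inter>{D \<in> carrier P. (x, y) \<in> D}"

definition pr1 :: "('a \<times> 'b) set gorder \<Rightarrow> 'b gorder \<Rightarrow> 'a \<Rightarrow> ('a \<times> 'b) set" where
  "pr1 P Y x = rect P x \<top>\<^bsub>Y\<^esub>"

definition pr2 :: "('a \<times> 'b) set gorder \<Rightarrow> 'a gorder \<Rightarrow> 'b \<Rightarrow> ('a \<times> 'b) set" where
  "pr2 P X y = rect P \<top>\<^bsub>X\<^esub> y"

text \<open>The map \<open>Z \<rightarrow> X \<times> Y\<close> (or \<open>Z \<rightarrow> X \<times>\<^sub>B Y\<close>) with components \<open>f : Z \<rightarrow> X\<close> and \<open>g : Z \<rightarrow> Y\<close>.\<close>

definition pairing :: "'z gorder \<Rightarrow> ('a \<Rightarrow> 'z) \<Rightarrow> ('b \<Rightarrow> 'z) \<Rightarrow> ('a \<times> 'b) set \<Rightarrow> 'z" where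
  "pairing Z f g D = \<Squnion>\<^bsub>Z\<^esub>((\<lambda>(x, y). f x \<sqinter>\<^bsub>Z\<^esub> g y) ` D)"

definition prod_map ::
    "'a gorder \<Rightarrow> 'b gorder \<Rightarrow> ('c \<Rightarrow> 'a) \<Rightarrow> ('d \<Rightarrow> 'b) \<Rightarrow> ('c \<times> 'd) set \<Rightarrow> ('a \<times> 'b) set" where
  "prod_map X Y f g =
     pairing (X \<times>\<^sub>L Y) (f \<odot> pr1 (X \<times>\<^sub>L Y) Y) (g \<odot> pr2 (X \<times>\<^sub>L Y) X)"


subsection \<open>Localic groups\<close>

definition localic_group ::
    "'g gorder \<Rightarrow> ('g \<Rightarrow> ('g \<times> 'g) set) \<Rightarrow> ('g \<Rightarrow> bool) \<Rightarrow> ('g \<Rightarrow> 'g) \<Rightarrow> bool" where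
  "localic_group G m e i \<longleftrightarrow>
     cont_map (G \<times>\<^sub>L G) G m \<and> cont_map point G e \<and> cont_map G G i \<and>
     (let GG = G \<times>\<^sub>L G; GGG = GG \<times>\<^sub>L G;
          a = pr1 GG G \<odot> pr1 GGG G; b = pr2 GG G \<odot> pr1 GGG G; c = pr2 GGG GG
      in map_eq G (m \<odot> pairing GGG (m \<odot> pairing GGG a b) c)
                  (m \<odot> pairing GGG a (m \<odot> pairing GGG b c))) \<and>
     map_eq G (m \<odot> pairing G (e \<odot> to_point G) id) id \<and>
     map_eq G (m \<odot> pairing G id (e \<odot> to_point G)) id \<and>
     map_eq G (m \<odot> pairing G i id) (e \<odot> to_point G) \<and>
     map_eq G (m \<odot> pairing G id i) (e \<odot> to_point G)"


subsection \<open>Sublocales and images\<close>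

text \<open>A sublocale of \<open>X\<close> is a locale \<open>S\<close> with a surjective frame homomorphism \<open>\<O>(X) \<rightarrow> \<O>(S)\<close>.\<close>

definition sublocale_incl :: "'s gorder \<Rightarrow> 'a gorder \<Rightarrow> ('a \<Rightarrow> 's) \<Rightarrow> bool" where
  "sublocale_incl S X s \<longleftrightarrow> cont_map S X s \<and> s ` carrier X = carrier S"

definition dense_sublocale :: "'s gorder \<Rightarrow> 'a gorder \<Rightarrow> ('a \<Rightarrow> 's) \<Rightarrow> bool" where
  "dense_sublocale S X s \<longleftrightarrow> sublocale_incl S X s \<and>
     (\<forall>W\<in>carrier X. W \<noteq> \<bottom>\<^bsub>X\<^esub> \<longrightarrow> s W \<noteq> \<bottom>\<^bsub>S\<^esub>)"

definition open_sub :: "'a gorder \<Rightarrow> 'a \<Rightarrow> 'a gorder" where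
  "open_sub X U = X\<lparr>carrier := {W \<in> carrier X. W \<sqsubseteq>\<^bsub>X\<^esub> U}\<rparr>"

definition open_incl :: "'a gorder \<Rightarrow> 'a \<Rightarrow> 'a \<Rightarrow> 'a" where
  "open_incl X U W = W \<sqinter>\<^bsub>X\<^esub> U"

text \<open>The value at \<open>U\<close> of the left adjoint of \<open>f\<^sup>*\<close>, for an open map \<open>f : X \<rightarrow> Y\<close>.\<close>

definition open_image :: "'a gorder \<Rightarrow> 'b gorder \<Rightarrow> ('b \<Rightarrow> 'a) \<Rightarrow> 'a \<Rightarrow> 'b" where
  "open_image X Y f U =
     (THE V. V \<in> carrier Y \<and> (\<forall>W\<in>carrier Y. V \<sqsubseteq>\<^bsub>Y\<^esub> W \<longleftrightarrow> U \<sqsubseteq>\<^bsub>X\<^esub> f W))"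

definition group_mult_opens :: "'g gorder \<Rightarrow> ('g \<Rightarrow> ('g \<times> 'g) set) \<Rightarrow> 'g \<Rightarrow> 'g \<Rightarrow> 'g" where
  "group_mult_opens G m U V = open_image (G \<times>\<^sub>L G) G m (rect (G \<times>\<^sub>L G) U V)"


subsection \<open>Epimorphisms\<close>

text \<open>
  A definition cannot quantify over types, so the types carrying the test locales are passed as
  parameters; a theorem in which \<open>'w\<close> and \<open>'z\<close> are free type variables covers all locales.
\<close>

definition epi :: "'w itself \<Rightarrow> 'a gorder \<Rightarrow> 'b gorder \<Rightarrow> ('b \<Rightarrow> 'a) \<Rightarrow> bool" where
  "epi _ X Y f \<longleftrightarrow> cont_map X Y f \<and>
     (\<forall>(W :: 'w gorder) u v. cont_map Y W u \<and> cont_map Y W v \<and> map_eq W (u \<odot> f) (v \<odot> f)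
        \<longrightarrow> map_eq W u v)"

definition pullback_stable_epi ::
    "'z itself \<Rightarrow> 'w itself \<Rightarrow> 'a gorder \<Rightarrow> 'b gorder \<Rightarrow> ('b \<Rightarrow> 'a) \<Rightarrow> bool" where
  "pullback_stable_epi _ w X Y f \<longleftrightarrow> cont_map X Y f \<and>
     (\<forall>(Z :: 'z gorder) g. cont_map Z Y g
        \<longrightarrow> (let P = pullback Z X Y g f in epi w P Z (pr1 P X)))"


subsection \<open>Universal property of the pullback\<close>

text \<open>
  The structure \<open>pullback X Y B f g\<close> is a pullback of locales, with \<open>pairing\<close> as mediating map
  (for test locales of arbitrary type), and \<open>X \<times>\<^sub>L Y\<close> is the pullback over the terminal locale.
\<close>

lemma frame_closure_system:
  fixes C :: "'p set set"
  assumes M: "M \<in> C" "\<And>D. D \<in> C \<Longrightarrow> D \<subseteq> M"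
    and I: "\<And>A. A \<subseteq> C \<Longrightarrow> A \<noteq> {} \<Longrightarrow> \<Inter>A \<in> C"
    and H: "\<And>D K. D \<in> C \<Longrightarrow> K \<in> C \<Longrightarrow> \<exists>H\<in>C. \<forall>E\<in>C. E \<subseteq> H \<longleftrightarrow> D \<inter> E \<subseteq> K"
  defines "L \<equiv> \<lparr>carrier = C, eq = (=), le = (\<subseteq>)\<rparr>"
  shows "frame L" and "\<top>\<^bsub>L\<^esub> = M" and "D \<in> C \<Longrightarrow> E \<in> C \<Longrightarrow> D \<sqinter>\<^bsub>L\<^esub> E = D \<inter> E"
    and "A \<subseteq> C \<Longrightarrow> \<Squnion>\<^bsub>L\<^esub>A = \<Inter>{D\<in>C. \<Union>A \<subseteq> D}"
proof -
  interpret partial_order L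
    by unfold_locales (auto simp: L_def)
  interpret complete_lattice L
  proof (rule complete_lattice_criterion1)
    show "\<exists>g. greatest L g (carrier L)"
      using M by (auto simp: greatest_def L_def)
    show "\<exists>i. is_glb L i A" if "A \<subseteq> carrier L" "A \<noteq> {}" for A
      using I[of A] that by (intro exI[of _ "\<Inter>A"]) (auto simp: greatest_def Lower_def L_def)
  qed
  have L: "carrier L = C" "le L = (\<subseteq>)" by (auto simp: L_def)
  have meet: "D \<sqinter>\<^bsub>L\<^esub> E = D \<inter> E" if "D \<in> C" "E \<in> C" for D E
  proof -
    have "D \<inter> E \<in> C" using I[of "{D,E}"] that by auto
    then have "D \<inter> E \<subseteq> D \<sqinter>\<^bsub>L\<^esub> E" using meet_le[of "D \<inter> E" D E] that by (auto simp: L)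
    then show ?thesis using meet_left[of D E] meet_right[of D E] that by (auto simp: L)
  qed
  have sup: "\<Squnion>\<^bsub>L\<^esub>A = \<Inter>{D\<in>C. \<Union>A \<subseteq> D}" if "A \<subseteq> C" for A
  proof (rule le_antisym)
    have ne: "M \<in> {D\<in>C. \<Union>A \<subseteq> D}" using that M by auto
    show c: "\<Inter>{D\<in>C. \<Union>A \<subseteq> D} \<in> carrier L" using ne I[of "{D\<in>C. \<Union>A \<subseteq> D}"] by (auto simp: L)
    show "\<Squnion>\<^bsub>L\<^esub>A \<in> carrier L" using that sup_closed[of A] by (simp add: L)
    show "\<Squnion>\<^bsub>L\<^esub>A \<sqsubseteq>\<^bsub>L\<^esub> \<Inter>{D\<in>C. \<Union>A \<subseteq> D}"
      using that by (intro sup_least c) (auto simp: L)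
    show "\<Inter>{D\<in>C. \<Union>A \<subseteq> D} \<sqsubseteq>\<^bsub>L\<^esub> \<Squnion>\<^bsub>L\<^esub>A"
      using sup_upper[of A] sup_closed[of A] that by (force simp: L)
  qed
  show "frame L"
  proof
    fix D B assume D: "D \<in> carrier L" and B: "B \<subseteq> carrier L"
    have im: "(\<lambda>b. D \<sqinter>\<^bsub>L\<^esub> b) ` B \<subseteq> carrier L" using D B by auto
    show "D \<sqinter>\<^bsub>L\<^esub> \<Squnion>\<^bsub>L\<^esub>B = \<Squnion>\<^bsub>L\<^esub>((\<lambda>b. D \<sqinter>\<^bsub>L\<^esub> b) ` B)"
    proof (rule le_antisym)
      obtain H where H: "H \<in> C" "\<And>E. E \<in> C \<Longrightarrow> E \<subseteq> H \<longleftrightarrow> D \<inter> E \<subseteq> \<Squnion>\<^bsub>L\<^esub>((\<lambda>b. D \<sqinter>\<^bsub>L\<^esub> b) ` B)"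
        using H[of D "\<Squnion>\<^bsub>L\<^esub>((\<lambda>b. D \<sqinter>\<^bsub>L\<^esub> b) ` B)"] D sup_closed[OF im] by (auto simp: L)
      have "\<Squnion>\<^bsub>L\<^esub>B \<sqsubseteq>\<^bsub>L\<^esub> H"
      proof (rule sup_least)
        fix b assume b: "b \<in> B"
        have "D \<sqinter>\<^bsub>L\<^esub> b \<subseteq> \<Squnion>\<^bsub>L\<^esub>((\<lambda>b. D \<sqinter>\<^bsub>L\<^esub> b) ` B)" using sup_upper[OF im] b by (auto simp: L)
        then show "b \<sqsubseteq>\<^bsub>L\<^esub> H" using H(2)[of b] b B D meet[of D b] by (auto simp: L)
      qed (use B H in \<open>auto simp: L\<close>)
      then show "D \<sqinter>\<^bsub>L\<^esub> \<Squnion>\<^bsub>L\<^esub>B \<sqsubseteq>\<^bsub>L\<^esub> \<Squnion>\<^bsub>L\<^esub>((\<lambda>b. D \<sqinter>\<^bsub>L\<^esub> b) ` B)"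
        using H(2)[of "\<Squnion>\<^bsub>L\<^esub>B"] sup_closed[of B] B D meet[of D "\<Squnion>\<^bsub>L\<^esub>B"] by (auto simp: L)
      show "\<Squnion>\<^bsub>L\<^esub>((\<lambda>b. D \<sqinter>\<^bsub>L\<^esub> b) ` B) \<sqsubseteq>\<^bsub>L\<^esub> D \<sqinter>\<^bsub>L\<^esub> \<Squnion>\<^bsub>L\<^esub>B"
      proof (rule sup_least[OF im])
        fix x assume "x \<in> (\<lambda>b. D \<sqinter>\<^bsub>L\<^esub> b) ` B"
        then obtain b where b: "b \<in> B" "x = D \<sqinter>\<^bsub>L\<^esub> b" by auto
        have "b \<subseteq> \<Squnion>\<^bsub>L\<^esub>B" using sup_upper[OF B b(1)] by (simp add: L)
        then show "x \<sqsubseteq>\<^bsub>L\<^esub> D \<sqinter>\<^bsub>L\<^esub> \<Squnion>\<^bsub>L\<^esub>B"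
          using b meet[of D b] meet[of D "\<Squnion>\<^bsub>L\<^esub>B"] D B sup_closed[OF B] by (auto simp: L)
      qed (use D B in auto)
    qed (use D B im in auto)
  qed
  show "\<top>\<^bsub>L\<^esub> = M" using M top_higher[of M] top_closed by (auto simp: L)
  show "D \<in> C \<Longrightarrow> E \<in> C \<Longrightarrow> D \<sqinter>\<^bsub>L\<^esub> E = D \<inter> E" by (rule meet)
  show "A \<subseteq> C \<Longrightarrow> \<Squnion>\<^bsub>L\<^esub>A = \<Inter>{D\<in>C. \<Union>A \<subseteq> D}" by (rule sup)
qed

context frame
begin

lemma meet_mono: "\<lbrakk>a \<sqsubseteq> a'; b \<sqsubseteq> b'; a \<in> carrier L; a' \<in> carrier L; b \<in> carrier L; b' \<in> carrier L\<rbrakk>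
   \<Longrightarrow> a \<sqinter> b \<sqsubseteq> a' \<sqinter> b'"
  by (meson le_trans meet_closed meet_le meet_left meet_right)

lemma sup_meet_distrib:
    "\<lbrakk>a \<in> carrier L; B \<subseteq> carrier L\<rbrakk> \<Longrightarrow> (\<Squnion>B) \<sqinter> a = \<Squnion>((\<lambda>b. b \<sqinter> a) ` B)"
  using meet_sup_distrib[of a B] by (simp add: meet_comm)

lemma meet_swap: "\<lbrakk>a \<in> carrier L; b \<in> carrier L; c \<in> carrier L\<rbrakk> \<Longrightarrow> (a \<sqinter> b) \<sqinter> c = (a \<sqinter> c) \<sqinter> b"
  by (metis meet_assoc meet_comm)

lemma meet_idem: "a \<in> carrier L \<Longrightarrow> a \<sqinter> a = a"
  by (metis le_iff_join le_refl)

end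

lemma c_idealD:
  assumes "c_ideal X Y D"
  shows "D \<subseteq> carrier X \<times> carrier Y"
    and "\<lbrakk>(x, y) \<in> D; x' \<in> carrier X; y' \<in> carrier Y; x' \<sqsubseteq>\<^bsub>X\<^esub> x; y' \<sqsubseteq>\<^bsub>Y\<^esub> y\<rbrakk> \<Longrightarrow> (x', y') \<in> D"
    and "\<lbrakk>K \<subseteq> carrier X; y \<in> carrier Y; \<And>x. x \<in> K \<Longrightarrow> (x, y) \<in> D\<rbrakk> \<Longrightarrow> (\<Squnion>\<^bsub>X\<^esub>K, y) \<in> D"
    and "\<lbrakk>K' \<subseteq> carrier Y; x \<in> carrier X; \<And>y. y \<in> K' \<Longrightarrow> (x, y) \<in> D\<rbrakk> \<Longrightarrow> (x, \<Squnion>\<^bsub>Y\<^esub>K') \<in> D"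
proof -
  note 1 = assms[unfolded c_ideal_def]
  show "D \<subseteq> carrier X \<times> carrier Y" using 1 by (rule conjunct1)
  show "\<lbrakk>(x, y) \<in> D; x' \<in> carrier X; y' \<in> carrier Y; x' \<sqsubseteq>\<^bsub>X\<^esub> x; y' \<sqsubseteq>\<^bsub>Y\<^esub> y\<rbrakk> \<Longrightarrow> (x', y') \<in> D"
    using 1[THEN conjunct2, THEN conjunct1] by metis
  show "\<lbrakk>K \<subseteq> carrier X; y \<in> carrier Y; \<And>x. x \<in> K \<Longrightarrow> (x, y) \<in> D\<rbrakk> \<Longrightarrow> (\<Squnion>\<^bsub>X\<^esub>K, y) \<in> D"
    using 1[THEN conjunct2, THEN conjunct2, THEN conjunct1] by simp
  show "\<lbrakk>K' \<subseteq> carrier Y; x \<in> carrier X; \<And>y. y \<in> K' \<Longrightarrow> (x, y) \<in> D\<rbrakk> \<Longrightarrow> (x, \<Squnion>\<^bsub>Y\<^esub>K') \<in> D"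
    using 1[THEN conjunct2, THEN conjunct2, THEN conjunct2] by simp
qed

lemma pullback_frame:
  assumes X: "frame X" and Y: "frame Y"
    and f: "\<And>b. b \<in> carrier B \<Longrightarrow> f b \<in> carrier X" and g: "\<And>b. b \<in> carrier B \<Longrightarrow> g b \<in> carrier Y"
  shows "frame (pullback X Y B f g)"
    and "\<top>\<^bsub>pullback X Y B f g\<^esub> = carrier X \<times> carrier Y"
    and "D \<in> carrier (pullback X Y B f g) \<Longrightarrow> E \<in> carrier (pullback X Y B f g) \<Longrightarrow> D \<sqinter>\<^bsub>pullback X Y B f g\<^esub> E = D \<inter> E"
    and "A \<subseteq> carrier (pullback X Y B f g) \<Longrightarrow> \<Squnion>\<^bsub>pullback X Y B f g\<^esub>A = \<Inter>{D\<in>carrier (pullback X Y B f g). \<Union>A \<subseteq> D}"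
    and "A \<subseteq> carrier (pullback X Y B f g) \<Longrightarrow> A \<noteq> {} \<Longrightarrow> \<Inter>A \<in> carrier (pullback X Y B f g)"
proof -
  interpret X: frame X by fact
  interpret Y: frame Y by fact
  define C where "C = {D. c_ideal X Y D \<and>
        (\<forall>x\<in>carrier X. \<forall>y\<in>carrier Y. \<forall>b\<in>carrier B.
           (x \<sqinter>\<^bsub>X\<^esub> f b, y) \<in> D \<longleftrightarrow> (x, y \<sqinter>\<^bsub>Y\<^esub> g b) \<in> D)}"
  have P: "pullback X Y B f g = \<lparr>carrier = C, eq = (=), le = (\<subseteq>)\<rparr>"
    by (simp add: pullback_def C_def)
  have M: "carrier X \<times> carrier Y \<in> C"
    using f g by (auto simp: C_def c_ideal_def)
  have M': "D \<subseteq> carrier X \<times> carrier Y" if "D \<in> C" for D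
    using that by (auto simp: C_def c_ideal_def)
  have I: "\<Inter>A \<in> C" if "A \<subseteq> C" "A \<noteq> {}" for A
  proof -
    have A: "c_ideal X Y D" "\<And>x y b. x \<in> carrier X \<Longrightarrow> y \<in> carrier Y \<Longrightarrow> b \<in> carrier B \<Longrightarrow>
           (x \<sqinter>\<^bsub>X\<^esub> f b, y) \<in> D \<longleftrightarrow> (x, y \<sqinter>\<^bsub>Y\<^esub> g b) \<in> D" if "D \<in> A" for D
      using that \<open>A \<subseteq> C\<close> unfolding C_def by blast+
    have "c_ideal X Y (\<Inter>A)"
      unfolding c_ideal_def
    proof (intro conjI allI impI; (elim conjE)?)
      show "\<Inter>A \<subseteq> carrier X \<times> carrier Y" using c_idealD(1)[OF A(1)] \<open>A \<noteq> {}\<close> by fast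
    next
      fix x y x' y' assume h: "(x,y) \<in> \<Inter>A" "x' \<in> carrier X" "y' \<in> carrier Y" "x' \<sqsubseteq>\<^bsub>X\<^esub> x" "y' \<sqsubseteq>\<^bsub>Y\<^esub> y"
      show "(x',y') \<in> \<Inter>A"
      proof
        fix D assume "D \<in> A"
        with h show "(x',y') \<in> D" by (auto intro: c_idealD(2)[OF A(1)[OF \<open>D \<in> A\<close>], where x=x and y=y])
      qed
    next
      fix K y assume h: "K \<subseteq> carrier X" "y \<in> carrier Y" "\<forall>x\<in>K. (x,y) \<in> \<Inter>A"
      show "(\<Squnion>\<^bsub>X\<^esub>K, y) \<in> \<Inter>A"
      proof
        fix D assume "D \<in> A"
        with h show "(\<Squnion>\<^bsub>X\<^esub>K, y) \<in> D" by (intro c_idealD(3)[OF A(1)]) auto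
      qed
    next
      fix x K assume h: "x \<in> carrier X" "K \<subseteq> carrier Y" "\<forall>y\<in>K. (x,y) \<in> \<Inter>A"
      show "(x, \<Squnion>\<^bsub>Y\<^esub>K) \<in> \<Inter>A"
      proof
        fix D assume "D \<in> A"
        with h show "(x, \<Squnion>\<^bsub>Y\<^esub>K) \<in> D" by (intro c_idealD(4)[OF A(1)]) auto
      qed
    qed
    then show ?thesis using A(2) by (simp add: C_def)
  qed
  have H: "\<exists>H\<in>C. \<forall>E\<in>C. E \<subseteq> H \<longleftrightarrow> D \<inter> E \<subseteq> K" if D: "D \<in> C" and K: "K \<in> C" for D K
  proof -
    have Dc: "c_ideal X Y D" and Kc: "c_ideal X Y K" using D K by (auto simp: C_def)
    have Kb: "(x \<sqinter>\<^bsub>X\<^esub> f b, y) \<in> K \<longleftrightarrow> (x, y \<sqinter>\<^bsub>Y\<^esub> g b) \<in> K" if "x \<in> carrier X" "y \<in> carrier Y" "b \<in> carrier B" for x y b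
      using that K by (auto simp: C_def)
    define H where "H = {(x,y). x \<in> carrier X \<and> y \<in> carrier Y \<and> (\<forall>(a,b)\<in>D. (x \<sqinter>\<^bsub>X\<^esub> a, y \<sqinter>\<^bsub>Y\<^esub> b) \<in> K)}"
    have D_car: "a \<in> carrier X" "b \<in> carrier Y" if "(a,b) \<in> D" for a b
      using that c_idealD(1)[OF Dc] by auto
    have HI: "(x,y) \<in> H" if "x \<in> carrier X" "y \<in> carrier Y" "\<And>a b. (a,b) \<in> D \<Longrightarrow> (x \<sqinter>\<^bsub>X\<^esub> a, y \<sqinter>\<^bsub>Y\<^esub> b) \<in> K" for x y
      using that by (auto simp: H_def)
    have HD: "x \<in> carrier X" "y \<in> carrier Y" "\<And>a b. (a,b) \<in> D \<Longrightarrow> (x \<sqinter>\<^bsub>X\<^esub> a, y \<sqinter>\<^bsub>Y\<^esub> b) \<in> K" if "(x,y) \<in> H" for x y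
      using that by (auto simp: H_def)
    have "c_ideal X Y H"
      unfolding c_ideal_def
    proof (intro conjI allI impI; (elim conjE)?)
      show "H \<subseteq> carrier X \<times> carrier Y" by (auto simp: H_def)
    next
      fix x y x' y' assume h: "(x,y) \<in> H" "x' \<in> carrier X" "y' \<in> carrier Y" "x' \<sqsubseteq>\<^bsub>X\<^esub> x" "y' \<sqsubseteq>\<^bsub>Y\<^esub> y"
      show "(x',y') \<in> H"
      proof (rule HI)
        fix a b assume ab: "(a,b) \<in> D"
        show "(x' \<sqinter>\<^bsub>X\<^esub> a, y' \<sqinter>\<^bsub>Y\<^esub> b) \<in> K"
          using HD(1,2)[OF h(1)] h(2-) D_car[OF ab]
          by (intro c_idealD(2)[OF Kc HD(3)[OF h(1) ab]] X.meet_closed Y.meet_closed X.meet_mono Y.meet_mono) auto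
      qed (use h in auto)
    next
      fix A y assume h: "A \<subseteq> carrier X" "y \<in> carrier Y" "\<forall>x\<in>A. (x,y) \<in> H"
      show "(\<Squnion>\<^bsub>X\<^esub>A, y) \<in> H"
      proof (rule HI)
        fix a b assume ab: "(a,b) \<in> D"
        show "(\<Squnion>\<^bsub>X\<^esub>A \<sqinter>\<^bsub>X\<^esub> a, y \<sqinter>\<^bsub>Y\<^esub> b) \<in> K"
          unfolding X.sup_meet_distrib[OF D_car(1)[OF ab] h(1)]
          using h D_car[OF ab] HD(3)[OF _ ab] by (intro c_idealD(3)[OF Kc]) auto
      qed (use h in auto)
    next
      fix x A assume h: "x \<in> carrier X" "A \<subseteq> carrier Y" "\<forall>y\<in>A. (x,y) \<in> H"
      show "(x, \<Squnion>\<^bsub>Y\<^esub>A) \<in> H"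
      proof (rule HI)
        fix a b assume ab: "(a,b) \<in> D"
        show "(x \<sqinter>\<^bsub>X\<^esub> a, \<Squnion>\<^bsub>Y\<^esub>A \<sqinter>\<^bsub>Y\<^esub> b) \<in> K"
          unfolding Y.sup_meet_distrib[OF D_car(2)[OF ab] h(2)]
          using h D_car[OF ab] HD(3)[OF _ ab] by (intro c_idealD(4)[OF Kc]) auto
      qed (use h in auto)
    qed
    moreover have "(x \<sqinter>\<^bsub>X\<^esub> f b, y) \<in> H \<longleftrightarrow> (x, y \<sqinter>\<^bsub>Y\<^esub> g b) \<in> H"
      if xyb: "x \<in> carrier X" "y \<in> carrier Y" "b \<in> carrier B" for x y b
    proof -
      have "((x \<sqinter>\<^bsub>X\<^esub> f b) \<sqinter>\<^bsub>X\<^esub> a, y \<sqinter>\<^bsub>Y\<^esub> c) \<in> K \<longleftrightarrow> (x \<sqinter>\<^bsub>X\<^esub> a, (y \<sqinter>\<^bsub>Y\<^esub> g b) \<sqinter>\<^bsub>Y\<^esub> c) \<in> K" if "(a,c) \<in> D" for a c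
        using Kb[of "x \<sqinter>\<^bsub>X\<^esub> a" "y \<sqinter>\<^bsub>Y\<^esub> c" b] xyb D_car[OF that] f g
          X.meet_swap[of x "f b" a] Y.meet_swap[of y "g b" c] by auto
      then show ?thesis using xyb f g by (auto simp: H_def)
    qed
    ultimately have "H \<in> C" by (simp add: C_def)
    moreover have "E \<subseteq> H \<longleftrightarrow> D \<inter> E \<subseteq> K" if E: "E \<in> C" for E
    proof
      assume EH: "E \<subseteq> H"
      show "D \<inter> E \<subseteq> K"
      proof
        fix z assume z: "z \<in> D \<inter> E"
        obtain a b where ab: "z = (a,b)" by force
        have "(a \<sqinter>\<^bsub>X\<^esub> a, b \<sqinter>\<^bsub>Y\<^esub> b) \<in> K" using HD(3)[of a b a b] EH z ab by auto
        then show "z \<in> K" using D_car[of a b] z ab X.meet_idem Y.meet_idem by auto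
      qed
    next
      assume DE: "D \<inter> E \<subseteq> K"
      have Ec: "c_ideal X Y E" using E by (auto simp: C_def)
      show "E \<subseteq> H"
      proof (intro subrelI HI)
        fix x y assume xy: "(x,y) \<in> E"
        show xc: "x \<in> carrier X" and yc: "y \<in> carrier Y" using c_idealD(1)[OF Ec] xy by auto
        fix a b assume ab: "(a,b) \<in> D"
        have "(x \<sqinter>\<^bsub>X\<^esub> a, y \<sqinter>\<^bsub>Y\<^esub> b) \<in> E"
          using D_car[OF ab] xc yc by (intro c_idealD(2)[OF Ec xy]) (auto intro: X.meet_left Y.meet_left)
        moreover have "(x \<sqinter>\<^bsub>X\<^esub> a, y \<sqinter>\<^bsub>Y\<^esub> b) \<in> D"
          using D_car[OF ab] xc yc by (intro c_idealD(2)[OF Dc ab]) (auto intro: X.meet_right Y.meet_right)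
        ultimately show "(x \<sqinter>\<^bsub>X\<^esub> a, y \<sqinter>\<^bsub>Y\<^esub> b) \<in> K" using DE by auto
      qed
    qed
    ultimately show ?thesis by blast
  qed
  note F = frame_closure_system[of "carrier X \<times> carrier Y" C, OF M M' I H, folded P]
  have [simp]: "carrier (pullback X Y B f g) = C" by (simp add: P)
  show "frame (pullback X Y B f g)" by (rule F(1))
  show "\<top>\<^bsub>pullback X Y B f g\<^esub> = carrier X \<times> carrier Y" by (rule F(2))
  show "D \<in> carrier (pullback X Y B f g) \<Longrightarrow> E \<in> carrier (pullback X Y B f g) \<Longrightarrow> D \<sqinter>\<^bsub>pullback X Y B f g\<^esub> E = D \<inter> E"
    using F(3) by simp
  show "A \<subseteq> carrier (pullback X Y B f g) \<Longrightarrow> \<Squnion>\<^bsub>pullback X Y B f g\<^esub>A = \<Inter>{D\<in>carrier (pullback X Y B f g). \<Union>A \<subseteq> D}"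
    using F(4) by simp
  show "A \<subseteq> carrier (pullback X Y B f g) \<Longrightarrow> A \<noteq> {} \<Longrightarrow> \<Inter>A \<in> carrier (pullback X Y B f g)"
    using I by simp
qed


lemma pullback_shift:
  assumes X: "frame X" and Y: "frame Y"
    and f: "\<And>b. b \<in> carrier B \<Longrightarrow> f b \<in> carrier X" and g: "\<And>b. b \<in> carrier B \<Longrightarrow> g b \<in> carrier Y"
    and K: "K \<in> carrier (pullback X Y B f g)" and p: "p \<in> carrier X" and q: "q \<in> carrier Y"
  shows "{(x,y). x \<in> carrier X \<and> y \<in> carrier Y \<and> (x \<sqinter>\<^bsub>X\<^esub> p, y \<sqinter>\<^bsub>Y\<^esub> q) \<in> K} \<in> carrier (pullback X Y B f g)"
    (is "?H \<in> _")
proof -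
  interpret X: frame X by fact
  interpret Y: frame Y by fact
  have Kc: "c_ideal X Y K" and Kb: "\<And>x y b. x \<in> carrier X \<Longrightarrow> y \<in> carrier Y \<Longrightarrow> b \<in> carrier B \<Longrightarrow> (x \<sqinter>\<^bsub>X\<^esub> f b, y) \<in> K \<longleftrightarrow> (x, y \<sqinter>\<^bsub>Y\<^esub> g b) \<in> K"
    using K by (auto simp: pullback_def)
  have "c_ideal X Y ?H"
    unfolding c_ideal_def
  proof (intro conjI allI impI; (elim conjE)?)
    show "?H \<subseteq> carrier X \<times> carrier Y" by auto
  next
    fix x y x' y' assume h: "(x,y) \<in> ?H" "x' \<in> carrier X" "y' \<in> carrier Y" "x' \<sqsubseteq>\<^bsub>X\<^esub> x" "y' \<sqsubseteq>\<^bsub>Y\<^esub> y"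
    then have h1: "x \<in> carrier X" "y \<in> carrier Y" "(x \<sqinter>\<^bsub>X\<^esub> p, y \<sqinter>\<^bsub>Y\<^esub> q) \<in> K" by auto
    have "(x' \<sqinter>\<^bsub>X\<^esub> p, y' \<sqinter>\<^bsub>Y\<^esub> q) \<in> K"
      using h(2-) h1(1,2) p q by (intro c_idealD(2)[OF Kc h1(3)] X.meet_closed Y.meet_closed X.meet_mono Y.meet_mono) auto
    then show "(x',y') \<in> ?H" using h by simp
  next
    fix A y assume h: "A \<subseteq> carrier X" "y \<in> carrier Y" "\<forall>x\<in>A. (x,y) \<in> ?H"
    have "(\<Squnion>\<^bsub>X\<^esub>A \<sqinter>\<^bsub>X\<^esub> p, y \<sqinter>\<^bsub>Y\<^esub> q) \<in> K"
      unfolding X.sup_meet_distrib[OF p h(1)]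
      using h p q by (intro c_idealD(3)[OF Kc]) auto
    then show "(\<Squnion>\<^bsub>X\<^esub>A, y) \<in> ?H" using h by simp
  next
    fix x A assume h: "x \<in> carrier X" "A \<subseteq> carrier Y" "\<forall>y\<in>A. (x,y) \<in> ?H"
    have "(x \<sqinter>\<^bsub>X\<^esub> p, \<Squnion>\<^bsub>Y\<^esub>A \<sqinter>\<^bsub>Y\<^esub> q) \<in> K"
      unfolding Y.sup_meet_distrib[OF q h(2)]
      using h p q by (intro c_idealD(4)[OF Kc]) auto
    then show "(x, \<Squnion>\<^bsub>Y\<^esub>A) \<in> ?H" using h by simp
  qed
  moreover have "(x \<sqinter>\<^bsub>X\<^esub> f b, y) \<in> ?H \<longleftrightarrow> (x, y \<sqinter>\<^bsub>Y\<^esub> g b) \<in> ?H"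
    if xyb: "x \<in> carrier X" "y \<in> carrier Y" "b \<in> carrier B" for x y b
  proof -
    have "((x \<sqinter>\<^bsub>X\<^esub> f b) \<sqinter>\<^bsub>X\<^esub> p, y \<sqinter>\<^bsub>Y\<^esub> q) \<in> K \<longleftrightarrow> (x \<sqinter>\<^bsub>X\<^esub> p, (y \<sqinter>\<^bsub>Y\<^esub> g b) \<sqinter>\<^bsub>Y\<^esub> q) \<in> K"
      using Kb[of "x \<sqinter>\<^bsub>X\<^esub> p" "y \<sqinter>\<^bsub>Y\<^esub> q" b] xyb p q f g
        X.meet_swap[of x "f b" p] Y.meet_swap[of y "g b" q] by auto
    then show ?thesis using xyb f g by auto
  qed
  ultimately show ?thesis by (simp add: pullback_def)
qed

locale pullback_square = X: frame X + Y: frame Y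
  for X :: "'a gorder" and Y :: "'b gorder" +
  fixes B :: "'c gorder" and f :: "'c \<Rightarrow> 'a" and g :: "'c \<Rightarrow> 'b"
  assumes fc: "cont_map X B f" and gc: "cont_map Y B g"
begin

abbreviation "P \<equiv> pullback X Y B f g"

lemma f_c: "b \<in> carrier B \<Longrightarrow> f b \<in> carrier X" and g_c: "b \<in> carrier B \<Longrightarrow> g b \<in> carrier Y"
  using fc gc by (auto simp: cont_map_def frame_hom_def)

lemma frP: "frame P" by (rule pullback_frame) (use f_c g_c X.frame_axioms Y.frame_axioms in auto)
lemma topP: "\<top>\<^bsub>P\<^esub> = carrier X \<times> carrier Y"
  by (rule pullback_frame) (use f_c g_c X.frame_axioms Y.frame_axioms in auto)
lemma meetP: "D \<in> carrier P \<Longrightarrow> E \<in> carrier P \<Longrightarrow> D \<sqinter>\<^bsub>P\<^esub> E = D \<inter> E"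
  by (rule pullback_frame) (use f_c g_c X.frame_axioms Y.frame_axioms in auto)
lemma interP: "A \<subseteq> carrier P \<Longrightarrow> A \<noteq> {} \<Longrightarrow> \<Inter>A \<in> carrier P"
  by (rule pullback_frame) (use f_c g_c X.frame_axioms Y.frame_axioms in auto)
lemma leP: "D \<sqsubseteq>\<^bsub>P\<^esub> E \<longleftrightarrow> D \<subseteq> E" by (simp add: pullback_def)

sublocale P: frame P by (rule frP)

lemma subP: "D \<in> carrier P \<Longrightarrow> D \<subseteq> carrier X \<times> carrier Y"
  by (auto simp: pullback_def c_ideal_def)
lemma ciP: "D \<in> carrier P \<Longrightarrow> c_ideal X Y D" by (simp add: pullback_def)
lemma balP: "\<lbrakk>D \<in> carrier P; x \<in> carrier X; y \<in> carrier Y; b \<in> carrier B\<rbrakk> \<Longrightarrow> (x \<sqinter>\<^bsub>X\<^esub> f b, y) \<in> D \<longleftrightarrow> (x, y \<sqinter>\<^bsub>Y\<^esub> g b) \<in> D"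
  by (simp add: pullback_def)

lemma rect_c: "x \<in> carrier X \<Longrightarrow> y \<in> carrier Y \<Longrightarrow> rect P x y \<in> carrier P"
  unfolding rect_def using P.top_closed by (intro interP) (auto simp: topP)
lemma rect_mem: "(x,y) \<in> rect P x y" by (auto simp: rect_def)
lemma rect_le: "D \<in> carrier P \<Longrightarrow> (x,y) \<in> D \<Longrightarrow> rect P x y \<subseteq> D" by (auto simp: rect_def)

lemma rect_meet:
  assumes c: "x \<in> carrier X" "y \<in> carrier Y" "x' \<in> carrier X" "y' \<in> carrier Y"
  shows "rect P x y \<inter> rect P x' y' = rect P (x \<sqinter>\<^bsub>X\<^esub> x') (y \<sqinter>\<^bsub>Y\<^esub> y')" (is "_ = ?K")
proof
  have K: "?K \<in> carrier P" using c by (simp add: rect_c)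
  show "rect P x y \<inter> rect P x' y' \<subseteq> ?K"
  proof (rule subrelI)
    fix a b assume ab: "(a,b) \<in> rect P x y \<inter> rect P x' y'"
    have abc: "a \<in> carrier X" "b \<in> carrier Y" using ab subP[OF rect_c[OF c(1,2)]] by auto
    have "rect P x y \<subseteq> {(u,v). u \<in> carrier X \<and> v \<in> carrier Y \<and> (u \<sqinter>\<^bsub>X\<^esub> x', v \<sqinter>\<^bsub>Y\<^esub> y') \<in> ?K}"
      using c f_c g_c rect_mem[of "x \<sqinter>\<^bsub>X\<^esub> x'" "y \<sqinter>\<^bsub>Y\<^esub> y'"]
      by (intro rect_le pullback_shift X.frame_axioms Y.frame_axioms K) auto
    then have "(a \<sqinter>\<^bsub>X\<^esub> x', b \<sqinter>\<^bsub>Y\<^esub> y') \<in> ?K" using ab by auto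
    then have 1: "(x' \<sqinter>\<^bsub>X\<^esub> a, y' \<sqinter>\<^bsub>Y\<^esub> b) \<in> ?K" by (simp add: meet_comm)
    have "rect P x' y' \<subseteq> {(u,v). u \<in> carrier X \<and> v \<in> carrier Y \<and> (u \<sqinter>\<^bsub>X\<^esub> a, v \<sqinter>\<^bsub>Y\<^esub> b) \<in> ?K}"
      using c f_c g_c 1 abc by (intro rect_le pullback_shift X.frame_axioms Y.frame_axioms K) auto
    then have "(a \<sqinter>\<^bsub>X\<^esub> a, b \<sqinter>\<^bsub>Y\<^esub> b) \<in> ?K" using ab by auto
    then show "(a,b) \<in> ?K" using abc by (simp add: X.meet_idem Y.meet_idem)
  qed
  have "(x \<sqinter>\<^bsub>X\<^esub> x', y \<sqinter>\<^bsub>Y\<^esub> y') \<in> rect P x y"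
    by (rule c_idealD(2)[OF ciP[OF rect_c[OF c(1,2)]] rect_mem]) (use c in \<open>auto intro: X.meet_left Y.meet_left\<close>)
  moreover have "(x \<sqinter>\<^bsub>X\<^esub> x', y \<sqinter>\<^bsub>Y\<^esub> y') \<in> rect P x' y'"
    by (rule c_idealD(2)[OF ciP[OF rect_c[OF c(3,4)]] rect_mem]) (use c in \<open>auto intro: X.meet_right Y.meet_right\<close>)
  ultimately show "?K \<subseteq> rect P x y \<inter> rect P x' y'" using rect_le rect_c c by auto
qed

lemma top_mem: "D \<in> carrier P \<Longrightarrow> (\<top>\<^bsub>X\<^esub>, \<top>\<^bsub>Y\<^esub>) \<in> D \<Longrightarrow> D = carrier X \<times> carrier Y"
  using subP[of D] c_idealD(2)[OF ciP[of D], of "\<top>\<^bsub>X\<^esub>" "\<top>\<^bsub>Y\<^esub>"] X.top_higher Y.top_higher by auto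

lemma pr1_cont: "cont_map P X (pr1 P Y)"
proof -
  have "rect P (\<Squnion>\<^bsub>X\<^esub>K) \<top>\<^bsub>Y\<^esub> = \<Squnion>\<^bsub>P\<^esub>((\<lambda>x. rect P x \<top>\<^bsub>Y\<^esub>) ` K)" if K: "K \<subseteq> carrier X" for K
  proof (rule P.le_antisym)
    have im: "(\<lambda>x. rect P x \<top>\<^bsub>Y\<^esub>) ` K \<subseteq> carrier P" using K by (auto intro: rect_c)
    have S: "\<Squnion>\<^bsub>P\<^esub>((\<lambda>x. rect P x \<top>\<^bsub>Y\<^esub>) ` K) \<in> carrier P" using P.sup_closed[OF im] .
    then show "\<Squnion>\<^bsub>P\<^esub>((\<lambda>x. rect P x \<top>\<^bsub>Y\<^esub>) ` K) \<in> carrier P" .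
    show R: "rect P (\<Squnion>\<^bsub>X\<^esub>K) \<top>\<^bsub>Y\<^esub> \<in> carrier P" using K by (simp add: rect_c)
    show "rect P (\<Squnion>\<^bsub>X\<^esub>K) \<top>\<^bsub>Y\<^esub> \<sqsubseteq>\<^bsub>P\<^esub> \<Squnion>\<^bsub>P\<^esub>((\<lambda>x. rect P x \<top>\<^bsub>Y\<^esub>) ` K)"
      unfolding leP
    proof (rule rect_le[OF S], rule c_idealD(3)[OF ciP[OF S] K])
      fix x assume "x \<in> K"
      then have "rect P x \<top>\<^bsub>Y\<^esub> \<subseteq> \<Squnion>\<^bsub>P\<^esub>((\<lambda>x. rect P x \<top>\<^bsub>Y\<^esub>) ` K)"
        using P.sup_upper[OF im] by (auto simp: leP)
      then show "(x, \<top>\<^bsub>Y\<^esub>) \<in> \<Squnion>\<^bsub>P\<^esub>((\<lambda>x. rect P x \<top>\<^bsub>Y\<^esub>) ` K)" using rect_mem by auto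
    qed simp
    show "\<Squnion>\<^bsub>P\<^esub>((\<lambda>x. rect P x \<top>\<^bsub>Y\<^esub>) ` K) \<sqsubseteq>\<^bsub>P\<^esub> rect P (\<Squnion>\<^bsub>X\<^esub>K) \<top>\<^bsub>Y\<^esub>"
    proof (rule P.sup_least[OF im R])
      fix D assume "D \<in> (\<lambda>x. rect P x \<top>\<^bsub>Y\<^esub>) ` K"
      then obtain x where x: "x \<in> K" "D = rect P x \<top>\<^bsub>Y\<^esub>" by auto
      have "(x, \<top>\<^bsub>Y\<^esub>) \<in> rect P (\<Squnion>\<^bsub>X\<^esub>K) \<top>\<^bsub>Y\<^esub>"
        by (rule c_idealD(2)[OF ciP[OF R] rect_mem]) (use x K in \<open>auto intro: X.sup_upper\<close>)
      then show "D \<sqsubseteq>\<^bsub>P\<^esub> rect P (\<Squnion>\<^bsub>X\<^esub>K) \<top>\<^bsub>Y\<^esub>" using rect_le[OF R] x by (simp add: leP)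
    qed
  qed
  moreover have "rect P \<top>\<^bsub>X\<^esub> \<top>\<^bsub>Y\<^esub> = \<top>\<^bsub>P\<^esub>" using top_mem[OF rect_c rect_mem] topP by auto
  ultimately show ?thesis
    unfolding cont_map_def frame_hom_def pr1_def
    using P.frame_axioms X.frame_axioms rect_c meetP rect_meet[of _ "\<top>\<^bsub>Y\<^esub>" _ "\<top>\<^bsub>Y\<^esub>"] by (auto simp: Y.meet_idem)
qed

lemma pr2_cont: "cont_map P Y (pr2 P X)"
proof -
  have "rect P \<top>\<^bsub>X\<^esub> (\<Squnion>\<^bsub>Y\<^esub>K) = \<Squnion>\<^bsub>P\<^esub>((\<lambda>y. rect P \<top>\<^bsub>X\<^esub> y) ` K)" if K: "K \<subseteq> carrier Y" for K
  proof (rule P.le_antisym)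
    have im: "(\<lambda>y. rect P \<top>\<^bsub>X\<^esub> y) ` K \<subseteq> carrier P" using K by (auto intro: rect_c)
    have S: "\<Squnion>\<^bsub>P\<^esub>((\<lambda>y. rect P \<top>\<^bsub>X\<^esub> y) ` K) \<in> carrier P" using P.sup_closed[OF im] .
    then show "\<Squnion>\<^bsub>P\<^esub>((\<lambda>y. rect P \<top>\<^bsub>X\<^esub> y) ` K) \<in> carrier P" .
    show R: "rect P \<top>\<^bsub>X\<^esub> (\<Squnion>\<^bsub>Y\<^esub>K) \<in> carrier P" using K by (simp add: rect_c)
    show "rect P \<top>\<^bsub>X\<^esub> (\<Squnion>\<^bsub>Y\<^esub>K) \<sqsubseteq>\<^bsub>P\<^esub> \<Squnion>\<^bsub>P\<^esub>((\<lambda>y. rect P \<top>\<^bsub>X\<^esub> y) ` K)"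
      unfolding leP
    proof (rule rect_le[OF S], rule c_idealD(4)[OF ciP[OF S] K])
      fix x assume "x \<in> K"
      then have "rect P \<top>\<^bsub>X\<^esub> x \<subseteq> \<Squnion>\<^bsub>P\<^esub>((\<lambda>y. rect P \<top>\<^bsub>X\<^esub> y) ` K)"
        using P.sup_upper[OF im] by (auto simp: leP)
      then show "(\<top>\<^bsub>X\<^esub>, x) \<in> \<Squnion>\<^bsub>P\<^esub>((\<lambda>y. rect P \<top>\<^bsub>X\<^esub> y) ` K)" using rect_mem by auto
    qed simp
    show "\<Squnion>\<^bsub>P\<^esub>((\<lambda>y. rect P \<top>\<^bsub>X\<^esub> y) ` K) \<sqsubseteq>\<^bsub>P\<^esub> rect P \<top>\<^bsub>X\<^esub> (\<Squnion>\<^bsub>Y\<^esub>K)"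
    proof (rule P.sup_least[OF im R])
      fix D assume "D \<in> (\<lambda>y. rect P \<top>\<^bsub>X\<^esub> y) ` K"
      then obtain x where x: "x \<in> K" "D = rect P \<top>\<^bsub>X\<^esub> x" by auto
      have "(\<top>\<^bsub>X\<^esub>, x) \<in> rect P \<top>\<^bsub>X\<^esub> (\<Squnion>\<^bsub>Y\<^esub>K)"
        by (rule c_idealD(2)[OF ciP[OF R] rect_mem]) (use x K in \<open>auto intro: Y.sup_upper\<close>)
      then show "D \<sqsubseteq>\<^bsub>P\<^esub> rect P \<top>\<^bsub>X\<^esub> (\<Squnion>\<^bsub>Y\<^esub>K)" using rect_le[OF R] x by (simp add: leP)
    qed
  qed
  moreover have "rect P \<top>\<^bsub>X\<^esub> \<top>\<^bsub>Y\<^esub> = \<top>\<^bsub>P\<^esub>" using top_mem[OF rect_c rect_mem] topP by auto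
  ultimately show ?thesis
    unfolding cont_map_def frame_hom_def pr2_def
    using P.frame_axioms Y.frame_axioms rect_c meetP rect_meet[of "\<top>\<^bsub>X\<^esub>" _ "\<top>\<^bsub>X\<^esub>"] by (auto simp: X.meet_idem)
qed

lemma commutes: "map_eq B (f \<odot> pr1 P Y) (g \<odot> pr2 P X)"
  unfolding map_eq_def
proof
  fix b assume b: "b \<in> carrier B"
  have tx: "\<top>\<^bsub>X\<^esub> \<sqinter>\<^bsub>X\<^esub> f b = f b" using f_c[OF b] X.top_meet[of "f b"] X.eq_is_equal by simp
  have ty: "\<top>\<^bsub>Y\<^esub> \<sqinter>\<^bsub>Y\<^esub> g b = g b" using g_c[OF b] Y.top_meet[of "g b"] Y.eq_is_equal by simp
  have "(f b, \<top>\<^bsub>Y\<^esub>) \<in> D \<longleftrightarrow> (\<top>\<^bsub>X\<^esub>, g b) \<in> D" if "D \<in> carrier P" for D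
    using balP[OF that X.top_closed Y.top_closed b] tx ty by simp
  then have "{D \<in> carrier P. (f b, \<top>\<^bsub>Y\<^esub>) \<in> D} = {D \<in> carrier P. (\<top>\<^bsub>X\<^esub>, g b) \<in> D}" by blast
  then show "(f \<odot> pr1 P Y) b = (g \<odot> pr2 P X) b"
    by (simp add: pr1_def pr2_def rect_def)
qed

context
  fixes Z :: "'z gorder" and h k
  assumes hc: "cont_map Z X h" and kc: "cont_map Z Y k" and hk: "map_eq B (f \<odot> h) (g \<odot> k)"
begin

interpretation Z: frame Z using hc by (simp add: cont_map_def)

lemma h: "x \<in> carrier X \<Longrightarrow> h x \<in> carrier Z" "h \<top>\<^bsub>X\<^esub> = \<top>\<^bsub>Z\<^esub>"
   "x \<in> carrier X \<Longrightarrow> x' \<in> carrier X \<Longrightarrow> h (x \<sqinter>\<^bsub>X\<^esub> x') = h x \<sqinter>\<^bsub>Z\<^esub> h x'"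
   "K \<subseteq> carrier X \<Longrightarrow> h (\<Squnion>\<^bsub>X\<^esub>K) = \<Squnion>\<^bsub>Z\<^esub>(h ` K)"
  using hc by (auto simp: cont_map_def frame_hom_def)
lemma k: "y \<in> carrier Y \<Longrightarrow> k y \<in> carrier Z" "k \<top>\<^bsub>Y\<^esub> = \<top>\<^bsub>Z\<^esub>"
   "y \<in> carrier Y \<Longrightarrow> y' \<in> carrier Y \<Longrightarrow> k (y \<sqinter>\<^bsub>Y\<^esub> y') = k y \<sqinter>\<^bsub>Z\<^esub> k y'"
   "K' \<subseteq> carrier Y \<Longrightarrow> k (\<Squnion>\<^bsub>Y\<^esub>K') = \<Squnion>\<^bsub>Z\<^esub>(k ` K')"
  using kc by (auto simp: cont_map_def frame_hom_def)

lemma h_mono: "x \<in> carrier X \<Longrightarrow> x' \<in> carrier X \<Longrightarrow> x \<sqsubseteq>\<^bsub>X\<^esub> x' \<Longrightarrow> h x \<sqsubseteq>\<^bsub>Z\<^esub> h x'"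
  by (metis X.le_iff_join Z.le_iff_join h(1,3))
lemma k_mono: "x \<in> carrier Y \<Longrightarrow> x' \<in> carrier Y \<Longrightarrow> x \<sqsubseteq>\<^bsub>Y\<^esub> x' \<Longrightarrow> k x \<sqsubseteq>\<^bsub>Z\<^esub> k x'"
  by (metis Y.le_iff_join Z.le_iff_join k(1,3))

lemma R_c:
  assumes w: "w \<in> carrier Z"
  shows "{(x,y). x \<in> carrier X \<and> y \<in> carrier Y \<and> h x \<sqinter>\<^bsub>Z\<^esub> k y \<sqsubseteq>\<^bsub>Z\<^esub> w} \<in> carrier P" (is "?R \<in> _")
proof -
  have "c_ideal X Y ?R"
    unfolding c_ideal_def
  proof (intro conjI allI impI; (elim conjE)?)
    show "?R \<subseteq> carrier X \<times> carrier Y" by auto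
  next
    fix x y x' y' assume a: "(x,y) \<in> ?R" "x' \<in> carrier X" "y' \<in> carrier Y" "x' \<sqsubseteq>\<^bsub>X\<^esub> x" "y' \<sqsubseteq>\<^bsub>Y\<^esub> y"
    have "h x' \<sqinter>\<^bsub>Z\<^esub> k y' \<sqsubseteq>\<^bsub>Z\<^esub> h x \<sqinter>\<^bsub>Z\<^esub> k y"
      using a by (intro Z.meet_mono h_mono k_mono h k) auto
    then have "h x' \<sqinter>\<^bsub>Z\<^esub> k y' \<sqsubseteq>\<^bsub>Z\<^esub> w"
      by (rule Z.le_trans) (use a w h k in auto)
    then show "(x',y') \<in> ?R" using a by simp
  next
    fix K y assume a: "K \<subseteq> carrier X" "y \<in> carrier Y" "\<forall>x\<in>K. (x,y) \<in> ?R"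
    have hK: "h ` K \<subseteq> carrier Z" using a h by auto
    have "h (\<Squnion>\<^bsub>X\<^esub>K) \<sqinter>\<^bsub>Z\<^esub> k y \<sqsubseteq>\<^bsub>Z\<^esub> w"
      unfolding h(4)[OF a(1)] Z.sup_meet_distrib[OF k(1)[OF a(2)] hK]
      using a w h k by (intro Z.sup_least) auto
    then show "(\<Squnion>\<^bsub>X\<^esub>K, y) \<in> ?R" using a by simp
  next
    fix x K assume a: "x \<in> carrier X" "K \<subseteq> carrier Y" "\<forall>y\<in>K. (x,y) \<in> ?R"
    have kK: "k ` K \<subseteq> carrier Z" using a k by auto
    have "h x \<sqinter>\<^bsub>Z\<^esub> k (\<Squnion>\<^bsub>Y\<^esub>K) \<sqsubseteq>\<^bsub>Z\<^esub> w"
      unfolding k(4)[OF a(2)] Z.meet_sup_distrib[OF h(1)[OF a(1)] kK]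
      using a w h k by (intro Z.sup_least) auto
    then show "(x, \<Squnion>\<^bsub>Y\<^esub>K) \<in> ?R" using a by simp
  qed
  moreover have "(x \<sqinter>\<^bsub>X\<^esub> f b, y) \<in> ?R \<longleftrightarrow> (x, y \<sqinter>\<^bsub>Y\<^esub> g b) \<in> ?R"
    if a: "x \<in> carrier X" "y \<in> carrier Y" "b \<in> carrier B" for x y b
  proof -
    have "h (f b) = k (g b)" using hk a by (simp add: map_eq_def)
    then have "(h x \<sqinter>\<^bsub>Z\<^esub> h (f b)) \<sqinter>\<^bsub>Z\<^esub> k y = h x \<sqinter>\<^bsub>Z\<^esub> (k y \<sqinter>\<^bsub>Z\<^esub> k (g b))"
      using a h k f_c g_c Z.meet_swap[of "h x" "k (g b)" "k y"] Z.meet_assoc[of "h x" "k y" "k (g b)"] by simp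
    then show ?thesis using a h k f_c g_c by auto
  qed
  ultimately show ?thesis by (simp add: pullback_def)
qed

lemma im_c: "D \<in> carrier P \<Longrightarrow> (\<lambda>(x, y). h x \<sqinter>\<^bsub>Z\<^esub> k y) ` D \<subseteq> carrier Z"
  using subP[of D] h k by auto
lemma pair_c: "D \<in> carrier P \<Longrightarrow> pairing Z h k D \<in> carrier Z"
  unfolding pairing_def by (rule Z.sup_closed[OF im_c])

lemma pair_upper: "D \<in> carrier P \<Longrightarrow> (x,y) \<in> D \<Longrightarrow> h x \<sqinter>\<^bsub>Z\<^esub> k y \<sqsubseteq>\<^bsub>Z\<^esub> pairing Z h k D"
  unfolding pairing_def by (rule Z.sup_upper[OF im_c]) force+

lemma pair_le: assumes D: "D \<in> carrier P" and w: "w \<in> carrier Z"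
  shows "pairing Z h k D \<sqsubseteq>\<^bsub>Z\<^esub> w \<longleftrightarrow> D \<subseteq> {(x,y). x \<in> carrier X \<and> y \<in> carrier Y \<and> h x \<sqinter>\<^bsub>Z\<^esub> k y \<sqsubseteq>\<^bsub>Z\<^esub> w}"
proof
  assume a: "pairing Z h k D \<sqsubseteq>\<^bsub>Z\<^esub> w"
  show "D \<subseteq> {(x,y). x \<in> carrier X \<and> y \<in> carrier Y \<and> h x \<sqinter>\<^bsub>Z\<^esub> k y \<sqsubseteq>\<^bsub>Z\<^esub> w}"
  proof (rule subrelI)
    fix x y assume xy: "(x,y) \<in> D"
    have c: "x \<in> carrier X" "y \<in> carrier Y" using subP[OF D] xy by auto
    have "h x \<sqinter>\<^bsub>Z\<^esub> k y \<sqsubseteq>\<^bsub>Z\<^esub> w"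
      by (rule Z.le_trans[OF pair_upper[OF D xy] a]) (use c h k w pair_c[OF D] in auto)
    with c show "(x,y) \<in> {(x,y). x \<in> carrier X \<and> y \<in> carrier Y \<and> h x \<sqinter>\<^bsub>Z\<^esub> k y \<sqsubseteq>\<^bsub>Z\<^esub> w}" by simp
  qed
next
  assume "D \<subseteq> {(x,y). x \<in> carrier X \<and> y \<in> carrier Y \<and> h x \<sqinter>\<^bsub>Z\<^esub> k y \<sqsubseteq>\<^bsub>Z\<^esub> w}"
  then show "pairing Z h k D \<sqsubseteq>\<^bsub>Z\<^esub> w"
    unfolding pairing_def by (intro Z.sup_least[OF im_c[OF D] w]) auto
qed

lemma pair_rect: assumes c: "x \<in> carrier X" "y \<in> carrier Y"
  shows "pairing Z h k (rect P x y) = h x \<sqinter>\<^bsub>Z\<^esub> k y"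
proof (rule Z.le_antisym)
  show "pairing Z h k (rect P x y) \<sqsubseteq>\<^bsub>Z\<^esub> h x \<sqinter>\<^bsub>Z\<^esub> k y"
  proof -
    have w: "h x \<sqinter>\<^bsub>Z\<^esub> k y \<in> carrier Z" using c h k by simp
    show ?thesis unfolding pair_le[OF rect_c[OF c] w] by (rule rect_le[OF R_c[OF w]]) (use c w in auto)
  qed
  show "h x \<sqinter>\<^bsub>Z\<^esub> k y \<sqsubseteq>\<^bsub>Z\<^esub> pairing Z h k (rect P x y)" by (rule pair_upper[OF rect_c[OF c] rect_mem])
qed (use c h k pair_c rect_c in auto)

lemma pairing_cont: "cont_map Z P (pairing Z h k)"
proof -
  have 1: "pairing Z h k \<top>\<^bsub>P\<^esub> = \<top>\<^bsub>Z\<^esub>"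
    using pair_rect[OF X.top_closed Y.top_closed] top_mem[OF rect_c rect_mem] topP h k
    by (simp add: Z.meet_idem)
  have 2: "pairing Z h k (D \<sqinter>\<^bsub>P\<^esub> E) = pairing Z h k D \<sqinter>\<^bsub>Z\<^esub> pairing Z h k E"
    if D: "D \<in> carrier P" and E: "E \<in> carrier P" for D E
  proof (rule Z.le_antisym)
    have DE: "D \<inter> E \<in> carrier P" using P.meet_closed[OF D E] meetP[OF D E] by simp
    have mono: "pairing Z h k A \<sqsubseteq>\<^bsub>Z\<^esub> pairing Z h k A'" if "A \<in> carrier P" "A' \<in> carrier P" "A \<subseteq> A'" for A A'
      using that pair_le[of A "pairing Z h k A'"] pair_le[of A' "pairing Z h k A'"] pair_c[of A'] by auto
    show "pairing Z h k (D \<sqinter>\<^bsub>P\<^esub> E) \<sqsubseteq>\<^bsub>Z\<^esub> pairing Z h k D \<sqinter>\<^bsub>Z\<^esub> pairing Z h k E"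
      unfolding meetP[OF D E] by (intro Z.meet_le mono pair_c D E DE) auto
    have cD: "\<And>x y. (x,y) \<in> D \<Longrightarrow> x \<in> carrier X \<and> y \<in> carrier Y" using subP[OF D] by auto
    have cE: "\<And>x y. (x,y) \<in> E \<Longrightarrow> x \<in> carrier X \<and> y \<in> carrier Y" using subP[OF E] by auto
    have "pairing Z h k D \<sqinter>\<^bsub>Z\<^esub> pairing Z h k E = \<Squnion>\<^bsub>Z\<^esub>((\<lambda>b. b \<sqinter>\<^bsub>Z\<^esub> pairing Z h k E) ` (\<lambda>(x, y). h x \<sqinter>\<^bsub>Z\<^esub> k y) ` D)"
      using Z.sup_meet_distrib[OF pair_c[OF E] im_c[OF D]] by (simp add: pairing_def[of Z h k D])
    also have "\<dots> \<sqsubseteq>\<^bsub>Z\<^esub> pairing Z h k (D \<inter> E)"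
    proof (rule Z.sup_least)
      show "(\<lambda>b. b \<sqinter>\<^bsub>Z\<^esub> pairing Z h k E) ` (\<lambda>(x, y). h x \<sqinter>\<^bsub>Z\<^esub> k y) ` D \<subseteq> carrier Z"
        using im_c[OF D] pair_c[OF E] by auto
      fix z assume "z \<in> (\<lambda>b. b \<sqinter>\<^bsub>Z\<^esub> pairing Z h k E) ` (\<lambda>(x, y). h x \<sqinter>\<^bsub>Z\<^esub> k y) ` D"
      then obtain x y where xy: "(x,y) \<in> D" and z: "z = (h x \<sqinter>\<^bsub>Z\<^esub> k y) \<sqinter>\<^bsub>Z\<^esub> pairing Z h k E" by auto
      have hk: "h x \<sqinter>\<^bsub>Z\<^esub> k y \<in> carrier Z" using cD[OF xy] h k by simp
      have "z = \<Squnion>\<^bsub>Z\<^esub>((\<lambda>b. (h x \<sqinter>\<^bsub>Z\<^esub> k y) \<sqinter>\<^bsub>Z\<^esub> b) ` (\<lambda>(x, y). h x \<sqinter>\<^bsub>Z\<^esub> k y) ` E)"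
        using Z.meet_sup_distrib[OF hk im_c[OF E]] z by (simp add: pairing_def)
      also have "\<dots> \<sqsubseteq>\<^bsub>Z\<^esub> pairing Z h k (D \<inter> E)"
      proof (rule Z.sup_least)
        show "(\<lambda>b. (h x \<sqinter>\<^bsub>Z\<^esub> k y) \<sqinter>\<^bsub>Z\<^esub> b) ` (\<lambda>(x, y). h x \<sqinter>\<^bsub>Z\<^esub> k y) ` E \<subseteq> carrier Z"
          using im_c[OF E] hk by auto
        fix v assume "v \<in> (\<lambda>b. (h x \<sqinter>\<^bsub>Z\<^esub> k y) \<sqinter>\<^bsub>Z\<^esub> b) ` (\<lambda>(x, y). h x \<sqinter>\<^bsub>Z\<^esub> k y) ` E"
        then obtain x' y' where xy': "(x',y') \<in> E" and v: "v = (h x \<sqinter>\<^bsub>Z\<^esub> k y) \<sqinter>\<^bsub>Z\<^esub> (h x' \<sqinter>\<^bsub>Z\<^esub> k y')" by auto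
        note c = cD[OF xy] cE[OF xy']
        have "v = h (x \<sqinter>\<^bsub>X\<^esub> x') \<sqinter>\<^bsub>Z\<^esub> k (y \<sqinter>\<^bsub>Y\<^esub> y')"
        proof -
          have "v = ((h x \<sqinter>\<^bsub>Z\<^esub> k y) \<sqinter>\<^bsub>Z\<^esub> h x') \<sqinter>\<^bsub>Z\<^esub> k y'"
            unfolding v using c h k by (simp add: Z.meet_assoc)
          also have "(h x \<sqinter>\<^bsub>Z\<^esub> k y) \<sqinter>\<^bsub>Z\<^esub> h x' = (h x \<sqinter>\<^bsub>Z\<^esub> h x') \<sqinter>\<^bsub>Z\<^esub> k y"
            using c h k by (intro Z.meet_swap) auto
          finally show ?thesis using c h k by (simp add: Z.meet_assoc)
        qed
        moreover have "(x \<sqinter>\<^bsub>X\<^esub> x', y \<sqinter>\<^bsub>Y\<^esub> y') \<in> D"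
          by (rule c_idealD(2)[OF ciP[OF D] xy]) (use c in \<open>auto intro: X.meet_left Y.meet_left\<close>)
        moreover have "(x \<sqinter>\<^bsub>X\<^esub> x', y \<sqinter>\<^bsub>Y\<^esub> y') \<in> E"
          by (rule c_idealD(2)[OF ciP[OF E] xy']) (use c in \<open>auto intro: X.meet_right Y.meet_right\<close>)
        ultimately show "v \<sqsubseteq>\<^bsub>Z\<^esub> pairing Z h k (D \<inter> E)" using pair_upper[OF DE] by auto
      qed (rule pair_c[OF DE])
      finally show "z \<sqsubseteq>\<^bsub>Z\<^esub> pairing Z h k (D \<inter> E)" .
    qed (rule pair_c[OF DE])
    finally show "pairing Z h k D \<sqinter>\<^bsub>Z\<^esub> pairing Z h k E \<sqsubseteq>\<^bsub>Z\<^esub> pairing Z h k (D \<sqinter>\<^bsub>P\<^esub> E)" by (simp add: meetP D E)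
  qed (use D E pair_c in auto)
  have 3: "pairing Z h k (\<Squnion>\<^bsub>P\<^esub>A) = \<Squnion>\<^bsub>Z\<^esub>(pairing Z h k ` A)" if A: "A \<subseteq> carrier P" for A
  proof (rule Z.le_antisym)
    have im: "pairing Z h k ` A \<subseteq> carrier Z" using A pair_c by auto
    have S: "\<Squnion>\<^bsub>Z\<^esub>(pairing Z h k ` A) \<in> carrier Z" by (rule Z.sup_closed[OF im])
    have SA: "\<Squnion>\<^bsub>P\<^esub>A \<in> carrier P" by (rule P.sup_closed[OF A])
    show "pairing Z h k (\<Squnion>\<^bsub>P\<^esub>A) \<in> carrier Z" by (rule pair_c[OF SA])
    show "\<Squnion>\<^bsub>Z\<^esub>(pairing Z h k ` A) \<in> carrier Z" by (rule S)
    show "pairing Z h k (\<Squnion>\<^bsub>P\<^esub>A) \<sqsubseteq>\<^bsub>Z\<^esub> \<Squnion>\<^bsub>Z\<^esub>(pairing Z h k ` A)"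
      unfolding pair_le[OF SA S] leP[symmetric]
    proof (rule P.sup_least[OF A R_c[OF S]])
      fix D assume D: "D \<in> A"
      have "pairing Z h k D \<sqsubseteq>\<^bsub>Z\<^esub> \<Squnion>\<^bsub>Z\<^esub>(pairing Z h k ` A)" by (rule Z.sup_upper[OF im]) (use D in auto)
      then show "D \<sqsubseteq>\<^bsub>P\<^esub> {(x,y). x \<in> carrier X \<and> y \<in> carrier Y \<and> h x \<sqinter>\<^bsub>Z\<^esub> k y \<sqsubseteq>\<^bsub>Z\<^esub> \<Squnion>\<^bsub>Z\<^esub>(pairing Z h k ` A)}"
        using pair_le[OF _ S, of D] D A by (auto simp: leP)
    qed
    show "\<Squnion>\<^bsub>Z\<^esub>(pairing Z h k ` A) \<sqsubseteq>\<^bsub>Z\<^esub> pairing Z h k (\<Squnion>\<^bsub>P\<^esub>A)"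
    proof (rule Z.sup_least[OF im pair_c[OF SA]])
      fix z assume "z \<in> pairing Z h k ` A"
      then obtain D where D: "D \<in> A" "z = pairing Z h k D" by auto
      have "D \<subseteq> \<Squnion>\<^bsub>P\<^esub>A" using P.sup_upper[OF A D(1)] by (simp add: leP)
      then show "z \<sqsubseteq>\<^bsub>Z\<^esub> pairing Z h k (\<Squnion>\<^bsub>P\<^esub>A)"
        using pair_le[OF SA pair_c[OF SA]] pair_le[OF _ pair_c[OF SA], of D] D A pair_c[OF SA] by auto
    qed
  qed
  show ?thesis
    unfolding cont_map_def frame_hom_def using 1 2 3 pair_c P.frame_axioms Z.frame_axioms by auto
qed

lemma pairing_pr: "map_eq X (pr1 P Y \<odot> pairing Z h k) h" "map_eq Y (pr2 P X \<odot> pairing Z h k) k"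
proof -
  have "a \<sqinter>\<^bsub>Z\<^esub> \<top>\<^bsub>Z\<^esub> = a" "\<top>\<^bsub>Z\<^esub> \<sqinter>\<^bsub>Z\<^esub> a = a" if "a \<in> carrier Z" for a
    using Z.top_meet[OF that] Z.eq_is_equal by (simp_all add: meet_comm)
  then show "map_eq X (pr1 P Y \<odot> pairing Z h k) h" "map_eq Y (pr2 P X \<odot> pairing Z h k) k"
    using h k by (auto simp: map_eq_def pr1_def pr2_def pair_rect)
qed

lemma pairing_unique:
  assumes u: "cont_map Z P u" and u1: "map_eq X (pr1 P Y \<odot> u) h" and u2: "map_eq Y (pr2 P X \<odot> u) k"
  shows "map_eq P u (pairing Z h k)"
  unfolding map_eq_def
proof
  fix D assume D: "D \<in> carrier P"
  have tx: "a \<sqinter>\<^bsub>X\<^esub> \<top>\<^bsub>X\<^esub> = a" if "a \<in> carrier X" for a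
    using X.top_meet[OF that] X.eq_is_equal by (simp_all add: meet_comm)
  have ty: "\<top>\<^bsub>Y\<^esub> \<sqinter>\<^bsub>Y\<^esub> a = a" if "a \<in> carrier Y" for a
    using Y.top_meet[OF that] Y.eq_is_equal by (simp_all add: meet_comm)
  have ur: "u (rect P x y) = h x \<sqinter>\<^bsub>Z\<^esub> k y" if c: "x \<in> carrier X" "y \<in> carrier Y" for x y
  proof -
    have "rect P x y = pr1 P Y x \<sqinter>\<^bsub>P\<^esub> pr2 P X y"
      using c rect_meet[of x "\<top>\<^bsub>Y\<^esub>" "\<top>\<^bsub>X\<^esub>" y] tx ty by (simp add: pr1_def pr2_def meetP rect_c)
    then show ?thesis using u u1 u2 c rect_c
      by (auto simp: cont_map_def frame_hom_def map_eq_def pr1_def pr2_def)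
  qed
  have im: "(\<lambda>(x,y). rect P x y) ` D \<subseteq> carrier P" using subP[OF D] rect_c by auto
  have "D = \<Squnion>\<^bsub>P\<^esub>((\<lambda>(x,y). rect P x y) ` D)"
  proof (rule P.le_antisym)
    show "D \<sqsubseteq>\<^bsub>P\<^esub> \<Squnion>\<^bsub>P\<^esub>((\<lambda>(x,y). rect P x y) ` D)"
      unfolding leP
    proof (rule subrelI)
      fix x y assume xy: "(x,y) \<in> D"
      have "rect P x y \<subseteq> \<Squnion>\<^bsub>P\<^esub>((\<lambda>(x,y). rect P x y) ` D)"
        unfolding leP[symmetric] by (rule P.sup_upper[OF im]) (use xy in force)
      then show "(x,y) \<in> \<Squnion>\<^bsub>P\<^esub>((\<lambda>(x,y). rect P x y) ` D)" using rect_mem by auto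
    qed
    show "\<Squnion>\<^bsub>P\<^esub>((\<lambda>(x,y). rect P x y) ` D) \<sqsubseteq>\<^bsub>P\<^esub> D"
      by (rule P.sup_least[OF im D]) (use rect_le[OF D] in \<open>auto simp: leP\<close>)
  qed (use D P.sup_closed[OF im] in auto)
  then have "u D = \<Squnion>\<^bsub>Z\<^esub>(u ` (\<lambda>(x,y). rect P x y) ` D)"
    using u im by (metis cont_map_def frame_hom_def)
  also have "u ` (\<lambda>(x,y). rect P x y) ` D = (\<lambda>(x,y). h x \<sqinter>\<^bsub>Z\<^esub> k y) ` D"
    unfolding image_image using subP[OF D] ur by (intro image_cong) auto
  finally show "u D = pairing Z h k D" by (simp add: pairing_def)
qed

end
end

lemma prod_eq_pullback:
  assumes "frame X" "frame Y"
  shows "X \<times>\<^sub>L Y = pullback X Y point (to_point X) (to_point Y)"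
proof -
  interpret X: frame X by fact
  interpret Y: frame Y by fact
  have tx: "x \<sqinter>\<^bsub>X\<^esub> \<top>\<^bsub>X\<^esub> = x" "x \<sqinter>\<^bsub>X\<^esub> \<bottom>\<^bsub>X\<^esub> = \<bottom>\<^bsub>X\<^esub>" if "x \<in> carrier X" for x
    using X.top_meet[OF that] X.bottom_meet[OF that] X.eq_is_equal by (simp_all add: meet_comm)
  have ty: "x \<sqinter>\<^bsub>Y\<^esub> \<top>\<^bsub>Y\<^esub> = x" "x \<sqinter>\<^bsub>Y\<^esub> \<bottom>\<^bsub>Y\<^esub> = \<bottom>\<^bsub>Y\<^esub>" if "x \<in> carrier Y" for x
    using Y.top_meet[OF that] Y.bottom_meet[OF that] Y.eq_is_equal by (simp_all add: meet_comm)
  have bX: "\<Squnion>\<^bsub>X\<^esub>{} = \<bottom>\<^bsub>X\<^esub>" using X.weak_sup_empty X.eq_is_equal by simp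
  have bY: "\<Squnion>\<^bsub>Y\<^esub>{} = \<bottom>\<^bsub>Y\<^esub>" using Y.weak_sup_empty Y.eq_is_equal by simp
  have "(x \<sqinter>\<^bsub>X\<^esub> to_point X b, y) \<in> D \<longleftrightarrow> (x, y \<sqinter>\<^bsub>Y\<^esub> to_point Y b) \<in> D"
    if D: "c_ideal X Y D" and c: "x \<in> carrier X" "y \<in> carrier Y" for D x y b
    using tx[OF c(1)] ty[OF c(2)] c_idealD(3)[OF D, of "{}" y] c_idealD(4)[OF D, of "{}" x] c bX bY
    by (cases b) (auto simp: to_point_def)
  then show ?thesis unfolding prod_loc_def pullback_def by auto
qed

end

theory Submission
  imports Defs
begin

text \<open>
  Translating by the inverse identifies \<open>m\<close> with a product projection, and classically this gives
  an explicit image: \<open>y\<close> is part of \<open>a \<cdot> b\<close> as soon as \<open>u\<inverse> y\<close> lies in \<open>b\<close> for some \<open>u\<close> meeting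
  \<open>a\<close>.  The formula only asks which opens meet \<open>a\<close>, so \<open>a \<cdot> b\<close> depends on \<open>a\<close> only through its
  trace on any dense sublocale; by symmetry the same holds for \<open>b\<close>.

  Given \<open>g : Z \<rightarrow> U \<cdot> V\<close> and an open \<open>w\<close> of \<open>Z\<close>, the triples \<open>(x, a, b)\<close> with
  \<open>x \<sqinter> g\<^sup>*(a \<cdot> b) \<le> w\<close> are therefore well defined on traces \<open>(x, s a, t b)\<close>, and Frobenius reciprocity
  for \<open>m\<close> shows that they form an open set of \<open>Z \<times>\<^sub>U\<^sub>\<cdot>\<^sub>V (S \<times> T)\<close>.  It contains the pullback of \<open>z\<close>
  only if \<open>z \<le> w\<close>.  So the inverse image along the projection to \<open>Z\<close> is injective, which makes
  the projection an epimorphism.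
\<close>

subsection \<open>Frames and open sublocales\<close>

context frame
begin

lemma meet_top: "a \<in> carrier L \<Longrightarrow> a \<sqinter> \<top> = a" "a \<in> carrier L \<Longrightarrow> \<top> \<sqinter> a = a"
  using top_meet[of a] eq_is_equal by (simp_all add: meet_comm)

lemma meet_bot: "a \<in> carrier L \<Longrightarrow> a \<sqinter> \<bottom> = \<bottom>" "a \<in> carrier L \<Longrightarrow> \<bottom> \<sqinter> a = \<bottom>"
  using bottom_meet[of a] eq_is_equal by (simp_all add: meet_comm)

lemma le_bot: "a \<in> carrier L \<Longrightarrow> a \<sqsubseteq> \<bottom> \<Longrightarrow> a = \<bottom>"
  by (meson bottom_closed bottom_lower le_antisym)

lemma Sup_empty: "\<Squnion>{} = \<bottom>"
  using weak_sup_empty eq_is_equal by simp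

lemma meet_absorb: "a \<in> carrier L \<Longrightarrow> b \<in> carrier L \<Longrightarrow> a \<sqsubseteq> b \<Longrightarrow> a \<sqinter> b = a"
  using le_iff_join by metis

lemma sup_eqI:
  assumes "A \<subseteq> carrier L" "c \<in> carrier L" "\<And>a. a \<in> A \<Longrightarrow> a \<sqsubseteq> c"
    and "\<And>w. w \<in> carrier L \<Longrightarrow> (\<And>a. a \<in> A \<Longrightarrow> a \<sqsubseteq> w) \<Longrightarrow> c \<sqsubseteq> w"
  shows "\<Squnion>A = c"
proof (rule le_antisym)
  show "c \<sqsubseteq> \<Squnion>A" using assms(1) by (intro assms(4) sup_closed sup_upper)
qed (use assms in \<open>auto intro: sup_least\<close>)

lemma meet_eqI:
  assumes "a \<in> carrier L" "b \<in> carrier L" "c \<in> carrier L" "c \<sqsubseteq> a" "c \<sqsubseteq> b"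
    and "\<And>w. w \<in> carrier L \<Longrightarrow> w \<sqsubseteq> a \<Longrightarrow> w \<sqsubseteq> b \<Longrightarrow> w \<sqsubseteq> c"
  shows "a \<sqinter> b = c"
proof (rule le_antisym)
  show "a \<sqinter> b \<sqsubseteq> c" using assms(1,2) by (intro assms(6) meet_closed meet_left meet_right)
qed (use assms in \<open>auto intro: meet_le\<close>)

end

section \<open>Continuous maps and the terminal locale\<close>

lemma cont_mapD:
  assumes "cont_map X Y f"
  shows "frame X" "frame Y"
    and "y \<in> carrier Y \<Longrightarrow> f y \<in> carrier X"
    and "f \<top>\<^bsub>Y\<^esub> = \<top>\<^bsub>X\<^esub>"
    and "y \<in> carrier Y \<Longrightarrow> y' \<in> carrier Y \<Longrightarrow> f (y \<sqinter>\<^bsub>Y\<^esub> y') = f y \<sqinter>\<^bsub>X\<^esub> f y'"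
    and "K \<subseteq> carrier Y \<Longrightarrow> f (\<Squnion>\<^bsub>Y\<^esub>K) = \<Squnion>\<^bsub>X\<^esub>(f ` K)"
    and "f \<bottom>\<^bsub>Y\<^esub> = \<bottom>\<^bsub>X\<^esub>"
    and "y \<in> carrier Y \<Longrightarrow> y' \<in> carrier Y \<Longrightarrow> y \<sqsubseteq>\<^bsub>Y\<^esub> y' \<Longrightarrow> f y \<sqsubseteq>\<^bsub>X\<^esub> f y'"
proof -
  note f = assms[unfolded cont_map_def frame_hom_def]
  show X: "frame X" and Y: "frame Y" using f by auto
  show c: "f y \<in> carrier X" if "y \<in> carrier Y" for y using f that by auto
  show "f \<top>\<^bsub>Y\<^esub> = \<top>\<^bsub>X\<^esub>" using f by auto
  show m: "f (y \<sqinter>\<^bsub>Y\<^esub> y') = f y \<sqinter>\<^bsub>X\<^esub> f y'" if "y \<in> carrier Y" "y' \<in> carrier Y" for y y'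
    using f that by auto
  show s: "f (\<Squnion>\<^bsub>Y\<^esub>K) = \<Squnion>\<^bsub>X\<^esub>(f ` K)" if "K \<subseteq> carrier Y" for K using f that by auto
  show "f \<bottom>\<^bsub>Y\<^esub> = \<bottom>\<^bsub>X\<^esub>" using s[of "{}"] frame.Sup_empty[OF X] frame.Sup_empty[OF Y] by simp
  interpret X: frame X by fact
  interpret Y: frame Y by fact
  show "f y \<sqsubseteq>\<^bsub>X\<^esub> f y'" if "y \<in> carrier Y" "y' \<in> carrier Y" "y \<sqsubseteq>\<^bsub>Y\<^esub> y'"
    using that m[of y y'] c X.le_iff_join Y.le_iff_join by metis
qed

lemma cont_map_comp:
  assumes f: "cont_map X Y f" and g: "cont_map Y Z g"
  shows "cont_map X Z (g \<odot> f)"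
proof -
  have "g ` K \<subseteq> carrier Y" if "K \<subseteq> carrier Z" for K using that cont_mapD(3)[OF g] by auto
  then show ?thesis
    unfolding cont_map_def frame_hom_def
    using cont_mapD[OF f] cont_mapD[OF g] by (auto simp: image_comp)
qed

lemma cont_map_id: "frame X \<Longrightarrow> cont_map X X id"
  by (simp add: cont_map_def frame_hom_def)

lemma frame_point: "frame point"
  and point_simps: "\<top>\<^bsub>point\<^esub>" "\<not> \<bottom>\<^bsub>point\<^esub>" "p \<sqinter>\<^bsub>point\<^esub> q \<longleftrightarrow> p \<and> q" "\<Squnion>\<^bsub>point\<^esub>K \<longleftrightarrow> True \<in> K"
proof -
  interpret partial_order point by unfold_locales (auto simp: point_def)
  have sup: "least point (True \<in> K) (Upper point K)" for K
    by (auto simp: least_def Upper_def point_def)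
  interpret complete_lattice point
  proof (rule complete_latticeI)
    show "\<exists>s. is_lub point s K" for K using sup by blast
    show "\<exists>s. is_glb point s K" for K
      by (rule exI[of _ "False \<notin> K"]) (auto simp: greatest_def Lower_def point_def, (metis (full_types))+)
  qed
  have s: "\<Squnion>\<^bsub>point\<^esub>K \<longleftrightarrow> True \<in> K" for K
    using least_unique[OF sup sup_lub[of K]] by (simp add: point_def)
  have m: "p \<sqinter>\<^bsub>point\<^esub> q \<longleftrightarrow> p \<and> q" for p q
    using meet_left[of p q] meet_right[of p q] meet_le[of True p q] by (auto simp: point_def)
  show "\<top>\<^bsub>point\<^esub>" using top_higher[of True] by (simp add: point_def)
  show "\<not> \<bottom>\<^bsub>point\<^esub>" using bottom_lower[of False] by (simp add: point_def)
  show "frame point" by unfold_locales (auto simp: s m)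
  show "p \<sqinter>\<^bsub>point\<^esub> q \<longleftrightarrow> p \<and> q" "\<Squnion>\<^bsub>point\<^esub>K \<longleftrightarrow> True \<in> K" by (fact m s)+
qed

lemma cont_map_to_point: assumes "frame X" shows "cont_map X point (to_point X)"
proof -
  interpret frame X by fact
  have "to_point X (\<Squnion>\<^bsub>point\<^esub>K) = \<Squnion>\<^bsub>X\<^esub>(to_point X ` K)" for K
    by (rule sup_eqI[symmetric]) (auto simp: to_point_def point_simps)
  then show ?thesis
    unfolding cont_map_def frame_hom_def using frame_point assms
    by (auto simp: to_point_def point_simps meet_top meet_bot meet_idem)
qed

lemma to_point_comp: "cont_map X Y f \<Longrightarrow> f (to_point Y p) = to_point X p"
  by (simp add: to_point_def cont_mapD(4,7))

section \<open>Open sublocales as frames\<close>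

lemma assumes "frame X" and U: "U \<in> carrier X"
  shows open_sub_frame: "frame (open_sub X U)"
    and open_sub_meet: "a \<in> carrier X \<Longrightarrow> b \<in> carrier X \<Longrightarrow> a \<sqsubseteq>\<^bsub>X\<^esub> U \<Longrightarrow> b \<sqsubseteq>\<^bsub>X\<^esub> U \<Longrightarrow>
          a \<sqinter>\<^bsub>open_sub X U\<^esub> b = a \<sqinter>\<^bsub>X\<^esub> b"
    and open_sub_Sup: "K \<subseteq> carrier (open_sub X U) \<Longrightarrow> \<Squnion>\<^bsub>open_sub X U\<^esub>K = \<Squnion>\<^bsub>X\<^esub>K"
    and open_sub_top: "\<top>\<^bsub>open_sub X U\<^esub> = U"
    and open_sub_bot: "\<bottom>\<^bsub>open_sub X U\<^esub> = \<bottom>\<^bsub>X\<^esub>"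
proof -
  interpret X: frame X by fact
  let ?O = "open_sub X U"
  have O: "carrier ?O = {W \<in> carrier X. W \<sqsubseteq>\<^bsub>X\<^esub> U}" "le ?O = le X" "eq ?O = eq X"
    by (auto simp: open_sub_def)
  interpret partial_order ?O
    by unfold_locales (auto simp: O X.eq_is_equal intro: X.le_antisym X.le_trans)
  have sup_c: "\<Squnion>\<^bsub>X\<^esub>K \<in> carrier ?O" if "K \<subseteq> carrier ?O" for K
    using that U by (auto simp: O intro!: X.sup_least X.sup_closed)
  have lub: "least ?O (\<Squnion>\<^bsub>X\<^esub>K) (Upper ?O K)" if "K \<subseteq> carrier ?O" for K
    unfolding least_def Upper_def using that sup_c[OF that]
    by (auto simp: O subset_iff intro!: X.sup_least X.sup_upper)
  interpret complete_lattice ?O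
  proof (rule complete_latticeI)
    fix K assume K: "K \<subseteq> carrier ?O"
    show "\<exists>s. is_lub ?O s K" using lub[OF K] by blast
    have c: "K \<subseteq> carrier X" using K by (auto simp: O)
    have i: "\<Sqinter>\<^bsub>X\<^esub>K \<in> carrier X" by (rule X.inf_closed[OF c])
    \<comment> \<open>Infima are those of \<open>X\<close> cut down by \<open>U\<close>; the cut
      matters for \<open>K = {}\<close>, whose infimum in \<open>X\<close> is \<open>\<top>\<close>.
      Joins need no such correction.\<close>
    have "U \<sqinter>\<^bsub>X\<^esub> \<Sqinter>\<^bsub>X\<^esub>K \<sqsubseteq>\<^bsub>X\<^esub> a" if "a \<in> K" for a
      by (rule X.le_trans[OF X.meet_right[OF U i] X.inf_lower[OF c that]]) (use U i that c in auto)
    moreover have "U \<sqinter>\<^bsub>X\<^esub> \<Sqinter>\<^bsub>X\<^esub>K \<sqsubseteq>\<^bsub>X\<^esub> U" by (rule X.meet_left[OF U i])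
    ultimately show "\<exists>s. is_glb ?O s K"
      using c i U K
      by (intro exI[of _ "U \<sqinter>\<^bsub>X\<^esub> \<Sqinter>\<^bsub>X\<^esub>K"]) 
         (auto simp: greatest_def Lower_def O subset_iff intro!: X.meet_le X.inf_greatest)
  qed
  show s: "\<Squnion>\<^bsub>?O\<^esub>K = \<Squnion>\<^bsub>X\<^esub>K" if "K \<subseteq> carrier ?O" for K
    using least_unique[OF sup_lub[OF that] lub[OF that]] .
  show m: "a \<sqinter>\<^bsub>?O\<^esub> b = a \<sqinter>\<^bsub>X\<^esub> b"
    if "a \<in> carrier X" "b \<in> carrier X" "a \<sqsubseteq>\<^bsub>X\<^esub> U" "b \<sqsubseteq>\<^bsub>X\<^esub> U" for a b
  proof (rule X.meet_eqI[symmetric])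
    have c: "a \<in> carrier ?O" "b \<in> carrier ?O" using that by (auto simp: O)
    show "a \<sqinter>\<^bsub>?O\<^esub> b \<in> carrier X" using meet_closed[OF c] by (simp add: O)
    show "a \<sqinter>\<^bsub>?O\<^esub> b \<sqsubseteq>\<^bsub>X\<^esub> a" using meet_left[OF c] by (simp add: O)
    show "a \<sqinter>\<^bsub>?O\<^esub> b \<sqsubseteq>\<^bsub>X\<^esub> b" using meet_right[OF c] by (simp add: O)
    fix w assume w: "w \<in> carrier X" "w \<sqsubseteq>\<^bsub>X\<^esub> a" "w \<sqsubseteq>\<^bsub>X\<^esub> b"
    have "w \<sqsubseteq>\<^bsub>X\<^esub> U" using X.le_trans[OF w(2) that(3)] w that U by simp
    then show "w \<sqsubseteq>\<^bsub>X\<^esub> a \<sqinter>\<^bsub>?O\<^esub> b" using meet_le[of w a b] w c by (simp add: O)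
  qed (use that in auto)
  show "frame ?O"
  proof
    fix a B assume a: "a \<in> carrier ?O" and B: "B \<subseteq> carrier ?O"
    have "\<And>b. b \<in> B \<Longrightarrow> a \<sqinter>\<^bsub>?O\<^esub> b = a \<sqinter>\<^bsub>X\<^esub> b" using a B by (intro m) (auto simp: O)
    then have "(\<lambda>b. a \<sqinter>\<^bsub>?O\<^esub> b) ` B = (\<lambda>b. a \<sqinter>\<^bsub>X\<^esub> b) ` B" by simp
    moreover have "(\<lambda>b. a \<sqinter>\<^bsub>?O\<^esub> b) ` B \<subseteq> carrier ?O" using a B by auto
    moreover have "a \<sqinter>\<^bsub>?O\<^esub> \<Squnion>\<^bsub>?O\<^esub>B = a \<sqinter>\<^bsub>X\<^esub> \<Squnion>\<^bsub>X\<^esub>B"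
      using m[of a "\<Squnion>\<^bsub>X\<^esub>B"] a sup_c[OF B] s[OF B] by (simp add: O)
    ultimately show "a \<sqinter>\<^bsub>?O\<^esub> \<Squnion>\<^bsub>?O\<^esub>B = \<Squnion>\<^bsub>?O\<^esub>((\<lambda>b. a \<sqinter>\<^bsub>?O\<^esub> b) ` B)"
      using X.meet_sup_distrib[of a B] s[of "(\<lambda>b. a \<sqinter>\<^bsub>?O\<^esub> b) ` B"] a B
      by (auto simp: O subset_iff)
  qed
  show "\<top>\<^bsub>?O\<^esub> = U"
    using top_higher[of U] top_closed U X.le_antisym[of U "\<top>\<^bsub>?O\<^esub>"] by (simp add: O)
  show "\<bottom>\<^bsub>?O\<^esub> = \<bottom>\<^bsub>X\<^esub>" 
    using bottom_lower[of "\<bottom>\<^bsub>X\<^esub>"] bottom_closed U X.le_bot[of "\<bottom>\<^bsub>?O\<^esub>"] by (simp add: O)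
qed

lemma carrier_open_sub: "carrier (open_sub X U) = {W \<in> carrier X. W \<sqsubseteq>\<^bsub>X\<^esub> U}"
  and le_open_sub: "le (open_sub X U) = le X"
  by (auto simp: open_sub_def)

subsection \<open>Binary products\<close>

locale product_square = X: frame X + Y: frame Y
  for X :: "'a gorder" and Y :: "'b gorder"

text \<open>A product is a pullback over the terminal locale, so the whole pullback theory is
  inherited. The rewrite makes the inherited facts speak of \<open>X \<times>\<^sub>L Y\<close>, and
  the compatibility condition on components becomes automatic.\<close>

sublocale product_square \<subseteq> pullback_square X Y point "to_point X" "to_point Y"
  rewrites "pullback X Y point (to_point X) (to_point Y) = X \<times>\<^sub>L Y"
proof -
  show "pullback_square X Y point (to_point X) (to_point Y)"
    using cont_map_to_point[OF X.frame_axioms] cont_map_to_point[OF Y.frame_axioms] X.frame_axioms Y.frame_axioms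
    by (auto simp: pullback_square_def pullback_square_axioms_def)
  show "pullback X Y point (to_point X) (to_point Y) = X \<times>\<^sub>L Y"
    by (simp add: prod_eq_pullback X.frame_axioms Y.frame_axioms)
qed

context product_square
begin

lemma point_commutes:
  assumes "cont_map Z X h" "cont_map Z Y k"
  shows "map_eq point (to_point X \<odot> h) (to_point Y \<odot> k)"
  using assms by (simp add: map_eq_def to_point_comp)

lemma pair_cont: "cont_map Z X h \<Longrightarrow> cont_map Z Y k \<Longrightarrow> cont_map Z (X \<times>\<^sub>L Y) (pairing Z h k)"
  by (rule pairing_cont[OF _ _ point_commutes])

lemma pair_pr1: "cont_map Z X h \<Longrightarrow> cont_map Z Y k \<Longrightarrow> x \<in> carrier X \<Longrightarrow> pairing Z h k (pr1 (X \<times>\<^sub>L Y) Y x) = h x"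
  and pair_pr2: "cont_map Z X h \<Longrightarrow> cont_map Z Y k \<Longrightarrow> y \<in> carrier Y \<Longrightarrow> pairing Z h k (pr2 (X \<times>\<^sub>L Y) X y) = k y"
  using pairing_pr[OF _ _ point_commutes, of Z h k] by (simp_all add: map_eq_def)

lemma pairing_rect: "cont_map Z X h \<Longrightarrow> cont_map Z Y k \<Longrightarrow> x \<in> carrier X \<Longrightarrow> y \<in> carrier Y \<Longrightarrow>
    pairing Z h k (rect (X \<times>\<^sub>L Y) x y) = h x \<sqinter>\<^bsub>Z\<^esub> k y"
  by (rule pair_rect[OF _ _ point_commutes])

lemma pairing_upper: "cont_map Z X h \<Longrightarrow> cont_map Z Y k \<Longrightarrow> D \<in> carrier (X \<times>\<^sub>L Y) \<Longrightarrow> (x, y) \<in> D \<Longrightarrow>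
    h x \<sqinter>\<^bsub>Z\<^esub> k y \<sqsubseteq>\<^bsub>Z\<^esub> pairing Z h k D"
  by (rule pair_upper[OF _ _ point_commutes])

text \<open>The identity has the two projections as components, and a map into the product is
  determined by its components.\<close>

lemma pairing_id:
  assumes D: "D \<in> carrier (X \<times>\<^sub>L Y)"
  shows "pairing (X \<times>\<^sub>L Y) (pr1 (X \<times>\<^sub>L Y) Y) (pr2 (X \<times>\<^sub>L Y) X) D = D"
  using pairing_unique[OF pr1_cont pr2_cont point_commutes[OF pr1_cont pr2_cont] cont_map_id[OF P.frame_axioms]] D
  by (simp add: map_eq_def)

text \<open>Maps count as equal when they agree on carriers, which is weaker than equality of
  functions; this congruence is what lets equal components be exchanged.\<close>

lemma pairing_cong:
  assumes "D \<in> carrier (X \<times>\<^sub>L Y)" "\<And>x. x \<in> carrier X \<Longrightarrow> h x = h' x" "\<And>y. y \<in> carrier Y \<Longrightarrow> k y = k' y"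
  shows "pairing Z h k D = pairing Z h' k' D"
proof -
  have "(\<lambda>(x, y). h x \<sqinter>\<^bsub>Z\<^esub> k y) ` D = (\<lambda>(x, y). h' x \<sqinter>\<^bsub>Z\<^esub> k' y) ` D"
    using subP[OF assms(1)] assms(2,3) by (intro image_cong) auto
  then show ?thesis by (simp add: pairing_def)
qed

lemma pairing_comp:
  assumes u: "cont_map Z' Z u" and h: "cont_map Z X h" and k: "cont_map Z Y k" and D: "D \<in> carrier (X \<times>\<^sub>L Y)"
  shows "u (pairing Z h k D) = pairing Z' (h \<odot> u) (k \<odot> u) D"
proof -
  have c: "h x \<in> carrier Z" "k y \<in> carrier Z" if "(x,y) \<in> D" for x y
    using that subP[OF D] cont_mapD(3)[OF h] cont_mapD(3)[OF k] by auto
  interpret Z: frame Z by (rule cont_mapD(2)[OF u])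
  have "u ` (\<lambda>(x, y). h x \<sqinter>\<^bsub>Z\<^esub> k y) ` D = (\<lambda>(x, y). u (h x) \<sqinter>\<^bsub>Z'\<^esub> u (k y)) ` D"
    unfolding image_image using c cont_mapD(5)[OF u] by (intro image_cong) auto
  moreover have "(\<lambda>(x, y). h x \<sqinter>\<^bsub>Z\<^esub> k y) ` D \<subseteq> carrier Z" using c by auto
  ultimately show ?thesis
    unfolding pairing_def by (simp add: cont_mapD(6)[OF u])
qed

text \<open>A c-ideal is closed under joins in each coordinate, including the empty join; hence
  every open of the product contains all degenerate pairs.\<close>

lemma bot_mem:
  assumes D: "D \<in> carrier (X \<times>\<^sub>L Y)"
  shows "y \<in> carrier Y \<Longrightarrow> (\<bottom>\<^bsub>X\<^esub>, y) \<in> D" "x \<in> carrier X \<Longrightarrow> (x, \<bottom>\<^bsub>Y\<^esub>) \<in> D"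
  using c_idealD(3)[OF ciP[OF D], of "{}"] c_idealD(4)[OF ciP[OF D], of "{}"]
  by (auto simp: X.Sup_empty Y.Sup_empty)

lemma carrier_prod: "D \<in> carrier (X \<times>\<^sub>L Y) \<longleftrightarrow> c_ideal X Y D"
  by (simp add: prod_loc_def)

text \<open>Adding the degenerate pairs to the pairs below \<open>(x, y)\<close> already gives a
  saturated set. Classically, a nonzero join has a nonzero member, and that member forces the bound
  on the other coordinate. So inclusion of rectangles is decided by which opens are nonzero, and
  this is where density can enter later.\<close>

lemma rect_eq:
  assumes c: "x \<in> carrier X" "y \<in> carrier Y"
  shows "rect (X \<times>\<^sub>L Y) x y = {(x', y'). x' \<in> carrier X \<and> y' \<in> carrier Y \<and>
     (x' = \<bottom>\<^bsub>X\<^esub> \<or> y' = \<bottom>\<^bsub>Y\<^esub> \<or> x' \<sqsubseteq>\<^bsub>X\<^esub> x \<and> y' \<sqsubseteq>\<^bsub>Y\<^esub> y)}" (is "_ = ?R")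
proof
  have "c_ideal X Y ?R"
    unfolding c_ideal_def
  proof (intro conjI allI impI; (elim conjE)?)
    show "?R \<subseteq> carrier X \<times> carrier Y" by auto
  next
    fix a b a' b' assume h: "(a,b) \<in> ?R" "a' \<in> carrier X" "b' \<in> carrier Y" "a' \<sqsubseteq>\<^bsub>X\<^esub> a" "b' \<sqsubseteq>\<^bsub>Y\<^esub> b"
    then consider "a = \<bottom>\<^bsub>X\<^esub>" | "b = \<bottom>\<^bsub>Y\<^esub>" | "a \<sqsubseteq>\<^bsub>X\<^esub> x" "b \<sqsubseteq>\<^bsub>Y\<^esub> y" by auto
    then have "a' = \<bottom>\<^bsub>X\<^esub> \<or> b' = \<bottom>\<^bsub>Y\<^esub> \<or> a' \<sqsubseteq>\<^bsub>X\<^esub> x \<and> b' \<sqsubseteq>\<^bsub>Y\<^esub> y"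
    proof cases
      case 1 then show ?thesis using h X.le_bot[of a'] by simp
    next
      case 2 then show ?thesis using h Y.le_bot[of b'] by simp
    next
      case 3 then show ?thesis
        using h c X.le_trans[of a' a x] Y.le_trans[of b' b y] by auto
    qed
    then show "(a',b') \<in> ?R" using h by simp
  next
    fix K b assume h: "K \<subseteq> carrier X" "b \<in> carrier Y" "\<forall>a\<in>K. (a,b) \<in> ?R"
    have "b \<sqsubseteq>\<^bsub>Y\<^esub> y" if "b \<noteq> \<bottom>\<^bsub>Y\<^esub>" "\<Squnion>\<^bsub>X\<^esub>K \<noteq> \<bottom>\<^bsub>X\<^esub>"
    proof (rule ccontr)
      assume "\<not> b \<sqsubseteq>\<^bsub>Y\<^esub> y"
      then have "a \<sqsubseteq>\<^bsub>X\<^esub> \<bottom>\<^bsub>X\<^esub>" if "a \<in> K" for a using h \<open>b \<noteq> _\<close> that by auto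
      then have "\<Squnion>\<^bsub>X\<^esub>K \<sqsubseteq>\<^bsub>X\<^esub> \<bottom>\<^bsub>X\<^esub>" using h by (intro X.sup_least) auto
      then show False using that(2) h X.le_bot by auto
    qed
    moreover have "\<Squnion>\<^bsub>X\<^esub>K \<sqsubseteq>\<^bsub>X\<^esub> x" if "b \<noteq> \<bottom>\<^bsub>Y\<^esub>"
      using h that c by (intro X.sup_least) auto
    ultimately show "(\<Squnion>\<^bsub>X\<^esub>K, b) \<in> ?R" using h by auto
  next
    fix a K assume h: "a \<in> carrier X" "K \<subseteq> carrier Y" "\<forall>b\<in>K. (a,b) \<in> ?R"
    have "a \<sqsubseteq>\<^bsub>X\<^esub> x" if "a \<noteq> \<bottom>\<^bsub>X\<^esub>" "\<Squnion>\<^bsub>Y\<^esub>K \<noteq> \<bottom>\<^bsub>Y\<^esub>"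
    proof (rule ccontr)
      assume "\<not> a \<sqsubseteq>\<^bsub>X\<^esub> x"
      then have "b \<sqsubseteq>\<^bsub>Y\<^esub> \<bottom>\<^bsub>Y\<^esub>" if "b \<in> K" for b using h \<open>a \<noteq> _\<close> that by auto
      then have "\<Squnion>\<^bsub>Y\<^esub>K \<sqsubseteq>\<^bsub>Y\<^esub> \<bottom>\<^bsub>Y\<^esub>" using h by (intro Y.sup_least) auto
      then show False using that(2) h Y.le_bot by auto
    qed
    moreover have "\<Squnion>\<^bsub>Y\<^esub>K \<sqsubseteq>\<^bsub>Y\<^esub> y" if "a \<noteq> \<bottom>\<^bsub>X\<^esub>"
      using h that c by (intro Y.sup_least) auto
    ultimately show "(a, \<Squnion>\<^bsub>Y\<^esub>K) \<in> ?R" using h by auto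
  qed
  then show "rect (X \<times>\<^sub>L Y) x y \<subseteq> ?R"
    using c by (intro rect_le) (auto simp: carrier_prod)
  show "?R \<subseteq> rect (X \<times>\<^sub>L Y) x y"
    using c_idealD(2)[OF ciP[OF rect_c[OF c]] rect_mem] bot_mem[OF rect_c[OF c]] by auto
qed

end

subsection \<open>Openness of multiplication\<close>

locale loc_group =
  fixes G :: "'g gorder" and m :: "'g \<Rightarrow> ('g \<times> 'g) set" and e :: "'g \<Rightarrow> bool" and i :: "'g \<Rightarrow> 'g"
  assumes localic_group: "localic_group G m e i"
begin

lemma m_cont: "cont_map (G \<times>\<^sub>L G) G m" and e_cont: "cont_map point G e" and i_cont: "cont_map G G i"
  using localic_group by (simp_all add: localic_group_def)

end

sublocale loc_group \<subseteq> frame G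
  by (rule cont_mapD(2)[OF m_cont])

sublocale loc_group \<subseteq> sq: product_square G G
  by unfold_locales

context loc_group
begin

section \<open>Group laws for generalized elements\<close>

abbreviation "GG \<equiv> G \<times>\<^sub>L G"
abbreviation "p1 \<equiv> pr1 GG G"
abbreviation "p2 \<equiv> pr2 GG G"

lemmas m_c = cont_mapD(3)[OF m_cont]

text \<open>The product of two generalized elements \<open>p, q : Z \<rightarrow> G\<close>.
  Calculations with elements of a group then carry over to maps out of an arbitrary
  \<open>Z\<close>.\<close>

definition mul :: "'z gorder \<Rightarrow> ('g \<Rightarrow> 'z) \<Rightarrow> ('g \<Rightarrow> 'z) \<Rightarrow> 'g \<Rightarrow> 'z" where
  "mul Z p q = m \<odot> pairing Z p q"

lemma mul_cont: "cont_map Z G p \<Longrightarrow> cont_map Z G q \<Longrightarrow> cont_map Z G (mul Z p q)"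
  unfolding mul_def by (rule cont_map_comp[OF sq.pair_cont m_cont])

lemma mul_cong:
  assumes "W \<in> carrier G" "\<And>x. x \<in> carrier G \<Longrightarrow> p x = p' x" "\<And>x. x \<in> carrier G \<Longrightarrow> q x = q' x"
  shows "mul Z p q W = mul Z p' q' W"
  using sq.pairing_cong[OF m_c[OF assms(1)] assms(2,3)] by (simp add: mul_def)

lemma mul_comp:
  assumes "cont_map Z' Z u" "cont_map Z G p" "cont_map Z G q" "W \<in> carrier G"
  shows "u (mul Z p q W) = mul Z' (p \<odot> u) (q \<odot> u) W"
  using sq.pairing_comp[OF assms(1-3) m_c[OF assms(4)]] by (simp add: mul_def)

text \<open>The group axiom is associativity of the three projections \<open>a, b, c\<close> of the
  triple product. The general case is its pullback along
  \<open>t = (p, q, r) : Z \<rightarrow> (G \<times> G) \<times> G\<close>.\<close>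

lemma mul_assoc:
  assumes p: "cont_map Z G p" and q: "cont_map Z G q" and r: "cont_map Z G r" and W: "W \<in> carrier G"
  shows "mul Z (mul Z p q) r W = mul Z p (mul Z q r) W"
proof -
  interpret GGG: product_square GG G by unfold_locales
  let ?GGG = "GG \<times>\<^sub>L G"
  define a where "a = p1 \<odot> pr1 ?GGG G"
  define b where "b = p2 \<odot> pr1 ?GGG G"
  define c where "c = pr2 ?GGG GG"
  define t where "t = pairing Z (pairing Z p q) r"
  have ax: "mul ?GGG (mul ?GGG a b) c W = mul ?GGG a (mul ?GGG b c) W"
    using localic_group W unfolding localic_group_def Let_def a_def b_def c_def mul_def map_eq_def by simp
  have pq: "cont_map Z GG (pairing Z p q)" by (rule sq.pair_cont[OF p q])
  have t: "cont_map Z ?GGG t" unfolding t_def by (rule GGG.pair_cont[OF pq r])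
  have a: "cont_map ?GGG G a" and b: "cont_map ?GGG G b" and c: "cont_map ?GGG G c"
    unfolding a_def b_def c_def
    by (intro cont_map_comp[OF GGG.pr1_cont] sq.pr1_cont sq.pr2_cont GGG.pr2_cont)+
  have p1c: "p1 x \<in> carrier GG" "p2 x \<in> carrier GG" if "x \<in> carrier G" for x
    using that cont_mapD(3)[OF sq.pr1_cont] cont_mapD(3)[OF sq.pr2_cont] by auto
  have ta: "(a \<odot> t) x = p x" and tb: "(b \<odot> t) x = q x" and tc: "(c \<odot> t) x = r x" if "x \<in> carrier G" for x
    using that p1c sq.pair_pr1[OF p q] sq.pair_pr2[OF p q]
    by (simp_all add: t_def a_def b_def c_def GGG.pair_pr1[OF pq r] GGG.pair_pr2[OF pq r])
  have "t (mul ?GGG (mul ?GGG a b) c W) = mul Z (mul ?GGG a b \<odot> t) (c \<odot> t) W"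
    by (rule mul_comp[OF t mul_cont[OF a b] c W])
  also have "\<dots> = mul Z (mul Z p q) r W"
  proof (rule mul_cong[OF W _ tc])
    fix x assume x: "x \<in> carrier G"
    show "(mul ?GGG a b \<odot> t) x = mul Z p q x"
      using mul_comp[OF t a b x] mul_cong[OF x ta tb] by simp
  qed
  finally have 1: "t (mul ?GGG (mul ?GGG a b) c W) = mul Z (mul Z p q) r W" .
  have "t (mul ?GGG a (mul ?GGG b c) W) = mul Z (a \<odot> t) (mul ?GGG b c \<odot> t) W"
    by (rule mul_comp[OF t a mul_cont[OF b c] W])
  also have "\<dots> = mul Z p (mul Z q r) W"
  proof (rule mul_cong[OF W ta])
    fix x assume x: "x \<in> carrier G"
    show "(mul ?GGG b c \<odot> t) x = mul Z q r x"
      using mul_comp[OF t b c x] mul_cong[OF x tb tc] by simp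
  qed
  finally show ?thesis using 1 ax by simp
qed

lemma unit_cont: "frame Z \<Longrightarrow> cont_map Z G (e \<odot> to_point Z)"
  by (rule cont_map_comp[OF cont_map_to_point e_cont])

text \<open>The axioms are the case of the generic element \<open>id\<close> of \<open>G\<close>;
  pulling them back along \<open>p\<close> gives the laws for \<open>p\<close>. The constant element
  \<open>e\<close> is stable under this since maps to the terminal locale are unique.\<close>

lemma
  assumes p: "cont_map Z G p" and W: "W \<in> carrier G"
  shows mul_unit_left: "mul Z (e \<odot> to_point Z) p W = p W"
    and mul_unit_right: "mul Z p (e \<odot> to_point Z) W = p W"
    and mul_inv_left: "mul Z (i \<odot> p) p W = (e \<odot> to_point Z) W"
    and mul_inv_right: "mul Z p (i \<odot> p) W = (e \<odot> to_point Z) W"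
proof -
  note I = cont_map_id[OF frame_axioms] and E = unit_cont[OF frame_axioms]
  have ax: "mul G (e \<odot> to_point G) id W = W" "mul G id (e \<odot> to_point G) W = W"
     "mul G i id W = (e \<odot> to_point G) W" "mul G id i W = (e \<odot> to_point G) W"
    using localic_group W by (simp_all add: localic_group_def map_eq_def mul_def)
  have ep: "e \<odot> to_point G \<odot> p = e \<odot> to_point Z" using to_point_comp[OF p] by (auto simp: fun_eq_iff)
  show "mul Z (e \<odot> to_point Z) p W = p W"
    using mul_comp[OF p E I W] ax(1) ep by simp
  show "mul Z p (e \<odot> to_point Z) W = p W"
    using mul_comp[OF p I E W] ax(2) ep by simp
  show "mul Z (i \<odot> p) p W = (e \<odot> to_point Z) W"
    using mul_comp[OF p i_cont I W] ax(3) to_point_comp[OF p] by simp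
  show "mul Z p (i \<odot> p) W = (e \<odot> to_point Z) W"
    using mul_comp[OF p I i_cont W] ax(4) to_point_comp[OF p] by simp
qed

lemma
  assumes p: "cont_map Z G p" and q: "cont_map Z G q" and W: "W \<in> carrier G"
  shows mul_cancel_left: "mul Z p (mul Z (i \<odot> p) q) W = q W"
    and mul_cancel_left_inv: "mul Z (i \<odot> p) (mul Z p q) W = q W"
    and mul_cancel_right: "mul Z (mul Z q (i \<odot> p)) p W = q W"
    and mul_cancel_right_inv: "mul Z (mul Z q p) (i \<odot> p) W = q W"
proof -
  have ip: "cont_map Z G (i \<odot> p)" by (rule cont_map_comp[OF p i_cont])
  have "mul Z p (mul Z (i \<odot> p) q) W = mul Z (mul Z p (i \<odot> p)) q W"
    by (rule mul_assoc[OF p ip q W, symmetric])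
  also have "\<dots> = mul Z (e \<odot> to_point Z) q W"
    by (rule mul_cong[OF W mul_inv_right[OF p]]) simp_all
  also have "\<dots> = q W" by (rule mul_unit_left[OF q W])
  finally show "mul Z p (mul Z (i \<odot> p) q) W = q W" .
  have "mul Z (i \<odot> p) (mul Z p q) W = mul Z (mul Z (i \<odot> p) p) q W"
    by (rule mul_assoc[OF ip p q W, symmetric])
  also have "\<dots> = mul Z (e \<odot> to_point Z) q W"
    by (rule mul_cong[OF W mul_inv_left[OF p]]) simp_all
  also have "\<dots> = q W" by (rule mul_unit_left[OF q W])
  finally show "mul Z (i \<odot> p) (mul Z p q) W = q W" .
  have "mul Z (mul Z q (i \<odot> p)) p W = mul Z q (mul Z (i \<odot> p) p) W"
    by (rule mul_assoc[OF q ip p W])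
  also have "\<dots> = mul Z q (e \<odot> to_point Z) W"
    by (rule mul_cong[OF W _ mul_inv_left[OF p]]) simp_all
  also have "\<dots> = q W" by (rule mul_unit_right[OF q W])
  finally show "mul Z (mul Z q (i \<odot> p)) p W = q W" .
  have "mul Z (mul Z q p) (i \<odot> p) W = mul Z q (mul Z p (i \<odot> p)) W"
    by (rule mul_assoc[OF q p ip W])
  also have "\<dots> = mul Z q (e \<odot> to_point Z) W"
    by (rule mul_cong[OF W _ mul_inv_right[OF p]]) simp_all
  also have "\<dots> = q W" by (rule mul_unit_right[OF q W])
  finally show "mul Z (mul Z q p) (i \<odot> p) W = q W" .
qed

lemma mul_projections: "W \<in> carrier G \<Longrightarrow> mul GG p1 p2 W = m W"
  using sq.pairing_id[OF m_c] by (simp add: mul_def)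

text \<open>Since \<open>(u, v) \<mapsto> (u, u v)\<close> is invertible, with inverse \<open>(u, y) \<mapsto> (u, u\<inverse> y)\<close>, it identifies
  multiplication with a projection.\<close>

definition ldiv :: "'g \<Rightarrow> ('g \<times> 'g) set" where "ldiv = mul GG (i \<odot> p1) p2"
text \<open>The mirror image: \<open>(y, v)\<close> goes to y times the inverse of v, which inverts
  the other shear, \<open>(u, v)\<close> to \<open>(u v, v)\<close>.\<close>

definition rdiv :: "'g \<Rightarrow> ('g \<times> 'g) set" where "rdiv = mul GG p1 (i \<odot> p2)"

lemma ldiv_cont: "cont_map GG G ldiv" and rdiv_cont: "cont_map GG G rdiv"
  unfolding ldiv_def rdiv_def
  by (intro mul_cont sq.pr1_cont sq.pr2_cont cont_map_comp[OF sq.pr1_cont i_cont]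
        cont_map_comp[OF sq.pr2_cont i_cont])+

text \<open>The inverse shear followed by multiplication is the second projection: u times (the
  inverse of u times y) is y. The lemma \<open>m_ldiv\<close> is the same cancellation in the
  opposite order, and \<open>rdiv_m\<close>, \<open>m_rdiv\<close> are the mirrored
  versions.\<close>

lemma ldiv_m: "c \<in> carrier G \<Longrightarrow> pairing GG p1 ldiv (m c) = p2 c"
  using mul_cancel_left[OF sq.pr1_cont sq.pr2_cont] by (simp add: mul_def ldiv_def)

lemma rdiv_m: "c \<in> carrier G \<Longrightarrow> pairing GG rdiv p2 (m c) = p1 c"
  using mul_cancel_right[OF sq.pr2_cont sq.pr1_cont] by (simp add: mul_def rdiv_def)

lemma m_ldiv:
  assumes W: "W \<in> carrier G"
  shows "pairing GG p1 m (ldiv W) = p2 W"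
proof -
  let ?t = "pairing GG p1 m"
  have t: "cont_map GG GG ?t" by (rule sq.pair_cont[OF sq.pr1_cont m_cont])
  have "?t (ldiv W) = mul GG (i \<odot> p1 \<odot> ?t) (p2 \<odot> ?t) W"
    unfolding ldiv_def by (rule mul_comp[OF t cont_map_comp[OF sq.pr1_cont i_cont] sq.pr2_cont W])
  also have "\<dots> = mul GG (i \<odot> p1) (mul GG p1 p2) W"
    by (rule mul_cong[OF W])
       (use cont_mapD(3)[OF i_cont] in \<open>simp_all add: sq.pair_pr1[OF sq.pr1_cont m_cont] sq.pair_pr2[OF sq.pr1_cont m_cont] mul_projections\<close>)
  also have "\<dots> = p2 W" by (rule mul_cancel_left_inv[OF sq.pr1_cont sq.pr2_cont W])
  finally show ?thesis .
qed

lemma m_rdiv: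
  assumes W: "W \<in> carrier G"
  shows "pairing GG m p2 (rdiv W) = p1 W"
proof -
  let ?t = "pairing GG m p2"
  have t: "cont_map GG GG ?t" by (rule sq.pair_cont[OF m_cont sq.pr2_cont])
  have "?t (rdiv W) = mul GG (p1 \<odot> ?t) (i \<odot> p2 \<odot> ?t) W"
    unfolding rdiv_def by (rule mul_comp[OF t sq.pr1_cont cont_map_comp[OF sq.pr2_cont i_cont] W])
  also have "\<dots> = mul GG (mul GG p1 p2) (i \<odot> p2) W"
    by (rule mul_cong[OF W])
       (use cont_mapD(3)[OF i_cont] in \<open>simp_all add: sq.pair_pr1[OF m_cont sq.pr2_cont] sq.pair_pr2[OF m_cont sq.pr2_cont] mul_projections\<close>)
  also have "\<dots> = p1 W" by (rule mul_cancel_right_inv[OF sq.pr2_cont sq.pr1_cont W])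
  finally show ?thesis .
qed

text \<open>The change of coordinates \<open>?s\<close> takes \<open>m c\<close> to the cylinder
  \<open>p2 c\<close>, while \<open>?t\<close> takes \<open>p2 c\<close> to \<open>m c\<close> and
  undoes \<open>?s\<close> on \<open>W\<close>. Both are monotone, so each yields one
  direction.\<close>

lemma subset_m_iff_left:
  assumes W: "W \<in> carrier GG" and c: "c \<in> carrier G"
  shows "W \<subseteq> m c \<longleftrightarrow> pairing GG p1 ldiv W \<subseteq> p2 c"
proof
  let ?s = "pairing GG p1 ldiv" and ?t = "pairing GG p1 m"
  have s: "cont_map GG GG ?s" by (rule sq.pair_cont[OF sq.pr1_cont ldiv_cont])
  have t: "cont_map GG GG ?t" by (rule sq.pair_cont[OF sq.pr1_cont m_cont])
  show "?s W \<subseteq> p2 c" if "W \<subseteq> m c"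
    using that cont_mapD(8)[OF s W m_c[OF c]] ldiv_m[OF c] by (simp add: sq.leP)
  have "?t (?s W) = pairing GG (p1 \<odot> ?t) (ldiv \<odot> ?t) W"
    by (rule sq.pairing_comp[OF t sq.pr1_cont ldiv_cont W])
  also have "\<dots> = pairing GG p1 p2 W"
    by (rule sq.pairing_cong[OF W]) (simp_all add: sq.pair_pr1[OF sq.pr1_cont m_cont] m_ldiv)
  finally have ts: "?t (?s W) = W" by (simp add: sq.pairing_id[OF W])
  show "W \<subseteq> m c" if "?s W \<subseteq> p2 c"
    using that cont_mapD(8)[OF t cont_mapD(3)[OF s W] cont_mapD(3)[OF sq.pr2_cont c]] ts
      sq.pair_pr2[OF sq.pr1_cont m_cont c] by (simp add: sq.leP)
qed

lemma subset_m_iff_right: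
  assumes W: "W \<in> carrier GG" and c: "c \<in> carrier G"
  shows "W \<subseteq> m c \<longleftrightarrow> pairing GG rdiv p2 W \<subseteq> p1 c"
proof
  let ?s = "pairing GG rdiv p2" and ?t = "pairing GG m p2"
  have s: "cont_map GG GG ?s" by (rule sq.pair_cont[OF rdiv_cont sq.pr2_cont])
  have t: "cont_map GG GG ?t" by (rule sq.pair_cont[OF m_cont sq.pr2_cont])
  show "?s W \<subseteq> p1 c" if "W \<subseteq> m c"
    using that cont_mapD(8)[OF s W m_c[OF c]] rdiv_m[OF c] by (simp add: sq.leP)
  have "?t (?s W) = pairing GG (rdiv \<odot> ?t) (p2 \<odot> ?t) W"
    by (rule sq.pairing_comp[OF t rdiv_cont sq.pr2_cont W])
  also have "\<dots> = pairing GG p1 p2 W"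
    by (rule sq.pairing_cong[OF W]) (simp_all add: sq.pair_pr2[OF m_cont sq.pr2_cont] m_rdiv)
  finally have ts: "?t (?s W) = W" by (simp add: sq.pairing_id[OF W])
  show "W \<subseteq> m c" if "?s W \<subseteq> p1 c"
    using that cont_mapD(8)[OF t cont_mapD(3)[OF s W] cont_mapD(3)[OF sq.pr1_cont c]] ts
      sq.pair_pr1[OF m_cont sq.pr2_cont c] by (simp add: sq.leP)
qed

section \<open>Rectangles inside an inverse image under multiplication\<close>

lemma p1_eq: "x \<in> carrier G \<Longrightarrow> p1 x = {(u, v). u \<in> carrier G \<and> v \<in> carrier G \<and> (v = \<bottom>\<^bsub>G\<^esub> \<or> u \<sqsubseteq>\<^bsub>G\<^esub> x)}"
  by (auto simp: pr1_def sq.rect_eq)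

lemma p2_eq: "x \<in> carrier G \<Longrightarrow> p2 x = {(u, v). u \<in> carrier G \<and> v \<in> carrier G \<and> (u = \<bottom>\<^bsub>G\<^esub> \<or> v \<sqsubseteq>\<^bsub>G\<^esub> x)}"
  by (auto simp: pr2_def sq.rect_eq)

lemma rect_subset_iff: "D \<in> carrier GG \<Longrightarrow> rect GG a b \<subseteq> D \<longleftrightarrow> (a, b) \<in> D"
  using sq.rect_le[of D a b] sq.rect_mem[of a b] by auto

lemma m_down:
  assumes "c \<in> carrier G" "(a, b) \<in> m c" "a' \<in> carrier G" "b' \<in> carrier G" "a' \<sqsubseteq>\<^bsub>G\<^esub> a" "b' \<sqsubseteq>\<^bsub>G\<^esub> b"
  shows "(a', b') \<in> m c"
  using c_idealD(2)[OF sq.ciP[OF m_c[OF assms(1)]] assms(2-6)] .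

lemma ldiv_sub: "b \<in> carrier G \<Longrightarrow> (u, y) \<in> ldiv b \<Longrightarrow> u \<in> carrier G \<and> y \<in> carrier G"
  and rdiv_sub: "b \<in> carrier G \<Longrightarrow> (u, y) \<in> rdiv b \<Longrightarrow> u \<in> carrier G \<and> y \<in> carrier G"
  using sq.subP[OF cont_mapD(3)[OF ldiv_cont]] sq.subP[OF cont_mapD(3)[OF rdiv_cont]] by blast+

text \<open>In sheared coordinates the rectangle of \<open>a\<close> and \<open>b\<close> is
  \<open>p1 a \<inter> ldiv b\<close>, and \<open>m c\<close> is the cylinder \<open>p2 c\<close>. A
  pair \<open>(u, y)\<close> lies in that cylinder when \<open>u\<close> is empty or
  \<open>y\<close> is below \<open>c\<close>. In the resulting criterion \<open>a\<close> occurs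
  only through the opens that it meets.\<close>

lemma mem_m_iff_left:
  assumes c: "a \<in> carrier G" "b \<in> carrier G" "c \<in> carrier G"
  shows "(a, b) \<in> m c \<longleftrightarrow> (\<forall>(u, y)\<in>ldiv b. u \<sqinter>\<^bsub>G\<^esub> a \<noteq> \<bottom>\<^bsub>G\<^esub> \<longrightarrow> y \<sqsubseteq>\<^bsub>G\<^esub> c)" (is "_ \<longleftrightarrow> ?R")
proof -
  have l: "ldiv b \<in> carrier GG" using cont_mapD(3)[OF ldiv_cont] c by simp
  have "(a, b) \<in> m c \<longleftrightarrow> p1 a \<inter> ldiv b \<subseteq> p2 c"
    using rect_subset_iff[OF m_c[OF c(3)], of a b] subset_m_iff_left[OF sq.rect_c[OF c(1,2)] c(3)]
      sq.pairing_rect[OF sq.pr1_cont ldiv_cont c(1,2)] sq.meetP[OF cont_mapD(3)[OF sq.pr1_cont c(1)] l] by simp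
  also have "\<dots> \<longleftrightarrow> ?R"
  proof
    assume h: "p1 a \<inter> ldiv b \<subseteq> p2 c"
    have "y \<sqsubseteq>\<^bsub>G\<^esub> c" if uy: "(u, y) \<in> ldiv b" "u \<sqinter>\<^bsub>G\<^esub> a \<noteq> \<bottom>\<^bsub>G\<^esub>" for u y
    proof -
      have k: "u \<in> carrier G" "y \<in> carrier G" using ldiv_sub[OF c(2) uy(1)] by auto
      \<comment> \<open>Cutting \<open>u\<close> down to \<open>a\<close> puts the pair into
        \<open>p1 a\<close> and keeps \<open>y\<close>; since the cut is nonzero, the degenerate
        alternative in \<open>p2 c\<close> is excluded.\<close>
      have "(u \<sqinter>\<^bsub>G\<^esub> a, y) \<in> ldiv b"
        by (rule c_idealD(2)[OF sq.ciP[OF l] uy(1)]) (use k c in \<open>auto intro: meet_left\<close>)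
      then have "(u \<sqinter>\<^bsub>G\<^esub> a, y) \<in> p2 c" using h k c by (auto simp: p1_eq intro: meet_right)
      then show ?thesis using uy c by (simp add: p2_eq)
    qed
    then show ?R by auto
  next
    assume R: ?R
    show "p1 a \<inter> ldiv b \<subseteq> p2 c"
    proof (rule subrelI)
      fix u y assume uy: "(u, y) \<in> p1 a \<inter> ldiv b"
      have k: "u \<in> carrier G" "y \<in> carrier G" using ldiv_sub[OF c(2)] uy by auto
      have "y \<sqsubseteq>\<^bsub>G\<^esub> c" if "u \<noteq> \<bottom>\<^bsub>G\<^esub>" 
        using R uy that k c meet_absorb[of u a] bottom_lower[of c] by (auto simp: p1_eq)
      then show "(u, y) \<in> p2 c" using k c by (auto simp: p2_eq)
    qed
  qed
  finally show ?thesis .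
qed

text \<open>The mirror image through \<open>rdiv\<close>: here it is \<open>b\<close> that occurs
  only through the opens that it meets.\<close>

lemma mem_m_iff_right:
  assumes c: "a \<in> carrier G" "b \<in> carrier G" "c \<in> carrier G"
  shows "(a, b) \<in> m c \<longleftrightarrow> (\<forall>(y, v)\<in>rdiv a. v \<sqinter>\<^bsub>G\<^esub> b \<noteq> \<bottom>\<^bsub>G\<^esub> \<longrightarrow> y \<sqsubseteq>\<^bsub>G\<^esub> c)" (is "_ \<longleftrightarrow> ?R")
proof -
  have l: "rdiv a \<in> carrier GG" using cont_mapD(3)[OF rdiv_cont] c by simp
  have "(a, b) \<in> m c \<longleftrightarrow> rdiv a \<inter> p2 b \<subseteq> p1 c"
    using rect_subset_iff[OF m_c[OF c(3)], of a b] subset_m_iff_right[OF sq.rect_c[OF c(1,2)] c(3)]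
      sq.pairing_rect[OF rdiv_cont sq.pr2_cont c(1,2)] sq.meetP[OF l cont_mapD(3)[OF sq.pr2_cont c(2)]] by simp
  also have "\<dots> \<longleftrightarrow> ?R"
  proof
    assume h: "rdiv a \<inter> p2 b \<subseteq> p1 c"
    have "y \<sqsubseteq>\<^bsub>G\<^esub> c" if uy: "(y, v) \<in> rdiv a" "v \<sqinter>\<^bsub>G\<^esub> b \<noteq> \<bottom>\<^bsub>G\<^esub>" for v y
    proof -
      have k: "v \<in> carrier G" "y \<in> carrier G" using rdiv_sub[OF c(1) uy(1)] by auto
      have "(y, v \<sqinter>\<^bsub>G\<^esub> b) \<in> rdiv a"
        by (rule c_idealD(2)[OF sq.ciP[OF l] uy(1)]) (use k c in \<open>auto intro: meet_left\<close>)
      then have "(y, v \<sqinter>\<^bsub>G\<^esub> b) \<in> p1 c" using h k c by (auto simp: p2_eq intro: meet_right)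
      then show ?thesis using uy c by (simp add: p1_eq)
    qed
    then show ?R by auto
  next
    assume R: ?R
    show "rdiv a \<inter> p2 b \<subseteq> p1 c"
    proof (rule subrelI)
      fix y v assume uy: "(y, v) \<in> rdiv a \<inter> p2 b"
      have k: "v \<in> carrier G" "y \<in> carrier G" using rdiv_sub[OF c(1)] uy by auto
      have "y \<sqsubseteq>\<^bsub>G\<^esub> c" if "v \<noteq> \<bottom>\<^bsub>G\<^esub>" 
        using R uy that k c meet_absorb[of v b] bottom_lower[of c] by (auto simp: p2_eq)
      then show "(y, v) \<in> p1 c" using k c by (auto simp: p1_eq)
    qed
  qed
  finally show ?thesis .
qed

section \<open>Products of opens as images under multiplication\<close>

abbreviation "gm \<equiv> group_mult_opens G m"

text \<open>The criterion for \<open>(a, b) \<in> m c\<close> bounds certain opens \<open>y\<close>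
  by \<open>c\<close> one at a time, hence bounds their join. So this join has the defining property
  of the image of the rectangle, and the definite description in \<open>open_image\<close> is
  resolved on all rectangles.\<close>

lemma
  assumes ab: "a \<in> carrier G" "b \<in> carrier G"
  shows gm_eq: "gm a b = \<Squnion>\<^bsub>G\<^esub>{y. \<exists>u. (u, y) \<in> ldiv b \<and> u \<sqinter>\<^bsub>G\<^esub> a \<noteq> \<bottom>\<^bsub>G\<^esub>}" (is "_ = \<Squnion>\<^bsub>G\<^esub>?K")
    and gm_c: "gm a b \<in> carrier G"
    and gm_le_iff: "\<And>c. c \<in> carrier G \<Longrightarrow> gm a b \<sqsubseteq>\<^bsub>G\<^esub> c \<longleftrightarrow> (a, b) \<in> m c"
proof -
  have K: "?K \<subseteq> carrier G" using ldiv_sub[OF ab(2)] by auto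
  have s: "\<Squnion>\<^bsub>G\<^esub>?K \<in> carrier G" by (rule sup_closed[OF K])
  have le: "\<Squnion>\<^bsub>G\<^esub>?K \<sqsubseteq>\<^bsub>G\<^esub> c \<longleftrightarrow> (a, b) \<in> m c" if c: "c \<in> carrier G" for c
  proof -
    have "\<Squnion>\<^bsub>G\<^esub>?K \<sqsubseteq>\<^bsub>G\<^esub> c \<longleftrightarrow> (\<forall>y\<in>?K. y \<sqsubseteq>\<^bsub>G\<^esub> c)"
    proof (intro iffI ballI)
      fix y assume h: "\<Squnion>\<^bsub>G\<^esub>?K \<sqsubseteq>\<^bsub>G\<^esub> c" and y: "y \<in> ?K"
      show "y \<sqsubseteq>\<^bsub>G\<^esub> c" by (rule le_trans[OF sup_upper[OF K y] h]) (use y K s c in auto)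
    qed (use K c in \<open>auto intro!: sup_least\<close>)
    also have "\<dots> \<longleftrightarrow> (a, b) \<in> m c" unfolding mem_m_iff_left[OF ab c] by auto
    finally show ?thesis .
  qed
  show eq: "gm a b = \<Squnion>\<^bsub>G\<^esub>?K"
    unfolding group_mult_opens_def open_image_def
  proof (rule the_equality)
    show "\<Squnion>\<^bsub>G\<^esub>?K \<in> carrier G \<and> (\<forall>W\<in>carrier G. \<Squnion>\<^bsub>G\<^esub>?K \<sqsubseteq>\<^bsub>G\<^esub> W \<longleftrightarrow> rect GG a b \<sqsubseteq>\<^bsub>GG\<^esub> m W)"
      using s le by (simp add: sq.leP rect_subset_iff[OF m_c])
    fix V assume V: "V \<in> carrier G \<and> (\<forall>W\<in>carrier G. V \<sqsubseteq>\<^bsub>G\<^esub> W \<longleftrightarrow> rect GG a b \<sqsubseteq>\<^bsub>GG\<^esub> m W)"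
    then have "V \<sqsubseteq>\<^bsub>G\<^esub> W \<longleftrightarrow> \<Squnion>\<^bsub>G\<^esub>?K \<sqsubseteq>\<^bsub>G\<^esub> W" if "W \<in> carrier G" for W
      using that le by (simp add: sq.leP rect_subset_iff[OF m_c])
    then show "V = \<Squnion>\<^bsub>G\<^esub>?K" using V s by (intro le_antisym) auto
  qed
  show "gm a b \<in> carrier G" using eq s by simp
  show "gm a b \<sqsubseteq>\<^bsub>G\<^esub> c \<longleftrightarrow> (a, b) \<in> m c" if "c \<in> carrier G" for c using le[OF that] eq by simp
qed

text \<open>Frobenius reciprocity for \<open>m\<close> on rectangles. The image of the open
  \<open>rect GG a b \<inter> m c\<close>, which need not be a rectangle, is replaced by a test open
  \<open>q\<close> whose inverse image contains it. After shearing, the hypothesis is evaluated at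
  the pairs \<open>(u \<sqinter> a, y \<sqinter> c)\<close>, where \<open>y\<close> runs through the
  opens whose join is \<open>gm a b\<close>.\<close>

lemma frobenius:
  assumes ab: "a \<in> carrier G" "b \<in> carrier G" and c: "c \<in> carrier G" and q: "q \<in> carrier G"
    and W: "rect GG a b \<inter> m c \<subseteq> m q"
  shows "gm a b \<sqinter>\<^bsub>G\<^esub> c \<sqsubseteq>\<^bsub>G\<^esub> q"
proof -
  let ?s = "pairing GG p1 ldiv"
  let ?K = "{y. \<exists>u. (u, y) \<in> ldiv b \<and> u \<sqinter>\<^bsub>G\<^esub> a \<noteq> \<bottom>\<^bsub>G\<^esub>}"
  have s: "cont_map GG GG ?s" by (rule sq.pair_cont[OF sq.pr1_cont ldiv_cont])
  have l: "ldiv b \<in> carrier GG" using cont_mapD(3)[OF ldiv_cont] ab by simp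
  have r: "rect GG a b \<in> carrier GG" by (rule sq.rect_c[OF ab])
  have w: "rect GG a b \<inter> m c = rect GG a b \<sqinter>\<^bsub>GG\<^esub> m c" using sq.meetP[OF r m_c[OF c]] by simp
  then have "rect GG a b \<inter> m c \<in> carrier GG" using r m_c[OF c] by simp
  then have "?s (rect GG a b \<inter> m c) \<subseteq> p2 q" using subset_m_iff_left[OF _ q] W by simp
  also have "?s (rect GG a b \<inter> m c) = p1 a \<inter> ldiv b \<inter> p2 c"
    unfolding w cont_mapD(5)[OF s r m_c[OF c]] sq.pairing_rect[OF sq.pr1_cont ldiv_cont ab] ldiv_m[OF c]
    using sq.meetP l cont_mapD(3)[OF sq.pr1_cont ab(1)] cont_mapD(3)[OF sq.pr2_cont c] sq.P.meet_closed by metis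
  finally have sub: "p1 a \<inter> ldiv b \<inter> p2 c \<subseteq> p2 q" .
  have K: "?K \<subseteq> carrier G" using ldiv_sub[OF ab(2)] by auto
  have "y \<sqinter>\<^bsub>G\<^esub> c \<sqsubseteq>\<^bsub>G\<^esub> q" if "y \<in> ?K" for y
  proof -
    obtain u where uy: "(u, y) \<in> ldiv b" "u \<sqinter>\<^bsub>G\<^esub> a \<noteq> \<bottom>\<^bsub>G\<^esub>" using \<open>y \<in> ?K\<close> by auto
    have k: "u \<in> carrier G" "y \<in> carrier G" using ldiv_sub[OF ab(2) uy(1)] by auto
    have "(u \<sqinter>\<^bsub>G\<^esub> a, y \<sqinter>\<^bsub>G\<^esub> c) \<in> ldiv b"
      by (rule c_idealD(2)[OF sq.ciP[OF l] uy(1)]) (use k ab c in \<open>auto intro: meet_left\<close>)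
    then have "(u \<sqinter>\<^bsub>G\<^esub> a, y \<sqinter>\<^bsub>G\<^esub> c) \<in> p2 q"
      using sub k ab c by (auto simp: p1_eq p2_eq meet_right)
    then show ?thesis using uy q by (simp add: p2_eq)
  qed
  then show ?thesis
    unfolding gm_eq[OF ab] sup_meet_distrib[OF c K] using K c q by (intro sup_least) auto
qed

text \<open>In a topological group this is the fact that \<open>cl(A) \<cdot> B = A \<cdot> B\<close> for open \<open>B\<close>.\<close>

lemma m_dense_left:
  assumes c: "a \<in> carrier G" "a' \<in> carrier G" "b \<in> carrier G" "c \<in> carrier G"
    and d: "\<And>u. u \<in> carrier G \<Longrightarrow> u \<sqinter>\<^bsub>G\<^esub> a' = \<bottom>\<^bsub>G\<^esub> \<Longrightarrow> u \<sqinter>\<^bsub>G\<^esub> a = \<bottom>\<^bsub>G\<^esub>"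
    and m: "(a', b) \<in> m c"
  shows "(a, b) \<in> m c"
  unfolding mem_m_iff_left[OF c(1,3,4)]
  using m[unfolded mem_m_iff_left[OF c(2-4)]] d ldiv_sub[OF c(3)] by fastforce

lemma m_dense_right:
  assumes c: "a \<in> carrier G" "b \<in> carrier G" "b' \<in> carrier G" "c \<in> carrier G"
    and d: "\<And>u. u \<in> carrier G \<Longrightarrow> u \<sqinter>\<^bsub>G\<^esub> b' = \<bottom>\<^bsub>G\<^esub> \<Longrightarrow> u \<sqinter>\<^bsub>G\<^esub> b = \<bottom>\<^bsub>G\<^esub>"
    and m: "(a, b') \<in> m c"
  shows "(a, b) \<in> m c"
  unfolding mem_m_iff_right[OF c(1,2,4)]
  using m[unfolded mem_m_iff_right[OF c(1,3,4)]] d rdiv_sub[OF c(1)] by fastforce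

end

subsection \<open>Dense sublocales of the factors\<close>

lemma open_incl_cont:
  assumes X: "frame X" and U: "U \<in> carrier X"
  shows "cont_map (open_sub X U) X (open_incl X U)"
proof -
  interpret frame X by fact
  note O = open_sub_frame[OF X U] open_sub_meet[OF X U] open_sub_Sup[OF X U] open_sub_top[OF X U]
  have c: "open_incl X U W \<in> carrier (open_sub X U)" if "W \<in> carrier X" for W
    using that U by (simp add: open_incl_def carrier_open_sub meet_right)
  have m: "open_incl X U (a \<sqinter>\<^bsub>X\<^esub> b) = open_incl X U a \<sqinter>\<^bsub>open_sub X U\<^esub> open_incl X U b"
    if "a \<in> carrier X" "b \<in> carrier X" for a b
    using that U O(2)[of "a \<sqinter>\<^bsub>X\<^esub> U" "b \<sqinter>\<^bsub>X\<^esub> U"] meet_swap[of a U "b \<sqinter>\<^bsub>X\<^esub> U"]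
      meet_assoc[of a b U] meet_assoc[of a "b \<sqinter>\<^bsub>X\<^esub> U" U] meet_assoc[of b U U]
    by (simp add: open_incl_def meet_right meet_idem)
  have "open_incl X U (\<Squnion>\<^bsub>X\<^esub>K) = \<Squnion>\<^bsub>open_sub X U\<^esub>(open_incl X U ` K)" if "K \<subseteq> carrier X" for K
  proof -
    have "open_incl X U ` K \<subseteq> carrier (open_sub X U)" using c that by auto
    from O(3)[OF this] show ?thesis using sup_meet_distrib[OF U that] by (simp add: open_incl_def[abs_def])
  qed
  then show ?thesis
    unfolding cont_map_def frame_hom_def using O(1) X c m U O(4) by (auto simp: open_incl_def meet_top)
qed

text \<open>Opens of the open sublocale are opens of \<open>Y\<close>, so the corestricted map has
  the same function \<open>r\<close> as inverse image. The condition \<open>r U = \<top>\<close>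
  says that the map lands in \<open>U\<close>; it provides preservation of the top element.\<close>

lemma
  assumes r: "cont_map X Y r" and U: "U \<in> carrier Y" and rU: "r U = \<top>\<^bsub>X\<^esub>"
  shows cont_map_corestrict: "cont_map X (open_sub Y U) r"
    and open_incl_corestrict: "W \<in> carrier Y \<Longrightarrow> r (open_incl Y U W) = r W"
proof -
  note Y = cont_mapD(2)[OF r]
  interpret X: frame X by (rule cont_mapD(1)[OF r])
  note O = open_sub_frame[OF Y U] open_sub_meet[OF Y U] open_sub_Sup[OF Y U] open_sub_top[OF Y U]
  have "K \<subseteq> carrier Y" if "K \<subseteq> carrier (open_sub Y U)" for K
    using that by (auto simp: carrier_open_sub)
  then show "cont_map X (open_sub Y U) r"
    unfolding cont_map_def frame_hom_def
    using O X.frame_axioms cont_mapD[OF r] rU by (auto simp: carrier_open_sub)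
  show "r (open_incl Y U W) = r W" if "W \<in> carrier Y"
    using that U cont_mapD(3,5)[OF r] rU by (simp add: open_incl_def X.meet_top)
qed

text \<open>The conclusion says that \<open>a\<close> lies in the closure of \<open>a'\<close>. If
  \<open>u\<close> met \<open>a\<close>, density would make the trace of
  \<open>u \<sqinter> a\<close> nonzero, but this trace is below that of
  \<open>u \<sqinter> a'\<close>, which is empty.\<close>

lemma dense_sublocale_disjoint:
  assumes X: "frame X" and U: "U \<in> carrier X" and s: "dense_sublocale S (open_sub X U) s"
    and a: "a \<in> carrier (open_sub X U)" "a' \<in> carrier (open_sub X U)" "s a \<sqsubseteq>\<^bsub>S\<^esub> s a'"
    and u: "u \<in> carrier X" "u \<sqinter>\<^bsub>X\<^esub> a' = \<bottom>\<^bsub>X\<^esub>"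
  shows "u \<sqinter>\<^bsub>X\<^esub> a = \<bottom>\<^bsub>X\<^esub>"
proof (rule ccontr)
  interpret X: frame X by fact
  let ?O = "open_sub X U"
  have sc: "cont_map S ?O s" using s by (simp add: dense_sublocale_def sublocale_incl_def)
  interpret S: frame S by (rule cont_mapD(1)[OF sc])
  interpret O: frame ?O by (rule cont_mapD(2)[OF sc])
  have c: "a \<in> carrier X" "a' \<in> carrier X" "a \<sqsubseteq>\<^bsub>X\<^esub> U" "a' \<sqsubseteq>\<^bsub>X\<^esub> U"
    using a by (auto simp: carrier_open_sub)
  \<comment> \<open>The frame homomorphism \<open>s\<close> lives on opens below \<open>U\<close>,
    while \<open>u\<close> is any open of \<open>X\<close>. Replacing \<open>u\<close> by
    \<open>u \<sqinter> U\<close> does not change its meets with \<open>a\<close> and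
    \<open>a'\<close>.\<close>
  have v: "u \<sqinter>\<^bsub>X\<^esub> U \<in> carrier ?O" using u U by (simp add: carrier_open_sub X.meet_right)
  have m: "(u \<sqinter>\<^bsub>X\<^esub> U) \<sqinter>\<^bsub>?O\<^esub> b = u \<sqinter>\<^bsub>X\<^esub> b" if b: "b \<in> carrier X" "b \<sqsubseteq>\<^bsub>X\<^esub> U" for b
  proof -
    have "(u \<sqinter>\<^bsub>X\<^esub> U) \<sqinter>\<^bsub>?O\<^esub> b = (u \<sqinter>\<^bsub>X\<^esub> U) \<sqinter>\<^bsub>X\<^esub> b"
      using b u U by (intro open_sub_meet[OF X U]) (auto simp: X.meet_right)
    also have "\<dots> = u \<sqinter>\<^bsub>X\<^esub> b"
      using b u U X.meet_absorb[of b U] by (simp add: X.meet_assoc meet_comm[of _ U])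
    finally show ?thesis .
  qed
  assume ne: "u \<sqinter>\<^bsub>X\<^esub> a \<noteq> \<bottom>\<^bsub>X\<^esub>"
  have "s (u \<sqinter>\<^bsub>X\<^esub> a) = s (u \<sqinter>\<^bsub>X\<^esub> U) \<sqinter>\<^bsub>S\<^esub> s a"
    using cont_mapD(5)[OF sc v a(1)] m[OF c(1,3)] by simp
  also have "\<dots> \<sqsubseteq>\<^bsub>S\<^esub> s (u \<sqinter>\<^bsub>X\<^esub> U) \<sqinter>\<^bsub>S\<^esub> s a'"
    using cont_mapD(3)[OF sc] a v by (intro S.meet_mono) auto
  also have "\<dots> = s (u \<sqinter>\<^bsub>X\<^esub> a')"
    using cont_mapD(5)[OF sc v a(2)] m[OF c(2,4)] by simp
  also have "\<dots> = \<bottom>\<^bsub>S\<^esub>" using u cont_mapD(7)[OF sc] open_sub_bot[OF X U] by simp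
  finally have le: "s (u \<sqinter>\<^bsub>X\<^esub> a) \<sqsubseteq>\<^bsub>S\<^esub> \<bottom>\<^bsub>S\<^esub>" .
  have w: "u \<sqinter>\<^bsub>X\<^esub> a \<in> carrier ?O" using O.meet_closed[OF v a(1)] m[OF c(1,3)] by simp
  have "s (u \<sqinter>\<^bsub>X\<^esub> a) = \<bottom>\<^bsub>S\<^esub>" using S.le_bot[OF cont_mapD(3)[OF sc w] le] .
  then show False using s w ne open_sub_bot[OF X U] by (auto simp: dense_sublocale_def)
qed

section \<open>Monotonicity and joins of products of opens\<close>

context loc_group
begin

lemma gm_unit_mem: "a \<in> carrier G \<Longrightarrow> b \<in> carrier G \<Longrightarrow> (a, b) \<in> m (gm a b)"
  using gm_le_iff[of a b "gm a b"] gm_c[of a b] by simp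

lemma gm_mono:
  assumes "a \<in> carrier G" "b \<in> carrier G" "a' \<in> carrier G" "b' \<in> carrier G" "a \<sqsubseteq>\<^bsub>G\<^esub> a'" "b \<sqsubseteq>\<^bsub>G\<^esub> b'"
  shows "gm a b \<sqsubseteq>\<^bsub>G\<^esub> gm a' b'"
  using gm_le_iff[of a b "gm a' b'"] m_down[OF gm_c gm_unit_mem] gm_c assms by simp

text \<open>By adjunction the claim is a membership in the open \<open>m ?Q\<close>, which contains
  every \<open>(a, b)\<close> with \<open>a \<in> A\<close> and is closed under joins in the first
  coordinate.\<close>

lemma gm_Sup_left:
  assumes A: "A \<subseteq> carrier G" and b: "b \<in> carrier G"
  shows "gm (\<Squnion>\<^bsub>G\<^esub>A) b \<sqsubseteq>\<^bsub>G\<^esub> \<Squnion>\<^bsub>G\<^esub>((\<lambda>a. gm a b) ` A)" (is "_ \<sqsubseteq>\<^bsub>G\<^esub> ?Q")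
proof -
  have im: "(\<lambda>a. gm a b) ` A \<subseteq> carrier G" using A b gm_c by auto
  have Q: "?Q \<in> carrier G" by (rule sup_closed[OF im])
  have "(a, b) \<in> m ?Q" if "a \<in> A" for a
    using gm_le_iff[of a b ?Q] sup_upper[OF im, of "gm a b"] that A b Q by auto
  then have "(\<Squnion>\<^bsub>G\<^esub>A, b) \<in> m ?Q" by (rule c_idealD(3)[OF sq.ciP[OF m_c[OF Q]] A b])
  then show ?thesis using gm_le_iff[OF sup_closed[OF A] b Q] by simp
qed

lemma gm_Sup_right:
  assumes a: "a \<in> carrier G" and B: "B \<subseteq> carrier G"
  shows "gm a (\<Squnion>\<^bsub>G\<^esub>B) \<sqsubseteq>\<^bsub>G\<^esub> \<Squnion>\<^bsub>G\<^esub>((\<lambda>b. gm a b) ` B)" (is "_ \<sqsubseteq>\<^bsub>G\<^esub> ?Q")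
proof -
  have im: "(\<lambda>b. gm a b) ` B \<subseteq> carrier G" using a B gm_c by auto
  have Q: "?Q \<in> carrier G" by (rule sup_closed[OF im])
  have "(a, b) \<in> m ?Q" if "b \<in> B" for b
    using gm_le_iff[of a b ?Q] sup_upper[OF im, of "gm a b"] that a B Q by auto
  then have "(a, \<Squnion>\<^bsub>G\<^esub>B) \<in> m ?Q" by (rule c_idealD(4)[OF sq.ciP[OF m_c[OF Q]] B a])
  then show ?thesis using gm_le_iff[OF a sup_closed[OF B] Q] by simp
qed

end

section \<open>Restriction of multiplication to the product of dense sublocales\<close>

locale dense_pair = loc_group G m e i
  for G :: "'g gorder" and m :: "'g \<Rightarrow> ('g \<times> 'g) set" and e :: "'g \<Rightarrow> bool" and i :: "'g \<Rightarrow> 'g" +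
  fixes S :: "'s gorder" and T :: "'t gorder" and s :: "'g \<Rightarrow> 's" and t :: "'g \<Rightarrow> 't" and U V :: 'g
  assumes U: "U \<in> carrier G" and V: "V \<in> carrier G"
    and dense_S: "dense_sublocale S (open_sub G U) s" and dense_T: "dense_sublocale T (open_sub G V) t"
begin

abbreviation "GU \<equiv> open_sub G U"
abbreviation "GV \<equiv> open_sub G V"
abbreviation "UV \<equiv> gm U V"
abbreviation "ST \<equiv> S \<times>\<^sub>L T"

lemma s_cont: "cont_map S GU s" and s_onto: "s ` carrier GU = carrier S"
  and t_cont: "cont_map T GV t" and t_onto: "t ` carrier GV = carrier T"
  using dense_S dense_T by (simp_all add: dense_sublocale_def sublocale_incl_def)

end

sublocale dense_pair \<subseteq> st: product_square S T
  using cont_mapD(1)[OF s_cont] cont_mapD(1)[OF t_cont] by (simp add: product_square_def)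

context dense_pair
begin

lemma GU_D: "a \<in> carrier GU \<Longrightarrow> a \<in> carrier G" "a \<in> carrier GU \<Longrightarrow> a \<sqsubseteq>\<^bsub>G\<^esub> U"
  and GV_D: "b \<in> carrier GV \<Longrightarrow> b \<in> carrier G" "b \<in> carrier GV \<Longrightarrow> b \<sqsubseteq>\<^bsub>G\<^esub> V"
  by (simp_all add: carrier_open_sub)

lemma UV_c: "UV \<in> carrier G" by (rule gm_c[OF U V])

lemma gm_UV: "a \<in> carrier GU \<Longrightarrow> b \<in> carrier GV \<Longrightarrow> gm a b \<in> carrier (open_sub G UV)"
  using gm_c gm_mono[of a b U V] U V by (auto simp: carrier_open_sub)

text \<open>The factors are exchanged one at a time, from \<open>(a', b')\<close> to
  \<open>(a, b')\<close> by the left criterion and then to \<open>(a, b)\<close> by the right one.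
  In particular \<open>gm a b\<close> is determined by the traces \<open>s a\<close> and
  \<open>t b\<close>; this is the only use of density.\<close>

lemma gm_dense_mono:
  assumes c: "a \<in> carrier GU" "b \<in> carrier GV" "a' \<in> carrier GU" "b' \<in> carrier GV"
    and le: "s a \<sqsubseteq>\<^bsub>S\<^esub> s a'" "t b \<sqsubseteq>\<^bsub>T\<^esub> t b'"
  shows "gm a b \<sqsubseteq>\<^bsub>G\<^esub> gm a' b'"
proof -
  note k = GU_D(1)[OF c(1)] GV_D(1)[OF c(2)] GU_D(1)[OF c(3)] GV_D(1)[OF c(4)]
  have q: "gm a' b' \<in> carrier G" by (rule gm_c[OF k(3,4)])
  have dS: "u \<sqinter>\<^bsub>G\<^esub> a = \<bottom>\<^bsub>G\<^esub>" if "u \<in> carrier G" "u \<sqinter>\<^bsub>G\<^esub> a' = \<bottom>\<^bsub>G\<^esub>" for u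
    by (rule dense_sublocale_disjoint[OF frame_axioms U dense_S c(1,3) le(1) that])
  have dT: "u \<sqinter>\<^bsub>G\<^esub> b = \<bottom>\<^bsub>G\<^esub>" if "u \<in> carrier G" "u \<sqinter>\<^bsub>G\<^esub> b' = \<bottom>\<^bsub>G\<^esub>" for u
    by (rule dense_sublocale_disjoint[OF frame_axioms V dense_T c(2,4) le(2) that])
  have "(a, b') \<in> m (gm a' b')"
    by (rule m_dense_left[OF k(1,3,4) q dS gm_unit_mem[OF k(3,4)]])
  then have "(a, b) \<in> m (gm a' b')"
    using m_dense_right[OF k(1,2,4) q dT] by blast
  then show ?thesis using gm_le_iff[OF k(1,2) q] by simp
qed

abbreviation "sG \<equiv> open_incl G U \<odot> s"
abbreviation "tG \<equiv> open_incl G V \<odot> t"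
abbreviation "r \<equiv> m \<odot> prod_map S T sG tG"

lemma sG_cont: "cont_map S G sG" and tG_cont: "cont_map T G tG"
  using cont_map_comp[OF s_cont open_incl_cont[OF frame_axioms U]]
    cont_map_comp[OF t_cont open_incl_cont[OF frame_axioms V]] by auto

lemma sG_eq: "a \<in> carrier GU \<Longrightarrow> sG a = s a" and tG_eq: "b \<in> carrier GV \<Longrightarrow> tG b = t b"
  using U V by (simp_all add: open_incl_def meet_absorb carrier_open_sub)

lemma s1_cont: "cont_map ST G (sG \<odot> pr1 ST T)" and t2_cont: "cont_map ST G (tG \<odot> pr2 ST S)"
  by (rule cont_map_comp[OF st.pr1_cont sG_cont], rule cont_map_comp[OF st.pr2_cont tG_cont])

lemma r_cont: "cont_map ST G r"
  unfolding prod_map_def by (rule cont_map_comp[OF sq.pair_cont[OF s1_cont t2_cont] m_cont])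

lemma pr1_mem: "x \<in> carrier S \<Longrightarrow> (\<sigma>, \<tau>) \<in> pr1 ST T x \<longleftrightarrow>
     \<sigma> \<in> carrier S \<and> \<tau> \<in> carrier T \<and> (\<tau> = \<bottom>\<^bsub>T\<^esub> \<or> \<sigma> \<sqsubseteq>\<^bsub>S\<^esub> x)"
  and pr2_mem: "y \<in> carrier T \<Longrightarrow> (\<sigma>, \<tau>) \<in> pr2 ST S y \<longleftrightarrow>
     \<sigma> \<in> carrier S \<and> \<tau> \<in> carrier T \<and> (\<sigma> = \<bottom>\<^bsub>S\<^esub> \<or> \<tau> \<sqsubseteq>\<^bsub>T\<^esub> y)"
  by (auto simp: pr1_def pr2_def st.rect_eq)

text \<open>The inverse image \<open>r c\<close> is the join of the traces of all rectangles in
  \<open>m c\<close>, and for opens of \<open>U\<close> and \<open>V\<close> that trace is the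
  rectangle of \<open>s a\<close> and \<open>t b\<close>.\<close>

lemma r_mem:
  assumes c: "c \<in> carrier G" and ab: "(a, b) \<in> m c" "a \<in> carrier GU" "b \<in> carrier GV"
  shows "(s a, t b) \<in> r c"
proof -
  let ?s = "pr1 ST T (sG a)" and ?t = "pr2 ST S (tG b)"
  have k: "s a \<in> carrier S" "t b \<in> carrier T" using cont_mapD(3)[OF s_cont ab(2)] cont_mapD(3)[OF t_cont ab(3)] by auto
  have "?s \<in> carrier ST" "?t \<in> carrier ST"
    using cont_mapD(3)[OF st.pr1_cont] cont_mapD(3)[OF st.pr2_cont] sG_eq[OF ab(2)] tG_eq[OF ab(3)] k by auto
  then have "?s \<inter> ?t \<subseteq> r c"
    using sq.pairing_upper[OF s1_cont t2_cont m_c[OF c] ab(1)]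
    by (simp add: prod_map_def st.leP st.meetP)
  moreover have "(s a, t b) \<in> ?s \<inter> ?t"
    using k sG_eq[OF ab(2)] tG_eq[OF ab(3)] by (simp add: pr1_mem pr2_mem)
  ultimately show ?thesis by blast
qed

lemma U_GU: "U \<in> carrier GU" and V_GV: "V \<in> carrier GV"
  using U V by (simp_all add: carrier_open_sub)

lemma s_U: "s U = \<top>\<^bsub>S\<^esub>" and t_V: "t V = \<top>\<^bsub>T\<^esub>"
  using cont_mapD(4)[OF s_cont] cont_mapD(4)[OF t_cont] open_sub_top[OF frame_axioms U]
    open_sub_top[OF frame_axioms V] by simp_all

text \<open>The unit of the adjunction puts \<open>(U, V)\<close> into \<open>m UV\<close>. Its
  trace is the pair of top elements, and an open of \<open>ST\<close> containing that pair is
  everything. Hence the target of \<open>r\<close> can be cut down to \<open>UV\<close>.\<close>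

lemma r_UV: "r UV = \<top>\<^bsub>ST\<^esub>"
  using st.top_mem[OF cont_mapD(3)[OF r_cont UV_c]]
    r_mem[OF UV_c gm_unit_mem[OF U V] U_GU V_GV] st.topP by (simp add: s_U t_V)

lemma r_corestrict: "cont_map ST (open_sub G UV) r"
  by (rule cont_map_corestrict[OF r_cont UV_c r_UV])

lemma r_open_incl: "map_eq G (open_incl G UV \<odot> r) r"
  unfolding map_eq_def
proof
  fix W assume "W \<in> carrier G"
  then have "r (open_incl G UV W) = r W" by (rule open_incl_corestrict[OF r_cont UV_c r_UV])
  then show "(open_incl G UV \<odot> r) W = r W" by simp
qed

end

section \<open>Base change along a map into the product open\<close>

locale dense_pair_over = dense_pair +
  fixes Z :: "'z gorder" and g
  assumes g_cont: "cont_map Z (open_sub G UV) g"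
begin

interpretation Z: frame Z by (rule cont_mapD(1)[OF g_cont])

abbreviation "GUV \<equiv> open_sub G UV"

lemma GUV_Sup: "K \<subseteq> carrier GUV \<Longrightarrow> \<Squnion>\<^bsub>GUV\<^esub>K = \<Squnion>\<^bsub>G\<^esub>K"
  by (rule open_sub_Sup[OF frame_axioms UV_c])

lemma GUV_closed: "K \<subseteq> carrier GUV \<Longrightarrow> \<Squnion>\<^bsub>G\<^esub>K \<in> carrier GUV"
  using UV_c by (auto simp: carrier_open_sub intro!: sup_least sup_closed)

lemma g_c: "c \<in> carrier GUV \<Longrightarrow> g c \<in> carrier Z"
  by (rule cont_mapD(3)[OF g_cont])

lemma g_mono: "c \<in> carrier GUV \<Longrightarrow> d \<in> carrier GUV \<Longrightarrow> c \<sqsubseteq>\<^bsub>G\<^esub> d \<Longrightarrow> g c \<sqsubseteq>\<^bsub>Z\<^esub> g d"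
  using cont_mapD(8)[OF g_cont] by (simp add: le_open_sub)

lemma meet_g_mono:
  assumes "x \<in> carrier Z" "w \<in> carrier Z" "c \<in> carrier GUV" "d \<in> carrier GUV" "c \<sqsubseteq>\<^bsub>G\<^esub> d"
    and "x \<sqinter>\<^bsub>Z\<^esub> g d \<sqsubseteq>\<^bsub>Z\<^esub> w"
  shows "x \<sqinter>\<^bsub>Z\<^esub> g c \<sqsubseteq>\<^bsub>Z\<^esub> w"
  by (rule Z.le_trans[OF Z.meet_mono[OF Z.le_refl g_mono[OF assms(3-5)]] assms(6)])
     (use assms g_c in auto)

lemma meet_g_Sup:
  assumes x: "x \<in> carrier Z" and w: "w \<in> carrier Z" and K: "K \<subseteq> carrier GUV"
    and le: "\<And>c. c \<in> K \<Longrightarrow> x \<sqinter>\<^bsub>Z\<^esub> g c \<sqsubseteq>\<^bsub>Z\<^esub> w"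
  shows "x \<sqinter>\<^bsub>Z\<^esub> g (\<Squnion>\<^bsub>G\<^esub>K) \<sqsubseteq>\<^bsub>Z\<^esub> w"
proof -
  have gK: "g ` K \<subseteq> carrier Z" using K g_c by auto
  have "x \<sqinter>\<^bsub>Z\<^esub> g (\<Squnion>\<^bsub>G\<^esub>K) = \<Squnion>\<^bsub>Z\<^esub>((\<lambda>b. x \<sqinter>\<^bsub>Z\<^esub> b) ` g ` K)"
    using cont_mapD(6)[OF g_cont K] GUV_Sup[OF K] Z.meet_sup_distrib[OF x gK] by simp
  then show ?thesis using x w gK le by (auto intro!: Z.sup_least)
qed

text \<open>Here \<open>x \<sqinter> g (a \<cdot> b)\<close> is the image under the open projection \<open>Z \<times>\<^sub>G (U \<times> V) \<rightarrow> Z\<close> of the open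
  set given by \<open>x\<close>, \<open>a\<close> and \<open>b\<close>.  By \<open>gm_dense_mono\<close> it depends on \<open>s a\<close> and \<open>t b\<close> only.\<close>

definition fibre where
  "fibre x w = {(s a, t b) | a b. a \<in> carrier GU \<and> b \<in> carrier GV \<and> x \<sqinter>\<^bsub>Z\<^esub> g (gm a b) \<sqsubseteq>\<^bsub>Z\<^esub> w}"

context
  fixes x w assumes x: "x \<in> carrier Z" and w: "w \<in> carrier Z"
begin

text \<open>Membership of \<open>(\<sigma>, \<tau>)\<close> supplies representatives
  \<open>a'\<close>, \<open>b'\<close> of its own; \<open>gm_dense_mono\<close> compares them with
  \<open>a\<close>, \<open>b\<close> through traces alone. This makes \<open>fibre\<close>
  independent of representatives and downward closed.\<close>

lemma fibre_antimono:
  assumes ab: "a \<in> carrier GU" "b \<in> carrier GV" and \<sigma>\<tau>: "(\<sigma>, \<tau>) \<in> fibre x w"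
    and le: "s a \<sqsubseteq>\<^bsub>S\<^esub> \<sigma>" "t b \<sqsubseteq>\<^bsub>T\<^esub> \<tau>"
  shows "x \<sqinter>\<^bsub>Z\<^esub> g (gm a b) \<sqsubseteq>\<^bsub>Z\<^esub> w"
proof -
  obtain a' b' where a': "a' \<in> carrier GU" "b' \<in> carrier GV" "\<sigma> = s a'" "\<tau> = t b'"
      "x \<sqinter>\<^bsub>Z\<^esub> g (gm a' b') \<sqsubseteq>\<^bsub>Z\<^esub> w"
    using \<sigma>\<tau> by (auto simp: fibre_def)
  show ?thesis
    by (rule meet_g_mono[OF x w gm_UV[OF ab] gm_UV[OF a'(1,2)] gm_dense_mono[OF ab a'(1,2)] a'(5)])
       (use le a' in auto)
qed

lemma fibre_iff:
  assumes ab: "a \<in> carrier GU" "b \<in> carrier GV"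
  shows "(s a, t b) \<in> fibre x w \<longleftrightarrow> x \<sqinter>\<^bsub>Z\<^esub> g (gm a b) \<sqsubseteq>\<^bsub>Z\<^esub> w"
proof
  assume h: "(s a, t b) \<in> fibre x w"
  show "x \<sqinter>\<^bsub>Z\<^esub> g (gm a b) \<sqsubseteq>\<^bsub>Z\<^esub> w"
    using fibre_antimono[OF ab h] cont_mapD(3)[OF s_cont ab(1)] cont_mapD(3)[OF t_cont ab(2)] by simp
qed (use ab in \<open>auto simp: fibre_def\<close>)

text \<open>Joins in \<open>S\<close> or \<open>T\<close> are lifted to joins in \<open>G\<close>,
  where \<open>gm\<close> is controlled by the products of the members and
  \<open>x \<sqinter> g _\<close> distributes over joins.\<close>

lemma fibre_c: "fibre x w \<in> carrier ST"
  unfolding st.carrier_prod c_ideal_def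
proof (intro conjI allI impI; (elim conjE)?)
  show sub: "fibre x w \<subseteq> carrier S \<times> carrier T"
    using s_onto t_onto by (auto simp: fibre_def)
next
  fix \<sigma> \<tau> \<sigma>' \<tau>'
  assume h: "(\<sigma>, \<tau>) \<in> fibre x w" "\<sigma>' \<in> carrier S" "\<tau>' \<in> carrier T" "\<sigma>' \<sqsubseteq>\<^bsub>S\<^esub> \<sigma>" "\<tau>' \<sqsubseteq>\<^bsub>T\<^esub> \<tau>"
  obtain a b where ab: "a \<in> carrier GU" "b \<in> carrier GV" "\<sigma>' = s a" "\<tau>' = t b"
    using h(2,3) s_onto t_onto by (metis imageE)
  then show "(\<sigma>', \<tau>') \<in> fibre x w" using fibre_antimono[OF ab(1,2) h(1)] h by (auto simp: fibre_iff)
next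
  fix K \<tau> assume h: "K \<subseteq> carrier S" "\<tau> \<in> carrier T" "\<forall>\<sigma>\<in>K. (\<sigma>, \<tau>) \<in> fibre x w"
  obtain b where b: "b \<in> carrier GV" "\<tau> = t b" using h t_onto by (metis imageE)
  define A where "A = {a \<in> carrier GU. s a \<in> K}"
  have A: "A \<subseteq> carrier GU" "A \<subseteq> carrier G" "s ` A = K"
    using h s_onto by (auto simp: A_def GU_D)
  have SA: "\<Squnion>\<^bsub>GU\<^esub>A = \<Squnion>\<^bsub>G\<^esub>A" by (rule open_sub_Sup[OF frame_axioms U A(1)])
  have c: "\<Squnion>\<^bsub>G\<^esub>A \<in> carrier GU"
    using A U sup_closed[OF A(2)] by (auto simp: carrier_open_sub intro!: sup_least)
  let ?K = "(\<lambda>a. gm a b) ` A"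
  have K: "?K \<subseteq> carrier GUV" using A b gm_UV by auto
  have "x \<sqinter>\<^bsub>Z\<^esub> g (\<Squnion>\<^bsub>G\<^esub>?K) \<sqsubseteq>\<^bsub>Z\<^esub> w"
    by (rule meet_g_Sup[OF x w K]) (use A h b fibre_iff in \<open>auto simp: A_def\<close>)
  then have "x \<sqinter>\<^bsub>Z\<^esub> g (gm (\<Squnion>\<^bsub>G\<^esub>A) b) \<sqsubseteq>\<^bsub>Z\<^esub> w"
    using meet_g_mono[OF x w gm_UV[OF c b(1)] GUV_closed[OF K] gm_Sup_left[OF A(2) GV_D(1)[OF b(1)]]] by simp
  then show "(\<Squnion>\<^bsub>S\<^esub>K, \<tau>) \<in> fibre x w"
    using fibre_iff[OF c b(1)] cont_mapD(6)[OF s_cont A(1)] A(3) SA b(2) by simp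
next
  fix \<sigma> K assume h: "\<sigma> \<in> carrier S" "K \<subseteq> carrier T" "\<forall>\<tau>\<in>K. (\<sigma>, \<tau>) \<in> fibre x w"
  obtain a where a: "a \<in> carrier GU" "\<sigma> = s a" using h s_onto by (metis imageE)
  define B where "B = {b \<in> carrier GV. t b \<in> K}"
  have B: "B \<subseteq> carrier GV" "B \<subseteq> carrier G" "t ` B = K"
    using h t_onto by (auto simp: B_def GV_D)
  have SB: "\<Squnion>\<^bsub>GV\<^esub>B = \<Squnion>\<^bsub>G\<^esub>B" by (rule open_sub_Sup[OF frame_axioms V B(1)])
  have c: "\<Squnion>\<^bsub>G\<^esub>B \<in> carrier GV"
    using B V sup_closed[OF B(2)] by (auto simp: carrier_open_sub intro!: sup_least)
  let ?K = "(\<lambda>b. gm a b) ` B"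
  have K: "?K \<subseteq> carrier GUV" using B a gm_UV by auto
  have "x \<sqinter>\<^bsub>Z\<^esub> g (\<Squnion>\<^bsub>G\<^esub>?K) \<sqsubseteq>\<^bsub>Z\<^esub> w"
    by (rule meet_g_Sup[OF x w K]) (use B h a fibre_iff in \<open>auto simp: B_def\<close>)
  then have "x \<sqinter>\<^bsub>Z\<^esub> g (gm a (\<Squnion>\<^bsub>G\<^esub>B)) \<sqsubseteq>\<^bsub>Z\<^esub> w"
    using meet_g_mono[OF x w gm_UV[OF a(1) c] GUV_closed[OF K] gm_Sup_right[OF GU_D(1)[OF a(1)] B(2)]] by simp
  then show "(\<sigma>, \<Squnion>\<^bsub>T\<^esub>K) \<in> fibre x w"
    using fibre_iff[OF a(1) c] cont_mapD(6)[OF t_cont B(1)] B(3) SB a(2) by simp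
qed

lemma subset_fibreI:
  assumes A: "A \<subseteq> carrier S \<times> carrier T"
    and h: "\<And>a b. a \<in> carrier GU \<Longrightarrow> b \<in> carrier GV \<Longrightarrow> (s a, t b) \<in> A \<Longrightarrow> x \<sqinter>\<^bsub>Z\<^esub> g (gm a b) \<sqsubseteq>\<^bsub>Z\<^esub> w"
  shows "A \<subseteq> fibre x w"
proof (rule subrelI)
  fix \<sigma> \<tau> assume st: "(\<sigma>, \<tau>) \<in> A"
  then have "\<sigma> \<in> s ` carrier GU" "\<tau> \<in> t ` carrier GV" using A s_onto t_onto by auto
  then show "(\<sigma>, \<tau>) \<in> fibre x w" using h st by (auto simp: fibre_iff)
qed

text \<open>By distributivity it suffices to treat \<open>A\<close> cut by one rectangle of
  \<open>r c\<close>. There \<open>gm a b\<close> is below \<open>c\<close>, so the additional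
  factor \<open>g c\<close> in \<open>x \<sqinter> g c \<sqinter> g (gm a b)\<close> is
  absorbed.\<close>

lemma subset_fibre_inter_r:
  assumes A: "A \<in> carrier ST" and c: "c \<in> carrier GUV"
    and h: "A \<subseteq> fibre (x \<sqinter>\<^bsub>Z\<^esub> g c) w"
  shows "A \<inter> r c \<subseteq> fibre x w"
proof -
  have cG: "c \<in> carrier G" using c by (simp add: carrier_open_sub)
  let ?f = "\<lambda>(a, b). pr1 ST T (sG a) \<sqinter>\<^bsub>ST\<^esub> pr2 ST S (tG b)"
  have ab: "a \<in> carrier G \<and> b \<in> carrier G" if "(a, b) \<in> m c" for a b
    using sq.subP[OF m_c[OF cG]] that by auto
  have fc: "?f p \<in> carrier ST" if "p \<in> m c" for p
    using that ab cont_mapD(3)[OF s1_cont] cont_mapD(3)[OF t2_cont] by (cases p) auto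
  then have im: "?f ` m c \<subseteq> carrier ST" by auto
  have rc: "r c \<in> carrier ST" by (rule cont_mapD(3)[OF r_cont cG])
  have "A \<inter> r c = A \<sqinter>\<^bsub>ST\<^esub> r c" using st.meetP[OF A rc] by simp
  also have "\<dots> = \<Squnion>\<^bsub>ST\<^esub>((\<lambda>b. A \<sqinter>\<^bsub>ST\<^esub> b) ` ?f ` m c)"
    using st.P.meet_sup_distrib[OF A im] by (simp add: prod_map_def pairing_def)
  also have "\<dots> \<sqsubseteq>\<^bsub>ST\<^esub> fibre x w"
  proof (rule st.P.sup_least[OF _ fibre_c])
    show "(\<lambda>b. A \<sqinter>\<^bsub>ST\<^esub> b) ` ?f ` m c \<subseteq> carrier ST" using A im by auto
    fix D assume "D \<in> (\<lambda>b. A \<sqinter>\<^bsub>ST\<^esub> b) ` ?f ` m c"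
    then obtain a' b' where a'b': "(a', b') \<in> m c" and D: "D = A \<sqinter>\<^bsub>ST\<^esub> ?f (a', b')" by auto
    note k = ab[OF a'b', THEN conjunct1] ab[OF a'b', THEN conjunct2]
    \<comment> \<open>The opens \<open>a'\<close>, \<open>b'\<close> range over all of
      \<open>G\<close>; they are cut to \<open>U\<close> and \<open>V\<close>, which leaves their
      traces unchanged and makes \<open>gm_dense_mono\<close> applicable.\<close>
    define a0 where "a0 = a' \<sqinter>\<^bsub>G\<^esub> U"
    define b0 where "b0 = b' \<sqinter>\<^bsub>G\<^esub> V"
    have a0: "a0 \<in> carrier GU" and b0: "b0 \<in> carrier GV"
      using k U V by (simp_all add: a0_def b0_def carrier_open_sub meet_right)
    have "(a0, b0) \<in> m c"
      by (rule m_down[OF cG a'b']) (use k U V in \<open>auto simp: a0_def b0_def intro: meet_left\<close>)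
    then have gm0: "gm a0 b0 \<sqsubseteq>\<^bsub>G\<^esub> c"
      using gm_le_iff[OF GU_D(1)[OF a0] GV_D(1)[OF b0] cG] by simp
    have f: "?f (a', b') = pr1 ST T (s a0) \<inter> pr2 ST S (t b0)"
      using st.meetP cont_mapD(3)[OF s1_cont k(1)] cont_mapD(3)[OF t2_cont k(2)]
      by (simp add: open_incl_def a0_def b0_def)
    have D': "D = A \<inter> (pr1 ST T (s a0) \<inter> pr2 ST S (t b0))"
      using D st.meetP[OF A fc[OF a'b']] f by simp
    have sc: "s a0 \<in> carrier S" "t b0 \<in> carrier T"
      using cont_mapD(3)[OF s_cont a0] cont_mapD(3)[OF t_cont b0] by auto
    have "D \<subseteq> fibre x w"
    proof (rule subset_fibreI)
      show "D \<subseteq> carrier S \<times> carrier T" using D' st.subP[OF A] by auto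
      fix a b assume a: "a \<in> carrier GU" and b: "b \<in> carrier GV" and st: "(s a, t b) \<in> D"
      have stA: "(s a, t b) \<in> A" using st D' by simp
      have stc: "s a \<in> carrier S" "t b \<in> carrier T" using st.subP[OF A] stA by auto
      \<comment> \<open>A pair in the rectangle is either degenerate, hence in every open of
        \<open>ST\<close> and so in the fibre, or below the traces of \<open>a0\<close> and
        \<open>b0\<close>.\<close>
      consider "s a = \<bottom>\<^bsub>S\<^esub>" | "t b = \<bottom>\<^bsub>T\<^esub>" | "s a \<sqsubseteq>\<^bsub>S\<^esub> s a0" "t b \<sqsubseteq>\<^bsub>T\<^esub> t b0"
        using st D' sc by (auto simp: pr1_mem pr2_mem)
      then show "x \<sqinter>\<^bsub>Z\<^esub> g (gm a b) \<sqsubseteq>\<^bsub>Z\<^esub> w"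
      proof cases
        case 1
        then show ?thesis using st.bot_mem(1)[OF fibre_c stc(2)] fibre_iff[OF a b] by simp
      next
        case 2
        then show ?thesis using st.bot_mem(2)[OF fibre_c stc(1)] fibre_iff[OF a b] by simp
      next
        case 3
        have "gm a b \<sqsubseteq>\<^bsub>G\<^esub> c"
          by (rule le_trans[OF gm_dense_mono[OF a b a0 b0 3] gm0])
             (use cG gm_c GU_D GV_D a b a0 b0 in auto)
        then have "g (gm a b) \<sqsubseteq>\<^bsub>Z\<^esub> g c" by (rule g_mono[OF gm_UV[OF a b] c])
        then have "g c \<sqinter>\<^bsub>Z\<^esub> g (gm a b) = g (gm a b)"
          using Z.meet_absorb[OF g_c[OF gm_UV[OF a b]] g_c[OF c]] by (simp add: meet_comm)
        then have "x \<sqinter>\<^bsub>Z\<^esub> g (gm a b) = (x \<sqinter>\<^bsub>Z\<^esub> g c) \<sqinter>\<^bsub>Z\<^esub> g (gm a b)"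
          using Z.meet_assoc x g_c[OF c] g_c[OF gm_UV[OF a b]] by simp
        \<comment> \<open>\<open>A\<close> is known to lie in the fibre for
          \<open>x \<sqinter> g c\<close>, so the criterion is instantiated there rather than at the
          fixed \<open>x\<close>.\<close>
        then show ?thesis
          using stA h dense_pair_over.fibre_iff[OF dense_pair_over_axioms _ w a b, of "x \<sqinter>\<^bsub>Z\<^esub> g c"] x g_c[OF c] by auto
      qed
    qed
    then show "D \<sqsubseteq>\<^bsub>ST\<^esub> fibre x w" by (simp add: st.leP)
  qed
  finally show ?thesis by (simp add: st.leP)
qed

text \<open>The converse of the balance condition, and the place where Frobenius reciprocity enters:
  \<open>gm a b \<sqinter> c\<close> is covered by products of smaller rectangles contained in
  \<open>m c\<close>. The traces of these rectangles lie in \<open>A \<inter> r c\<close>, where the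
  hypothesis bounds them by \<open>w\<close>.\<close>

lemma inter_r_subset_fibre:
  assumes A: "A \<in> carrier ST" and c: "c \<in> carrier GUV"
    and h: "A \<inter> r c \<subseteq> fibre x w"
  shows "A \<subseteq> fibre (x \<sqinter>\<^bsub>Z\<^esub> g c) w"
proof (rule dense_pair_over.subset_fibreI[OF dense_pair_over_axioms _ w st.subP[OF A]])
  have cG: "c \<in> carrier G" using c by (simp add: carrier_open_sub)
  show "x \<sqinter>\<^bsub>Z\<^esub> g c \<in> carrier Z" using x g_c[OF c] by simp
  fix a b assume a: "a \<in> carrier GU" and b: "b \<in> carrier GV" and st: "(s a, t b) \<in> A"
  note aG = GU_D(1)[OF a] and bG = GV_D(1)[OF b]
  \<comment> \<open>The products of all rectangles inside both \<open>a \<times> b\<close> and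
    \<open>m c\<close>; their join serves as the test open \<open>q\<close> for
    \<open>frobenius\<close>.\<close>
  define K where "K = {gm a' b' | a' b'. a' \<in> carrier G \<and> b' \<in> carrier G \<and> a' \<sqsubseteq>\<^bsub>G\<^esub> a \<and> b' \<sqsubseteq>\<^bsub>G\<^esub> b \<and> (a', b') \<in> m c}"
  have a': "a' \<in> carrier GU" if "a' \<in> carrier G" "a' \<sqsubseteq>\<^bsub>G\<^esub> a" for a'
    using le_trans[OF that(2) GU_D(2)[OF a]] that aG U by (simp add: carrier_open_sub)
  have b': "b' \<in> carrier GV" if "b' \<in> carrier G" "b' \<sqsubseteq>\<^bsub>G\<^esub> b" for b'
    using le_trans[OF that(2) GV_D(2)[OF b]] that bG V by (simp add: carrier_open_sub)
  have K: "K \<subseteq> carrier GUV" using gm_UV[OF a' b'] by (auto simp: K_def)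
  have KG: "K \<subseteq> carrier G" using K by (auto simp: carrier_open_sub)
  have q: "\<Squnion>\<^bsub>G\<^esub>K \<in> carrier G" by (rule sup_closed[OF KG])
  have "rect GG a b \<inter> m c \<subseteq> m (\<Squnion>\<^bsub>G\<^esub>K)"
  proof (rule subrelI)
    fix a1 b1 assume p: "(a1, b1) \<in> rect GG a b \<inter> m c"
    have k: "a1 \<in> carrier G" "b1 \<in> carrier G" using p sq.subP[OF m_c[OF cG]] by auto
    have "(a1, b1) \<in> m (\<Squnion>\<^bsub>G\<^esub>K)" if "a1 \<sqsubseteq>\<^bsub>G\<^esub> a" "b1 \<sqsubseteq>\<^bsub>G\<^esub> b"
      using sup_upper[OF KG, of "gm a1 b1"] gm_le_iff[OF k q] that p k by (auto simp: K_def)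
    \<comment> \<open>By \<open>rect_eq\<close> the remaining pairs of the rectangle are degenerate,
      and those belong to every open.\<close>
    then show "(a1, b1) \<in> m (\<Squnion>\<^bsub>G\<^esub>K)"
      using p sq.rect_eq[OF aG bG] sq.bot_mem[OF m_c[OF q]] k by auto
  qed
  then have "gm a b \<sqinter>\<^bsub>G\<^esub> c \<sqsubseteq>\<^bsub>G\<^esub> \<Squnion>\<^bsub>G\<^esub>K" by (rule frobenius[OF aG bG cG q])
  moreover have "x \<sqinter>\<^bsub>Z\<^esub> g (\<Squnion>\<^bsub>G\<^esub>K) \<sqsubseteq>\<^bsub>Z\<^esub> w"
  proof (rule meet_g_Sup[OF x w K])
    fix y assume "y \<in> K"
    then obtain a1 b1 where y: "y = gm a1 b1" and k: "a1 \<in> carrier G" "b1 \<in> carrier G"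
        and le: "a1 \<sqsubseteq>\<^bsub>G\<^esub> a" "b1 \<sqsubseteq>\<^bsub>G\<^esub> b" and mc: "(a1, b1) \<in> m c" by (auto simp: K_def)
    note a1 = a'[OF k(1) le(1)] and b1 = b'[OF k(2) le(2)]
    have "s a1 \<sqsubseteq>\<^bsub>S\<^esub> s a" "t b1 \<sqsubseteq>\<^bsub>T\<^esub> t b"
      using cont_mapD(8)[OF s_cont a1 a] cont_mapD(8)[OF t_cont b1 b] le by (simp_all add: le_open_sub)
    then have "(s a1, t b1) \<in> A"
      by (intro c_idealD(2)[OF st.ciP[OF A] st] cont_mapD(3)[OF s_cont a1] cont_mapD(3)[OF t_cont b1])
    then show "x \<sqinter>\<^bsub>Z\<^esub> g y \<sqsubseteq>\<^bsub>Z\<^esub> w" using h r_mem[OF cG mc a1 b1] fibre_iff[OF a1 b1] y by auto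
  qed
  moreover have m: "gm a b \<sqinter>\<^bsub>GUV\<^esub> c = gm a b \<sqinter>\<^bsub>G\<^esub> c"
    using open_sub_meet[OF frame_axioms UV_c] gm_UV[OF a b] c by (simp add: carrier_open_sub)
  moreover have mc: "gm a b \<sqinter>\<^bsub>G\<^esub> c \<in> carrier GUV"
    using gm_UV[OF a b] c UV_c le_trans[OF meet_right, of "gm a b" c UV] by (auto simp: carrier_open_sub)
  ultimately have "x \<sqinter>\<^bsub>Z\<^esub> g (gm a b \<sqinter>\<^bsub>GUV\<^esub> c) \<sqsubseteq>\<^bsub>Z\<^esub> w"
    using meet_g_mono[OF x w mc GUV_closed[OF K]] by simp
  then show "(x \<sqinter>\<^bsub>Z\<^esub> g c) \<sqinter>\<^bsub>Z\<^esub> g (gm a b) \<sqsubseteq>\<^bsub>Z\<^esub> w"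
    using cont_mapD(5)[OF g_cont gm_UV[OF a b] c] Z.meet_assoc[OF x g_c[OF c] g_c[OF gm_UV[OF a b]]]
    by (simp add: meet_comm)
qed

end

section \<open>The pullback and its projection to the base\<close>

abbreviation "Q \<equiv> pullback Z ST GUV g r"

lemma pullback_square: "pullback_square Z ST GUV g r"
  by (intro pullback_square.intro pullback_square_axioms.intro Z.frame_axioms st.P.frame_axioms
        g_cont r_corestrict)

text \<open>Closure in \<open>x\<close> is distributivity in \<open>Z\<close>; closure in
  \<open>A\<close> holds because each fibre is itself an open of \<open>ST\<close>. The relation
  identifying \<open>g c \<times> \<top>\<close> with \<open>\<top> \<times> r c\<close> is the pair
  of inclusions just proved.\<close>

lemma fibres_c:
  assumes w: "w \<in> carrier Z"
  shows "{(x, A). x \<in> carrier Z \<and> A \<in> carrier ST \<and> A \<subseteq> fibre x w} \<in> carrier Q" (is "?D \<in> _")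
proof -
  have "c_ideal Z ST ?D"
    unfolding c_ideal_def
  proof (intro conjI allI impI; (elim conjE)?)
    show "?D \<subseteq> carrier Z \<times> carrier ST" by auto
  next
    fix x A x' A' assume h: "(x, A) \<in> ?D" "x' \<in> carrier Z" "A' \<in> carrier ST" "x' \<sqsubseteq>\<^bsub>Z\<^esub> x" "A' \<sqsubseteq>\<^bsub>ST\<^esub> A"
    have x: "x \<in> carrier Z" using h by auto
    have "A' \<subseteq> fibre x' w"
    proof (rule subset_fibreI[OF h(2) w st.subP[OF h(3)]])
      fix a b assume a: "a \<in> carrier GU" and b: "b \<in> carrier GV" and "(s a, t b) \<in> A'"
      then have le: "x \<sqinter>\<^bsub>Z\<^esub> g (gm a b) \<sqsubseteq>\<^bsub>Z\<^esub> w" using h fibre_iff[OF x w a b] by (auto simp: st.leP)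
      have gc: "g (gm a b) \<in> carrier Z" by (rule g_c[OF gm_UV[OF a b]])
      show "x' \<sqinter>\<^bsub>Z\<^esub> g (gm a b) \<sqsubseteq>\<^bsub>Z\<^esub> w"
        by (rule Z.le_trans[OF Z.meet_mono[OF h(4) Z.le_refl[OF gc]] le]) (use x h gc w in auto)
    qed
    then show "(x', A') \<in> ?D" using h by simp
  next
    fix K A assume h: "K \<subseteq> carrier Z" "A \<in> carrier ST" "\<forall>x\<in>K. (x, A) \<in> ?D"
    have SK: "\<Squnion>\<^bsub>Z\<^esub>K \<in> carrier Z" by (rule Z.sup_closed[OF h(1)])
    have "A \<subseteq> fibre (\<Squnion>\<^bsub>Z\<^esub>K) w"
    proof (rule subset_fibreI[OF SK w st.subP[OF h(2)]])
      fix a b assume a: "a \<in> carrier GU" and b: "b \<in> carrier GV" and st: "(s a, t b) \<in> A"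
      have gc: "g (gm a b) \<in> carrier Z" by (rule g_c[OF gm_UV[OF a b]])
      have "x \<sqinter>\<^bsub>Z\<^esub> g (gm a b) \<sqsubseteq>\<^bsub>Z\<^esub> w" if "x \<in> K" for x
        using h that st fibre_iff[OF _ w a b, of x] by auto
      then show "\<Squnion>\<^bsub>Z\<^esub>K \<sqinter>\<^bsub>Z\<^esub> g (gm a b) \<sqsubseteq>\<^bsub>Z\<^esub> w"
        unfolding Z.sup_meet_distrib[OF gc h(1)] using h(1) gc w by (auto intro!: Z.sup_least)
    qed
    then show "(\<Squnion>\<^bsub>Z\<^esub>K, A) \<in> ?D" using h SK by simp
  next
    fix x K assume h: "x \<in> carrier Z" "K \<subseteq> carrier ST" "\<forall>A\<in>K. (x, A) \<in> ?D"
    have "\<Squnion>\<^bsub>ST\<^esub>K \<sqsubseteq>\<^bsub>ST\<^esub> fibre x w"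
      by (rule st.P.sup_least[OF h(2) fibre_c[OF h(1) w]]) (use h in \<open>auto simp: st.leP\<close>)
    then show "(x, \<Squnion>\<^bsub>ST\<^esub>K) \<in> ?D" using h st.P.sup_closed[OF h(2)] by (simp add: st.leP)
  qed
  moreover have "(x \<sqinter>\<^bsub>Z\<^esub> g c, A) \<in> ?D \<longleftrightarrow> (x, A \<sqinter>\<^bsub>ST\<^esub> r c) \<in> ?D"
    if x: "x \<in> carrier Z" and A: "A \<in> carrier ST" and c: "c \<in> carrier GUV" for x A c
  proof -
    have rc: "r c \<in> carrier ST" by (rule cont_mapD(3)[OF r_corestrict c])
    have "A \<subseteq> fibre (x \<sqinter>\<^bsub>Z\<^esub> g c) w \<longleftrightarrow> A \<sqinter>\<^bsub>ST\<^esub> r c \<subseteq> fibre x w"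
      unfolding st.meetP[OF A rc]
      using subset_fibre_inter_r[OF x w A c] inter_r_subset_fibre[OF x w A c] by auto
    then show ?thesis using x A rc g_c[OF c] st.P.meet_closed[OF A rc] Z.meet_closed[OF x] by simp
  qed
  ultimately show ?thesis by (simp add: pullback_def)
qed

text \<open>The open \<open>?D\<close> contains \<open>(w, \<top>)\<close>, hence all of
  \<open>pr1 Q ST w\<close>. If this equals \<open>pr1 Q ST z\<close>, then
  \<open>(z, \<top>)\<close> lies in \<open>?D\<close> as well, and the fibre criterion returns a
  bound on \<open>z\<close>.\<close>

lemma pr1_reflects_le:
  assumes z: "z \<in> carrier Z" and w: "w \<in> carrier Z" and eq: "pr1 Q ST z = pr1 Q ST w"
  shows "z \<sqsubseteq>\<^bsub>Z\<^esub> w"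
proof -
  interpret Q: pullback_square Z ST GUV g r by (rule pullback_square)
  let ?D = "{(x, A). x \<in> carrier Z \<and> A \<in> carrier ST \<and> A \<subseteq> fibre x w}"
  have top: "\<top>\<^bsub>ST\<^esub> \<in> carrier ST" by simp
  have "\<top>\<^bsub>ST\<^esub> \<subseteq> fibre w w"
    by (rule subset_fibreI[OF w w st.subP[OF top]]) (use w g_c gm_UV in \<open>auto intro: Z.meet_left\<close>)
  then have "(w, \<top>\<^bsub>ST\<^esub>) \<in> ?D" using w by simp
  then have "rect Q w \<top>\<^bsub>ST\<^esub> \<subseteq> ?D" by (rule Q.rect_le[OF fibres_c[OF w]])
  then have "(z, \<top>\<^bsub>ST\<^esub>) \<in> ?D" using eq Q.rect_mem[of z "\<top>\<^bsub>ST\<^esub>"] by (auto simp: pr1_def)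
  \<comment> \<open>The criterion is tested at \<open>(U, V)\<close>, whose product
    \<open>UV\<close> is the top of \<open>GUV\<close>, so that \<open>g UV = \<top>\<close> and the
    bound becomes \<open>z \<sqsubseteq> w\<close>.\<close>
  moreover have "(s U, t V) \<in> \<top>\<^bsub>ST\<^esub>"
    using st.topP cont_mapD(3)[OF s_cont U_GU] cont_mapD(3)[OF t_cont V_GV] by simp
  ultimately have "z \<sqinter>\<^bsub>Z\<^esub> g UV \<sqsubseteq>\<^bsub>Z\<^esub> w" using fibre_iff[OF z w U_GU V_GV] by auto
  moreover have "g UV = \<top>\<^bsub>Z\<^esub>" using cont_mapD(4)[OF g_cont] open_sub_top[OF frame_axioms UV_c] by simp
  ultimately show ?thesis using Z.meet_top(1)[OF z] by simp
qed

text \<open>Composition of maps is reversed composition of inverse images, so an injective inverse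
  image can be cancelled; this works for every test locale \<open>W\<close>.\<close>

lemma epi_pr1: "epi TYPE('w) Q Z (pr1 Q ST)"
proof -
  interpret Q: pullback_square Z ST GUV g r by (rule pullback_square)
  have "z = w" if "z \<in> carrier Z" "w \<in> carrier Z" "pr1 Q ST z = pr1 Q ST w" for z w
    using pr1_reflects_le[of z w] pr1_reflects_le[of w z] that by (simp add: Z.le_antisym)
  then have inj: "inj_on (pr1 Q ST) (carrier Z)" by (rule inj_onI)
  show ?thesis
    unfolding epi_def
  proof (intro conjI allI impI Q.pr1_cont)
    fix W :: "'w gorder" and u v
    assume uv: "cont_map Z W u \<and> cont_map Z W v \<and> map_eq W (u \<odot> pr1 Q ST) (v \<odot> pr1 Q ST)"
    show "map_eq W u v"
      unfolding map_eq_def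
    proof
      fix y assume y: "y \<in> carrier W"
      have "pr1 Q ST (u y) = pr1 Q ST (v y)" using uv y by (simp add: map_eq_def)
      then show "u y = v y"
        by (rule inj_onD[OF inj]) (use uv y in \<open>auto intro: cont_mapD(3)\<close>)
    qed
  qed
qed

end

text \<open>The corestriction to \<open>U \<cdot> V\<close> is the same function as the restriction
  of \<open>m\<close>, read on fewer opens. The \<open>map_eq\<close> clause certifies that
  following it by the open inclusion returns the restricted multiplication.\<close>

theorem theorem3p2:
  fixes G :: "'g gorder" and S :: "'s gorder" and T :: "'t gorder"
    and m :: "'g \<Rightarrow> ('g \<times> 'g) set" and e :: "'g \<Rightarrow> bool" and i :: "'g \<Rightarrow> 'g"
    and s :: "'g \<Rightarrow> 's" and t :: "'g \<Rightarrow> 't" and U V :: 'g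
  assumes "localic_group G m e i"
    and "U \<in> carrier G" and "V \<in> carrier G"
    and "dense_sublocale S (open_sub G U) s"
    and "dense_sublocale T (open_sub G V) t"
  shows "let UV = group_mult_opens G m U V;
             r = m \<odot> prod_map S T (open_incl G U \<odot> s) (open_incl G V \<odot> t)
         in UV \<in> carrier G \<and>
            cont_map (S \<times>\<^sub>L T) (open_sub G UV) r \<and>
            map_eq G (open_incl G UV \<odot> r)
                     (m \<odot> prod_map S T (open_incl G U \<odot> s) (open_incl G V \<odot> t)) \<and>
            pullback_stable_epi TYPE('z) TYPE('w) (S \<times>\<^sub>L T) (open_sub G UV) r"
proof -
  interpret dense_pair G m e i S T s t U V
    using assms by unfold_locales
  have "pullback_stable_epi TYPE('z) TYPE('w) ST (open_sub G UV) r"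
    unfolding pullback_stable_epi_def Let_def
  proof (intro conjI allI impI)
    show "cont_map ST (open_sub G UV) r" by (rule r_corestrict)
    fix Z :: "'z gorder" and g assume "cont_map Z (open_sub G UV) g"
    then interpret dense_pair_over G m e i S T s t U V Z g by unfold_locales
    show "epi TYPE('w) Q Z (pr1 Q ST)" by (rule epi_pr1)
  qed
  then show ?thesis
    unfolding Let_def by (intro conjI UV_c r_corestrict r_open_incl)
qed

end
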